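(* Let $(\mathbb A,\mathsf E,\mathsf M)$ be a context. The collection of perfect morphisms is pullback stable, closed under composition, and satisfies the following properties, for preneighbourhood morphisms $f:(X,\mu)\to(Y,\phi)$ and $g:(Y,\phi)\to(Z,\psi)$: (a) If every preneighbourhood morphism is continuous then every closed embedding is perfect. (b) If $g\circ f$ is perfect and $f$ is a proper morphism, stably continuous and stably in $\mathsf E$, then $g$ is perfect. (c) If $g\circ f$ is proper and $g$ is separated then $f$ is proper. (d) If $g\circ f$ is perfect and $g$ is separated then $f$ is perfect.
   Context: A context is a triple $(\mathbb A,\mathsf E,\mathsf M)$ where $\mathbb A$ is a finitely complete category with finite coproducts, $(\mathsf E,\mathsf M)$ is a proper factorization system on $\mathbb A$ ($\mathsf E\subseteq$ epimorphisms, $\mathsf M\subseteq$ monomorphisms), and for each object $X$ the poset $\mathrm{Sub}(X)$ of admissible subobjects of $X$ ($\mathsf M$-morphisms with codomain $X$, equivalent ones identified) is a complete lattice, with largest element $\mathrm{id}_X$ and smallest element $\sigma_X$ (the $\mathsf M$-part of the factorization of the unique morphism from the initial object to $X$). For $f:X\to Y$, $\exists_f m$ is the $\mathsf M$-part of the factorization of $f\circ m$ ($m\in\mathrm{Sub}(X)$) and $f^{-1}n$ is the pullback of $n\in\mathrm{Sub}(Y)$ along $f$. A filter on $X$ is an up-closed subset of $\mathrm{Sub}(X)$ closed under finite meets; filters $\mathrm{Fil}(X)$ are ordered by inclusion. A preneighbourhood system on $X$ is an order preserving map $\mu:\mathrm{Sub}(X)^{\mathrm{op}}\to\mathrm{Fil}(X)$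 with $\mu(\sigma_X)=\mathrm{Sub}(X)$ and $p\in\mu(m)\Rightarrow m\leq p$; $(X,\mu)$ is then an internal preneighbourhood space. A preneighbourhood morphism $f:(X,\mu)\to(Y,\phi)$ is a morphism $f:X\to Y$ such that $p\in\phi(u)\Rightarrow f^{-1}p\in\mu(f^{-1}u)$. Limits of preneighbourhood spaces carry the smallest preneighbourhood system making the projections preneighbourhood morphisms; in particular for $m:M\to X$ in $\mathsf M$, $M$ carries $\mu|_m(a)=\{u\in\mathrm{Sub}(M):(\exists v\in\mu(m\circ a))(m^{-1}v\leq u)\}$. Define $\mathtt{Far}_\mu p=\{x\in\mathrm{Sub}(X):(\exists u\in\mu(x))(u\wedge p=\sigma_X)\}$, $\mathrm{cl}_\mu p=\bigvee\{x\in\mathrm{Sub}(X): p\not< x\text{ and }x\notin\mathtt{Far}_\mu p\}$, and $\mathfrak C_\mu=\{p:\mathrm{cl}_\mu p=p\}$. A closed embedding is a morphism $m:(M,\mu|_m)\to(X,\mu)$ with $m\in\mathfrak C_\mu$. For preneighbourhood spaces $(X,\mu)$, $(Y,\phi)$, a morphism $f:X\to Y$ is closed if $p\in\mathfrak C_\mu\Rightarrow\exists_f p\in\mathfrak C_\phi$, and continuous if $t\in\mathfrak C_\phi\Rightarrow f^{-1}t\in\mathfrak C_\mu$. A preneighbourhood morphism $f$ is proper if its pullback along every preneighbourhood morphism is closed; it is stably continuous (stably in $\mathsf E$) if its pullback along every preneighbourhood morphism is continuous (in $\mathsf E$). For a preneighbourhood morphism $f:(X,\mu)\to(Y,\phi)$,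 let $X\times_Y X$ be its kernel pair with the pullback preneighbourhood system and $d_f=(\mathrm{id}_X,\mathrm{id}_X):(X,\mu)\to X\times_Y X$ the diagonal; $f$ is separated if $d_f$ is proper. A preneighbourhood morphism is perfect if it is both proper and separated.
   Formalization: Pullbacks of preneighbourhood spaces do not exist in every context, so a pullback here must have the universal property besides the smallest system; proper and separated include existence of the needed pullbacks, and (b) assumes that the pullbacks of g exist. *)

theory Defs
  imports "HOL-Algebra.Complete_Lattice"
begin

section \<open>Categories\<close>

record ('o, 'a) category =
  Obj :: "'o set"
  Arr :: "'a set"
  Dom :: "'a \<Rightarrow> 'o"
  Cod :: "'a \<Rightarrow> 'o"
  Id :: "'o \<Rightarrow> 'a"
  Comp :: "'a \<Rightarrow> 'a \<Rightarrow> 'a" (infixl \<open>\<cdot>\<index>\<close> 70)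

text \<open>\<open>g \<cdot> f\<close> is ``\<open>g\<close> after \<open>f\<close>''; it is only meaningful if \<open>Cod f = Dom g\<close>.\<close>

definition Hom :: "('o, 'a, 'r) category_scheme \<Rightarrow> 'o \<Rightarrow> 'o \<Rightarrow> 'a set" where
  "Hom C X Y = {f \<in> Arr C. Dom C f = X \<and> Cod C f = Y}"

locale category =
  fixes C :: "('o, 'a, 'r) category_scheme" (structure)
  assumes Dom_Obj: "f \<in> Arr C \<Longrightarrow> Dom C f \<in> Obj C"
    and Cod_Obj: "f \<in> Arr C \<Longrightarrow> Cod C f \<in> Obj C"
    and Id_Hom: "X \<in> Obj C \<Longrightarrow> Id C X \<in> Hom C X X"
    and Comp_Hom: "\<lbrakk>f \<in> Hom C X Y; g \<in> Hom C Y Z\<rbrakk> \<Longrightarrow> g \<cdot> f \<in> Hom C X Z"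
    and Comp_Id: "f \<in> Arr C \<Longrightarrow> f \<cdot> Id C (Dom C f) = f"
    and Id_Comp: "f \<in> Arr C \<Longrightarrow> Id C (Cod C f) \<cdot> f = f"
    and Comp_assoc: "\<lbrakk>f \<in> Hom C W X; g \<in> Hom C X Y; h \<in> Hom C Y Z\<rbrakk>
      \<Longrightarrow> h \<cdot> (g \<cdot> f) = (h \<cdot> g) \<cdot> f"

definition is_iso :: "('o, 'a, 'r) category_scheme \<Rightarrow> 'a \<Rightarrow> bool" where
  "is_iso C f \<longleftrightarrow> f \<in> Arr C \<and>
     (\<exists>g \<in> Hom C (Cod C f) (Dom C f).
        g \<cdot>\<^bsub>C\<^esub> f = Id C (Dom C f) \<and> f \<cdot>\<^bsub>C\<^esub> g = Id C (Cod C f))"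

definition is_mono :: "('o, 'a, 'r) category_scheme \<Rightarrow> 'a \<Rightarrow> bool" where
  "is_mono C f \<longleftrightarrow> f \<in> Arr C \<and>
     (\<forall>X. \<forall>g \<in> Hom C X (Dom C f). \<forall>h \<in> Hom C X (Dom C f).
        f \<cdot>\<^bsub>C\<^esub> g = f \<cdot>\<^bsub>C\<^esub> h \<longrightarrow> g = h)"

definition is_epi :: "('o, 'a, 'r) category_scheme \<Rightarrow> 'a \<Rightarrow> bool" where
  "is_epi C f \<longleftrightarrow> f \<in> Arr C \<and>
     (\<forall>Y. \<forall>g \<in> Hom C (Cod C f) Y. \<forall>h \<in> Hom C (Cod C f) Y.
        g \<cdot>\<^bsub>C\<^esub> f = h \<cdot>\<^bsub>C\<^esub> f \<longrightarrow> g = h)"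

definition is_initial :: "('o, 'a, 'r) category_scheme \<Rightarrow> 'o \<Rightarrow> bool" where
  "is_initial C I \<longleftrightarrow> I \<in> Obj C \<and> (\<forall>X \<in> Obj C. \<exists>!f. f \<in> Hom C I X)"

definition is_terminal :: "('o, 'a, 'r) category_scheme \<Rightarrow> 'o \<Rightarrow> bool" where
  "is_terminal C T \<longleftrightarrow> T \<in> Obj C \<and> (\<forall>X \<in> Obj C. \<exists>!f. f \<in> Hom C X T)"

definition is_coproduct ::
    "('o, 'a, 'r) category_scheme \<Rightarrow> 'o \<Rightarrow> 'o \<Rightarrow> 'a \<Rightarrow> 'a \<Rightarrow> bool" where
  "is_coproduct C X Y i j \<longleftrightarrow>
     i \<in> Hom C X (Cod C i) \<and> j \<in> Hom C Y (Cod C i) \<and>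
     (\<forall>Z. \<forall>a \<in> Hom C X Z. \<forall>b \<in> Hom C Y Z.
        \<exists>!t. t \<in> Hom C (Cod C i) Z \<and> t \<cdot>\<^bsub>C\<^esub> i = a \<and> t \<cdot>\<^bsub>C\<^esub> j = b)"

text \<open>
  In \<open>is_pullback C f h p q\<close> the cospan is \<open>f : X \<rightarrow> Y\<close>, \<open>h : W \<rightarrow> Y\<close>, and the
  projections are \<open>p : P \<rightarrow> X\<close>, \<open>q : P \<rightarrow> W\<close>; so \<open>q\<close> is the pullback of \<open>f\<close> along \<open>h\<close>.
\<close>

definition is_pullback ::
    "('o, 'a, 'r) category_scheme \<Rightarrow> 'a \<Rightarrow> 'a \<Rightarrow> 'a \<Rightarrow> 'a \<Rightarrow> bool" where
  "is_pullback C f h p q \<longleftrightarrow>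
     f \<in> Arr C \<and> h \<in> Hom C (Dom C h) (Cod C f) \<and>
     p \<in> Hom C (Dom C p) (Dom C f) \<and> q \<in> Hom C (Dom C p) (Dom C h) \<and>
     f \<cdot>\<^bsub>C\<^esub> p = h \<cdot>\<^bsub>C\<^esub> q \<and>
     (\<forall>T. \<forall>a \<in> Hom C T (Dom C f). \<forall>b \<in> Hom C T (Dom C h).
        f \<cdot>\<^bsub>C\<^esub> a = h \<cdot>\<^bsub>C\<^esub> b \<longrightarrow>
        (\<exists>!t. t \<in> Hom C T (Dom C p) \<and> p \<cdot>\<^bsub>C\<^esub> t = a \<and> q \<cdot>\<^bsub>C\<^esub> t = b))"

definition finitely_complete :: "('o, 'a, 'r) category_scheme \<Rightarrow> bool" where
  "finitely_complete C \<longleftrightarrow> (\<exists>T. is_terminal C T) \<and>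
     (\<forall>f \<in> Arr C. \<forall>h \<in> Arr C. Cod C f = Cod C h \<longrightarrow> (\<exists>p q. is_pullback C f h p q))"

definition has_finite_coproducts :: "('o, 'a, 'r) category_scheme \<Rightarrow> bool" where
  "has_finite_coproducts C \<longleftrightarrow> (\<exists>I. is_initial C I) \<and>
     (\<forall>X \<in> Obj C. \<forall>Y \<in> Obj C. \<exists>i j. is_coproduct C X Y i j)"


section \<open>Admissible subobjects\<close>

record ('o, 'a) fact_category = "('o, 'a) category" +
  EE :: "'a set"
  MM :: "'a set"

locale proper_factorization = category C
  for C :: "('o, 'a) fact_category" (structure) +
  assumes EE_epi: "e \<in> EE C \<Longrightarrow> is_epi C e"
    and MM_mono: "m \<in> MM C \<Longrightarrow> is_mono C m"
    and iso_EE: "is_iso C f \<Longrightarrow> f \<in> EE C"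
    and iso_MM: "is_iso C f \<Longrightarrow> f \<in> MM C"
    and EE_Comp: "\<lbrakk>d \<in> EE C; e \<in> EE C; Cod C d = Dom C e\<rbrakk> \<Longrightarrow> e \<cdot> d \<in> EE C"
    and MM_Comp: "\<lbrakk>m \<in> MM C; n \<in> MM C; Cod C m = Dom C n\<rbrakk> \<Longrightarrow> n \<cdot> m \<in> MM C"
    and factorization: "f \<in> Arr C \<Longrightarrow>
      \<exists>e \<in> EE C. \<exists>m \<in> MM C. Cod C e = Dom C m \<and> f = m \<cdot> e"
    and diagonal: "\<lbrakk>e \<in> EE C; m \<in> MM C; u \<in> Hom C (Dom C e) (Dom C m);
      v \<in> Hom C (Cod C e) (Cod C m); m \<cdot> u = v \<cdot> e\<rbrakk>
      \<Longrightarrow> \<exists>!d. d \<in> Hom C (Cod C e) (Dom C m) \<and> d \<cdot> e = u \<and> m \<cdot> d = v"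

definition factors_through :: "('o, 'a) fact_category \<Rightarrow> 'a \<Rightarrow> 'a \<Rightarrow> bool" where
  "factors_through C m n \<longleftrightarrow>
     Cod C m = Cod C n \<and> (\<exists>k \<in> Hom C (Dom C m) (Dom C n). m = n \<cdot>\<^bsub>C\<^esub> k)"

text \<open>An admissible subobject is the class of all \<open>\<M>\<close>-morphisms equivalent to a given one.\<close>

definition subobj :: "('o, 'a) fact_category \<Rightarrow> 'a \<Rightarrow> 'a set" where
  "subobj C m = {n \<in> MM C. factors_through C m n \<and> factors_through C n m}"

definition Sub :: "('o, 'a) fact_category \<Rightarrow> 'o \<Rightarrow> 'a set gorder" where
  "Sub C X = \<lparr>carrier = {subobj C m | m. m \<in> MM C \<and> Cod C m = X}, eq = (=),
     le = (\<lambda>p q. \<exists>m \<in> p. \<exists>n \<in> q. factors_through C m n)\<rparr>"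

text \<open>
  The \<open>\<M>\<close>-part of a factorization is only determined up to equivalence: \<open>M_part C f\<close>
  collects all possible choices, and so it is again an admissible subobject.  Likewise
  \<open>inverse_image\<close> collects all pullbacks of all representatives.
\<close>

definition M_part :: "('o, 'a) fact_category \<Rightarrow> 'a \<Rightarrow> 'a set" where
  "M_part C f = {m \<in> MM C. \<exists>e \<in> EE C. Cod C e = Dom C m \<and> f = m \<cdot>\<^bsub>C\<^esub> e}"

definition direct_image :: "('o, 'a) fact_category \<Rightarrow> 'a \<Rightarrow> 'a set \<Rightarrow> 'a set" where
  "direct_image C f p = (\<Union>m \<in> p. M_part C (f \<cdot>\<^bsub>C\<^esub> m))"

definition inverse_image :: "('o, 'a) fact_category \<Rightarrow> 'a \<Rightarrow> 'a set \<Rightarrow> 'a set" where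
  "inverse_image C f p = {m. \<exists>n \<in> p. \<exists>k. is_pullback C f n m k}"

definition comp_sub :: "('o, 'a) fact_category \<Rightarrow> 'a \<Rightarrow> 'a set \<Rightarrow> 'a set" where
  "comp_sub C m p = (\<Union>n \<in> p. subobj C (m \<cdot>\<^bsub>C\<^esub> n))"

definition sigma :: "('o, 'a) fact_category \<Rightarrow> 'o \<Rightarrow> 'a set" where
  "sigma C X = (\<Union>i \<in> {i. \<exists>I. is_initial C I \<and> i \<in> Hom C I X}. M_part C i)"

locale nbd_context = proper_factorization C
  for C :: "('o, 'a) fact_category" (structure) +
  assumes finitely_complete: "finitely_complete C"
    and finite_coproducts: "has_finite_coproducts C"
    and Sub_complete: "X \<in> Obj C \<Longrightarrow> complete_lattice (Sub C X)"


section \<open>Preneighbourhood spaces\<close>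

text \<open>The empty meet is included, so a filter contains the largest subobject.\<close>

definition is_filter :: "('o, 'a) fact_category \<Rightarrow> 'o \<Rightarrow> 'a set set \<Rightarrow> bool" where
  "is_filter C X F \<longleftrightarrow>
     F \<subseteq> carrier (Sub C X) \<and>
     (\<forall>p \<in> F. \<forall>q \<in> carrier (Sub C X). p \<sqsubseteq>\<^bsub>Sub C X\<^esub> q \<longrightarrow> q \<in> F) \<and>
     \<top>\<^bsub>Sub C X\<^esub> \<in> F \<and>
     (\<forall>p \<in> F. \<forall>q \<in> F. p \<sqinter>\<^bsub>Sub C X\<^esub> q \<in> F)"

text \<open>Only the values of \<open>\<mu>\<close> on \<open>carrier (Sub C X)\<close> matter, here and below.\<close>

definition is_pns ::
    "('o, 'a) fact_category \<Rightarrow> 'o \<Rightarrow> ('a set \<Rightarrow> 'a set set) \<Rightarrow> bool" where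
  "is_pns C X \<mu> \<longleftrightarrow> X \<in> Obj C \<and>
     (\<forall>m \<in> carrier (Sub C X). is_filter C X (\<mu> m)) \<and>
     (\<forall>m \<in> carrier (Sub C X). \<forall>n \<in> carrier (Sub C X).
        m \<sqsubseteq>\<^bsub>Sub C X\<^esub> n \<longrightarrow> \<mu> n \<subseteq> \<mu> m) \<and>
     \<mu> (sigma C X) = carrier (Sub C X) \<and>
     (\<forall>m \<in> carrier (Sub C X). \<forall>p \<in> \<mu> m. m \<sqsubseteq>\<^bsub>Sub C X\<^esub> p)"

text \<open>\<open>pn_morphism C \<mu> \<phi> f\<close>: \<open>f\<close> is a preneighbourhood morphism
  \<open>(Dom f, \<mu>) \<rightarrow> (Cod f, \<phi>)\<close>.\<close>

definition pn_morphism :: "('o, 'a) fact_category \<Rightarrow>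
    ('a set \<Rightarrow> 'a set set) \<Rightarrow> ('a set \<Rightarrow> 'a set set) \<Rightarrow> 'a \<Rightarrow> bool" where
  "pn_morphism C \<mu> \<phi> f \<longleftrightarrow>
     f \<in> Arr C \<and> is_pns C (Dom C f) \<mu> \<and> is_pns C (Cod C f) \<phi> \<and>
     (\<forall>u \<in> carrier (Sub C (Cod C f)). \<forall>p \<in> \<phi> u.
        inverse_image C f p \<in> \<mu> (inverse_image C f u))"

definition restrict_pns ::
    "('o, 'a) fact_category \<Rightarrow> ('a set \<Rightarrow> 'a set set) \<Rightarrow> 'a \<Rightarrow> 'a set \<Rightarrow> 'a set set" where
  "restrict_pns C \<mu> m a =
     {u \<in> carrier (Sub C (Dom C m)).
        \<exists>v \<in> \<mu> (comp_sub C m a). inverse_image C m v \<sqsubseteq>\<^bsub>Sub C (Dom C m)\<^esub> u}"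

text \<open>
  Pullback of \<open>f : (X, \<mu>) \<rightarrow> (Y, \<phi>)\<close> along \<open>h : (W, \<omega>) \<rightarrow> (Y, \<phi>)\<close> in the category of
  preneighbourhood spaces.  The pullback of the underlying morphisms carries the smallest
  system making the projections preneighbourhood morphisms.  The last conjunct is the
  universal property with respect to preneighbourhood morphisms: it has to be demanded,
  because the smallest system need not have it in every context.  The condition
  \<open>\<rho> (\<sigma>) = Sub P\<close> gets in the way when \<open>\<sigma>\<close> is not preserved by inverse images.
\<close>

definition pn_pullback :: "('o, 'a) fact_category \<Rightarrow>
    ('a set \<Rightarrow> 'a set set) \<Rightarrow> ('a set \<Rightarrow> 'a set set) \<Rightarrow> ('a set \<Rightarrow> 'a set set) \<Rightarrow>
    'a \<Rightarrow> 'a \<Rightarrow> ('a set \<Rightarrow> 'a set set) \<Rightarrow> 'a \<Rightarrow> 'a \<Rightarrow> bool" where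
  "pn_pullback C \<mu> \<phi> \<omega> f h \<rho> p q \<longleftrightarrow>
     pn_morphism C \<mu> \<phi> f \<and> pn_morphism C \<omega> \<phi> h \<and> is_pullback C f h p q \<and>
     pn_morphism C \<rho> \<mu> p \<and> pn_morphism C \<rho> \<omega> q \<and>
     (\<forall>\<rho>'. pn_morphism C \<rho>' \<mu> p \<and> pn_morphism C \<rho>' \<omega> q \<longrightarrow>
        (\<forall>m \<in> carrier (Sub C (Dom C p)). \<rho> m \<subseteq> \<rho>' m)) \<and>
     (\<forall>\<theta> t. t \<in> Hom C (Dom C t) (Dom C p) \<and>
        pn_morphism C \<theta> \<mu> (p \<cdot>\<^bsub>C\<^esub> t) \<and> pn_morphism C \<theta> \<omega> (q \<cdot>\<^bsub>C\<^esub> t) \<longrightarrow>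
        pn_morphism C \<theta> \<rho> t)"

definition has_pn_pullbacks :: "('o, 'a) fact_category \<Rightarrow>
    ('a set \<Rightarrow> 'a set set) \<Rightarrow> ('a set \<Rightarrow> 'a set set) \<Rightarrow> 'a \<Rightarrow> bool" where
  "has_pn_pullbacks C \<mu> \<phi> f \<longleftrightarrow>
     (\<forall>\<omega> h. pn_morphism C \<omega> \<phi> h \<and> Cod C h = Cod C f \<longrightarrow>
        (\<exists>\<rho> p q. pn_pullback C \<mu> \<phi> \<omega> f h \<rho> p q))"


section \<open>Closure, closed and continuous morphisms\<close>

definition Far ::
    "('o, 'a) fact_category \<Rightarrow> 'o \<Rightarrow> ('a set \<Rightarrow> 'a set set) \<Rightarrow> 'a set \<Rightarrow> 'a set set" where
  "Far C X \<mu> p =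
     {x \<in> carrier (Sub C X). \<exists>u \<in> \<mu> x. u \<sqinter>\<^bsub>Sub C X\<^esub> p = sigma C X}"

definition cl ::
    "('o, 'a) fact_category \<Rightarrow> 'o \<Rightarrow> ('a set \<Rightarrow> 'a set set) \<Rightarrow> 'a set \<Rightarrow> 'a set" where
  "cl C X \<mu> p =
     \<Squnion>\<^bsub>Sub C X\<^esub> {x \<in> carrier (Sub C X). \<not> p \<sqsubset>\<^bsub>Sub C X\<^esub> x \<and> x \<notin> Far C X \<mu> p}"

definition closed_subs ::
    "('o, 'a) fact_category \<Rightarrow> 'o \<Rightarrow> ('a set \<Rightarrow> 'a set set) \<Rightarrow> 'a set set" where
  "closed_subs C X \<mu> = {p \<in> carrier (Sub C X). cl C X \<mu> p = p}"

definition closed_embedding ::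
    "('o, 'a) fact_category \<Rightarrow> ('a set \<Rightarrow> 'a set set) \<Rightarrow> 'a \<Rightarrow> bool" where
  "closed_embedding C \<mu> m \<longleftrightarrow>
     m \<in> MM C \<and> is_pns C (Cod C m) \<mu> \<and> subobj C m \<in> closed_subs C (Cod C m) \<mu>"

text \<open>Closed and continuous refer to any underlying morphism between two spaces, not only to
  preneighbourhood morphisms.\<close>

definition closed_morphism :: "('o, 'a) fact_category \<Rightarrow>
    ('a set \<Rightarrow> 'a set set) \<Rightarrow> ('a set \<Rightarrow> 'a set set) \<Rightarrow> 'a \<Rightarrow> bool" where
  "closed_morphism C \<mu> \<phi> f \<longleftrightarrow>
     f \<in> Arr C \<and> is_pns C (Dom C f) \<mu> \<and> is_pns C (Cod C f) \<phi> \<and>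
     (\<forall>p \<in> closed_subs C (Dom C f) \<mu>. direct_image C f p \<in> closed_subs C (Cod C f) \<phi>)"

definition continuous_morphism :: "('o, 'a) fact_category \<Rightarrow>
    ('a set \<Rightarrow> 'a set set) \<Rightarrow> ('a set \<Rightarrow> 'a set set) \<Rightarrow> 'a \<Rightarrow> bool" where
  "continuous_morphism C \<mu> \<phi> f \<longleftrightarrow>
     f \<in> Arr C \<and> is_pns C (Dom C f) \<mu> \<and> is_pns C (Cod C f) \<phi> \<and>
     (\<forall>t \<in> closed_subs C (Cod C f) \<phi>. inverse_image C f t \<in> closed_subs C (Dom C f) \<mu>)"


section \<open>Proper, separated and perfect morphisms\<close>

text \<open>``The pullback of \<open>f\<close> along every preneighbourhood morphism has property \<open>\<Phi>\<close>'':
  the pullback exists, and every choice of it has the property.\<close>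

definition stably :: "('o, 'a) fact_category \<Rightarrow>
    (('a set \<Rightarrow> 'a set set) \<Rightarrow> ('a set \<Rightarrow> 'a set set) \<Rightarrow> 'a \<Rightarrow> bool) \<Rightarrow>
    ('a set \<Rightarrow> 'a set set) \<Rightarrow> ('a set \<Rightarrow> 'a set set) \<Rightarrow> 'a \<Rightarrow> bool" where
  "stably C \<Phi> \<mu> \<phi> f \<longleftrightarrow>
     pn_morphism C \<mu> \<phi> f \<and> has_pn_pullbacks C \<mu> \<phi> f \<and>
     (\<forall>\<omega> h \<rho> p q. pn_pullback C \<mu> \<phi> \<omega> f h \<rho> p q \<longrightarrow> \<Phi> \<rho> \<omega> q)"

definition proper :: "('o, 'a) fact_category \<Rightarrow>
    ('a set \<Rightarrow> 'a set set) \<Rightarrow> ('a set \<Rightarrow> 'a set set) \<Rightarrow> 'a \<Rightarrow> bool" where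
  "proper C = stably C (closed_morphism C)"

definition stably_continuous :: "('o, 'a) fact_category \<Rightarrow>
    ('a set \<Rightarrow> 'a set set) \<Rightarrow> ('a set \<Rightarrow> 'a set set) \<Rightarrow> 'a \<Rightarrow> bool" where
  "stably_continuous C = stably C (continuous_morphism C)"

definition stably_in_E :: "('o, 'a) fact_category \<Rightarrow>
    ('a set \<Rightarrow> 'a set set) \<Rightarrow> ('a set \<Rightarrow> 'a set set) \<Rightarrow> 'a \<Rightarrow> bool" where
  "stably_in_E C = stably C (\<lambda>_ _ q. q \<in> EE C)"

definition separated :: "('o, 'a) fact_category \<Rightarrow>
    ('a set \<Rightarrow> 'a set set) \<Rightarrow> ('a set \<Rightarrow> 'a set set) \<Rightarrow> 'a \<Rightarrow> bool" where
  "separated C \<mu> \<phi> f \<longleftrightarrow>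
     pn_morphism C \<mu> \<phi> f \<and>
     (\<exists>\<kappa> p q. pn_pullback C \<mu> \<phi> \<mu> f f \<kappa> p q) \<and>
     (\<forall>\<kappa> p q d. pn_pullback C \<mu> \<phi> \<mu> f f \<kappa> p q \<and> d \<in> Hom C (Dom C f) (Dom C p) \<and>
        p \<cdot>\<^bsub>C\<^esub> d = Id C (Dom C f) \<and> q \<cdot>\<^bsub>C\<^esub> d = Id C (Dom C f) \<longrightarrow>
        proper C \<mu> \<kappa> d)"

definition perfect :: "('o, 'a) fact_category \<Rightarrow>
    ('a set \<Rightarrow> 'a set set) \<Rightarrow> ('a set \<Rightarrow> 'a set set) \<Rightarrow> 'a \<Rightarrow> bool" where
  "perfect C \<mu> \<phi> f \<longleftrightarrow> proper C \<mu> \<phi> f \<and> separated C \<mu> \<phi> f"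

end

theory Submission
  imports Defs
begin

text \<open>
  Preneighbourhood spaces and their morphisms form a category, \<open>PNS C\<close>, and a pullback of
  preneighbourhood spaces is exactly a pullback in this category (\<open>pn_pullback_iff\<close>).  Hence being
  proper means that all pullbacks exist and lie in the class \<open>K\<close> of closed morphisms, and being
  separated means that every diagonal is proper.  The class \<open>K\<close> is closed under composition because
  taking direct images is functorial.  For any such class in any category the following holds,
  merely by pasting pullback squares.
  \<^item> Properness is stable under pullback and composition.
  \<^item> The diagonal of a pullback of \<open>f\<close> is a pullback of the diagonal of \<open>f\<close>; the diagonal of
    \<open>g \<cdot> f\<close> is the diagonal of \<open>f\<close> followed by a pullback of the diagonal of \<open>g\<close>.  So
    perfectness is stable under pullback and composition as well.
  \<^item> If \<open>g \<cdot> f\<close> is proper and \<open>g\<close> is separated, then \<open>f\<close> is its own graph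
    \<open>X \<rightarrow> X \<times>\<^sub>Z Y\<close>, a pullback of the diagonal of \<open>g\<close>, followed by the projection to \<open>Y\<close>, a
    pullback of \<open>g \<cdot> f\<close>; so \<open>f\<close> is proper.  The diagonal of \<open>f\<close> is always a pullback of that of
    \<open>g \<cdot> f\<close>, which gives the corresponding statement for perfect morphisms.
  \<^item> If every pullback \<open>e\<close> of \<open>f\<close> has the property that \<open>g' \<cdot> e \<in> K\<close> implies \<open>g' \<in> K\<close>, then
    \<open>f\<close> can be cancelled from a proper \<open>g \<cdot> f\<close>.  If moreover \<open>f\<close> is proper and \<open>g \<cdot> f\<close> is separated,
    then the diagonal of \<open>g\<close> preceded by \<open>f\<close> is proper, being the diagonal of \<open>g \<cdot> f\<close>
    followed by two pullbacks of \<open>f\<close>; cancelling \<open>f\<close> once more shows that \<open>g\<close> is separated.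

  What remains is about subobjects.  A morphism \<open>e\<close> that is stably in \<open>\<E>\<close> satisfies
  \<open>\<exists>\<^sub>e (e\<^sup>-\<^sup>1 c) = c\<close>; if it is also continuous, then for \<open>g' \<cdot> e\<close> closed and \<open>c\<close> closed,
  \<open>\<exists>\<^sub>g\<^sub>' c\<close> is the image of the closed subobject \<open>e\<^sup>-\<^sup>1 c\<close> under \<open>g' \<cdot> e\<close>.  So the cancellation
  property above holds (\<open>continuous_stably_E_cancel\<close>).  Finally, an admissible subobject with the
  restricted system, called an embedding here, has all pullbacks, and these are again embeddings;
  it is a closed morphism if its subobject is closed (\<open>closed_embedding_closed_morphism\<close>).  This
  covers closed embeddings when inverse images preserve closed subobjects.  It also covers diagonals:
  they are sections of a projection, hence embeddings, and therefore have all pullbacks.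
\<close>

section \<open>Pullbacks in a category\<close>

definition pullbacks_exist :: "('o, 'a, 'r) category_scheme \<Rightarrow> 'a \<Rightarrow> bool" where
  "pullbacks_exist C f \<longleftrightarrow>
     (\<forall>h \<in> Arr C. Cod C h = Cod C f \<longrightarrow> (\<exists>p q. is_pullback C f h p q))"

definition pullback_stable :: "('o, 'a, 'r) category_scheme \<Rightarrow> 'a set \<Rightarrow> 'a \<Rightarrow> bool" where
  "pullback_stable C K f \<longleftrightarrow> f \<in> Arr C \<and> pullbacks_exist C f \<and>
     (\<forall>h p q. is_pullback C f h p q \<longrightarrow> q \<in> K)"

definition is_diagonal :: "('o, 'a, 'r) category_scheme \<Rightarrow> 'a \<Rightarrow> 'a \<Rightarrow> 'a \<Rightarrow> 'a \<Rightarrow> bool" where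
  "is_diagonal C f p q d \<longleftrightarrow> is_pullback C f f p q \<and> d \<in> Hom C (Dom C f) (Dom C p) \<and>
     p \<cdot>\<^bsub>C\<^esub> d = Id C (Dom C f) \<and> q \<cdot>\<^bsub>C\<^esub> d = Id C (Dom C f)"

definition diagonal_stable :: "('o, 'a, 'r) category_scheme \<Rightarrow> 'a set \<Rightarrow> 'a \<Rightarrow> bool" where
  "diagonal_stable C K f \<longleftrightarrow> f \<in> Arr C \<and> (\<exists>p q. is_pullback C f f p q) \<and>
     (\<forall>p q d. is_diagonal C f p q d \<longrightarrow> pullback_stable C K d)"

definition comp_closed :: "('o, 'a, 'r) category_scheme \<Rightarrow> 'a set \<Rightarrow> bool" where
  "comp_closed C K \<longleftrightarrow> (\<forall>d \<in> K. \<forall>e \<in> K. Cod C d = Dom C e \<longrightarrow> e \<cdot>\<^bsub>C\<^esub> d \<in> K)"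

definition right_cancelling :: "('o, 'a, 'r) category_scheme \<Rightarrow> 'a set \<Rightarrow> 'a set" where
  "right_cancelling C K =
     {e. \<forall>g \<in> Arr C. Dom C g = Cod C e \<longrightarrow> g \<cdot>\<^bsub>C\<^esub> e \<in> K \<longrightarrow> g \<in> K}"

context category
begin

lemma Comp_Arr [simp]: "\<lbrakk>f \<in> Arr C; g \<in> Arr C; Cod C f = Dom C g\<rbrakk> \<Longrightarrow> g \<cdot> f \<in> Arr C"
  and Dom_Comp [simp]: "\<lbrakk>f \<in> Arr C; g \<in> Arr C; Cod C f = Dom C g\<rbrakk> \<Longrightarrow> Dom C (g \<cdot> f) = Dom C f"
  and Cod_Comp [simp]: "\<lbrakk>f \<in> Arr C; g \<in> Arr C; Cod C f = Dom C g\<rbrakk> \<Longrightarrow> Cod C (g \<cdot> f) = Cod C g"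
  using Comp_Hom[of f "Dom C f" "Cod C f" g "Cod C g"] by (auto simp: Hom_def)

lemma Id_Arr [simp]: "X \<in> Obj C \<Longrightarrow> Id C X \<in> Arr C"
  and Dom_Id [simp]: "X \<in> Obj C \<Longrightarrow> Dom C (Id C X) = X"
  and Cod_Id [simp]: "X \<in> Obj C \<Longrightarrow> Cod C (Id C X) = X"
  using Id_Hom[of X] by (auto simp: Hom_def)

declare Dom_Obj [simp] Cod_Obj [simp]

lemma Comp_Id' [simp]: "\<lbrakk>f \<in> Arr C; X = Dom C f\<rbrakk> \<Longrightarrow> f \<cdot> Id C X = f"
  and Id_Comp' [simp]: "\<lbrakk>f \<in> Arr C; X = Cod C f\<rbrakk> \<Longrightarrow> Id C X \<cdot> f = f"
  by (simp_all add: Comp_Id Id_Comp)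

lemma Comp_Comp [simp]:
  "\<lbrakk>f \<in> Arr C; g \<in> Arr C; h \<in> Arr C; Cod C f = Dom C g; Cod C g = Dom C h\<rbrakk>
    \<Longrightarrow> (h \<cdot> g) \<cdot> f = h \<cdot> (g \<cdot> f)"
  using Comp_assoc[of f "Dom C f" "Cod C f" g "Cod C g" h "Cod C h"] by (auto simp: Hom_def)

text \<open>
  Composites are normalised to right-nested form, so an equation between composites of two arrows no
  longer matches inside a longer one; the next three lemmas supply its extended form.
\<close>

lemma Comp_left_cong:
  "\<lbrakk>h \<cdot> g = h' \<cdot> g'; f \<in> Arr C; g \<in> Arr C; h \<in> Arr C; Cod C f = Dom C g; Cod C g = Dom C h;
    g' \<in> Arr C; h' \<in> Arr C; Dom C g' = Dom C g; Cod C g' = Dom C h'\<rbrakk>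
    \<Longrightarrow> h \<cdot> (g \<cdot> f) = h' \<cdot> (g' \<cdot> f)"
  by (simp flip: Comp_Comp)

lemma Comp_left_eq:
  "\<lbrakk>h \<cdot> g = k; f \<in> Arr C; g \<in> Arr C; h \<in> Arr C; Cod C f = Dom C g; Cod C g = Dom C h\<rbrakk>
    \<Longrightarrow> h \<cdot> (g \<cdot> f) = k \<cdot> f"
  by (simp flip: Comp_Comp)

lemma Comp_retract:
  "\<lbrakk>h \<cdot> g = Id C (Dom C g); f \<in> Arr C; g \<in> Arr C; h \<in> Arr C; Cod C f = Dom C g;
    Cod C g = Dom C h\<rbrakk> \<Longrightarrow> h \<cdot> (g \<cdot> f) = f"
  by (simp flip: Comp_Comp)

lemma pullbackD:
  assumes "is_pullback C f h p q"
  shows "f \<in> Arr C" "h \<in> Arr C" "p \<in> Arr C" "q \<in> Arr C" "Cod C h = Cod C f"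
    "Dom C q = Dom C p" "Cod C p = Dom C f" "Cod C q = Dom C h" "f \<cdot> p = h \<cdot> q"
  using assms by (auto simp: is_pullback_def Hom_def)

lemma pullbackE:
  assumes "is_pullback C f h p q" "a \<in> Arr C" "b \<in> Arr C" "Dom C b = Dom C a"
    "Cod C a = Dom C f" "Cod C b = Dom C h" "f \<cdot> a = h \<cdot> b"
  obtains t where "t \<in> Arr C" "Dom C t = Dom C a" "Cod C t = Dom C p" "p \<cdot> t = a" "q \<cdot> t = b"
proof -
  have "a \<in> Hom C (Dom C a) (Dom C f)" "b \<in> Hom C (Dom C a) (Dom C h)"
    using assms by (auto simp: Hom_def)
  then have "\<exists>!t. t \<in> Hom C (Dom C a) (Dom C p) \<and> p \<cdot> t = a \<and> q \<cdot> t = b"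
    using assms(1,7) unfolding is_pullback_def by blast
  then obtain t where "t \<in> Hom C (Dom C a) (Dom C p)" "p \<cdot> t = a" "q \<cdot> t = b" by blast
  then show ?thesis by (intro that[of t]) (simp_all add: Hom_def)
qed

lemma pullback_eqI:
  assumes "is_pullback C f h p q" "t \<in> Arr C" "t' \<in> Arr C" "Dom C t = Dom C t'"
    "Cod C t = Dom C p" "Cod C t' = Dom C p" "p \<cdot> t = p \<cdot> t'" "q \<cdot> t = q \<cdot> t'"
  shows "t = t'"
proof -
  note D = pullbackD[OF assms(1)]
  have "f \<cdot> (p \<cdot> t') = h \<cdot> (q \<cdot> t')"
    by (rule Comp_left_cong) (use D assms in simp_all)
  moreover have "p \<cdot> t' \<in> Hom C (Dom C t') (Dom C f)" "q \<cdot> t' \<in> Hom C (Dom C t') (Dom C h)"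
    using D assms by (auto simp: Hom_def)
  ultimately have "\<exists>!s. s \<in> Hom C (Dom C t') (Dom C p) \<and> p \<cdot> s = p \<cdot> t' \<and> q \<cdot> s = q \<cdot> t'"
    using assms(1) unfolding is_pullback_def by blast
  then obtain u where
    u: "\<And>s. s \<in> Hom C (Dom C t') (Dom C p) \<and> p \<cdot> s = p \<cdot> t' \<and> q \<cdot> s = q \<cdot> t' \<Longrightarrow> s = u"
    by blast
  have "t = u" by (rule u) (use assms in \<open>simp add: Hom_def\<close>)
  moreover have "t' = u" by (rule u) (use assms in \<open>simp add: Hom_def\<close>)
  ultimately show ?thesis by simp
qed

lemma pullbackI:
  assumes "f \<in> Arr C" "h \<in> Arr C" "p \<in> Arr C" "q \<in> Arr C" "Cod C h = Cod C f"
    "Dom C q = Dom C p" "Cod C p = Dom C f" "Cod C q = Dom C h" "f \<cdot> p = h \<cdot> q"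
    and ex: "\<And>a b. \<lbrakk>a \<in> Arr C; b \<in> Arr C; Dom C b = Dom C a; Cod C a = Dom C f;
      Cod C b = Dom C h; f \<cdot> a = h \<cdot> b\<rbrakk>
      \<Longrightarrow> \<exists>t. t \<in> Arr C \<and> Dom C t = Dom C a \<and> Cod C t = Dom C p \<and> p \<cdot> t = a \<and> q \<cdot> t = b"
    and un: "\<And>t t'. \<lbrakk>t \<in> Arr C; t' \<in> Arr C; Dom C t = Dom C t'; Cod C t = Dom C p;
      Cod C t' = Dom C p; p \<cdot> t = p \<cdot> t'; q \<cdot> t = q \<cdot> t'\<rbrakk> \<Longrightarrow> t = t'"
  shows "is_pullback C f h p q"
  unfolding is_pullback_def
proof (intro conjI allI ballI impI)
  fix T a b
  assume ab: "a \<in> Hom C T (Dom C f)" "b \<in> Hom C T (Dom C h)" "f \<cdot> a = h \<cdot> b"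
  then have "\<exists>t. t \<in> Hom C T (Dom C p) \<and> p \<cdot> t = a \<and> q \<cdot> t = b"
    using ex[of a b] by (simp add: Hom_def)
  then obtain t where t: "t \<in> Hom C T (Dom C p) \<and> p \<cdot> t = a \<and> q \<cdot> t = b" by (rule exE)
  then show "\<exists>!t. t \<in> Hom C T (Dom C p) \<and> p \<cdot> t = a \<and> q \<cdot> t = b"
  proof (rule ex1I)
    fix s assume "s \<in> Hom C T (Dom C p) \<and> p \<cdot> s = a \<and> q \<cdot> s = b"
    with t show "s = t" by - (rule un, simp_all add: Hom_def)
  qed
qed (use assms in \<open>auto simp: Hom_def\<close>)

lemma pullback_sym:
  assumes 1: "is_pullback C f h p q"
  shows "is_pullback C h f q p"
proof (rule pullbackI)
  note D [simp] = pullbackD(1-8)[OF 1]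
  fix a b
  assume ab: "a \<in> Arr C" "b \<in> Arr C" "Dom C b = Dom C a" "Cod C a = Dom C h"
    "Cod C b = Dom C f" "h \<cdot> a = f \<cdot> b"
  obtain t where "t \<in> Arr C" "Dom C t = Dom C b" "Cod C t = Dom C p" "p \<cdot> t = b" "q \<cdot> t = a"
    by (rule pullbackE[OF 1, of b a]) (use ab in simp_all)
  then show "\<exists>t. t \<in> Arr C \<and> Dom C t = Dom C a \<and> Cod C t = Dom C q \<and> q \<cdot> t = a \<and> p \<cdot> t = b"
    using ab by auto
next
  note D [simp] = pullbackD(1-8)[OF 1]
  show "s = t" if "s \<in> Arr C" "t \<in> Arr C" "Dom C s = Dom C t" "Cod C s = Dom C q"
    "Cod C t = Dom C q" "q \<cdot> s = q \<cdot> t" "p \<cdot> s = p \<cdot> t" for s t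
    by - (rule pullback_eqI[OF 1], use that in simp_all)
qed (simp_all add: pullbackD[OF 1])

lemma pullback_paste:
  assumes 1: "is_pullback C f h p q" and 2: "is_pullback C q k p' q'"
  shows "is_pullback C f (h \<cdot> k) (p \<cdot> p') q'"
proof (rule pullbackI)
  note D [simp] = pullbackD(1-8)[OF 1] pullbackD(1-8)[OF 2]
  show "f \<cdot> (p \<cdot> p') = (h \<cdot> k) \<cdot> q'"
  proof -
    have "f \<cdot> (p \<cdot> p') = h \<cdot> (q \<cdot> p')" by (rule Comp_left_cong) (use pullbackD(9)[OF 1] in simp_all)
    then show ?thesis using pullbackD(9)[OF 2] by simp
  qed
next
  note D [simp] = pullbackD(1-8)[OF 1] pullbackD(1-8)[OF 2]
  fix a b
  assume ab [simp]: "a \<in> Arr C" "b \<in> Arr C" "Dom C b = Dom C a" "Cod C a = Dom C f"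
    "Cod C b = Dom C (h \<cdot> k)" and eq: "f \<cdot> a = (h \<cdot> k) \<cdot> b"
  have [simp]: "Cod C b = Dom C k" using ab(5) by simp
  obtain t where t [simp]: "t \<in> Arr C" "Dom C t = Dom C a" "Cod C t = Dom C p"
    and t': "p \<cdot> t = a" "q \<cdot> t = k \<cdot> b"
    by (rule pullbackE[OF 1, of a "k \<cdot> b"]) (use eq in simp_all)
  obtain s where s [simp]: "s \<in> Arr C" "Dom C s = Dom C t" "Cod C s = Dom C p'"
    and s': "p' \<cdot> s = t" "q' \<cdot> s = b"
    by (rule pullbackE[OF 2, of t b]) (use t' in simp_all)
  show "\<exists>t. t \<in> Arr C \<and> Dom C t = Dom C a \<and> Cod C t = Dom C (p \<cdot> p') \<and> (p \<cdot> p') \<cdot> t = a \<and> q' \<cdot> t = b"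
    using s' t' by (intro exI[of _ s]) simp_all
next
  note D [simp] = pullbackD(1-8)[OF 1] pullbackD(1-8)[OF 2]
  fix s t
  assume st: "s \<in> Arr C" "t \<in> Arr C" "Dom C s = Dom C t" "Cod C s = Dom C (p \<cdot> p')"
    "Cod C t = Dom C (p \<cdot> p')" and eq: "(p \<cdot> p') \<cdot> s = (p \<cdot> p') \<cdot> t" "q' \<cdot> s = q' \<cdot> t"
  have st [simp]: "s \<in> Arr C" "t \<in> Arr C" "Dom C s = Dom C t" "Cod C s = Dom C p'"
    "Cod C t = Dom C p'"
    using st by auto
  have q: "q \<cdot> (p' \<cdot> r) = k \<cdot> (q' \<cdot> r)" if "r \<in> Arr C" "Cod C r = Dom C p'" for r
    by (rule Comp_left_cong) (use that pullbackD(9)[OF 2] in simp_all)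
  have "p' \<cdot> s = p' \<cdot> t"
    by - (rule pullback_eqI[OF 1], use eq q in simp_all)
  then show "s = t"
    by - (rule pullback_eqI[OF 2], use eq in simp_all)
qed (use pullbackD[OF 1] pullbackD[OF 2] in simp_all)

text \<open>
  The converse of pasting: the left square is a pullback if the right one and the outer rectangle are.
\<close>

lemma pullback_unpaste:
  assumes 1: "is_pullback C f (h \<cdot> k) r q'" and 2: "is_pullback C f h p q"
    and k: "k \<in> Arr C" "Cod C k = Dom C h"
    and t: "t \<in> Arr C" "Dom C t = Dom C r" "Cod C t = Dom C p" "p \<cdot> t = r" "q \<cdot> t = k \<cdot> q'"
  shows "is_pullback C q k t q'"
proof (rule pullbackI)
  have [simp]: "Dom C (h \<cdot> k) = Dom C k" using k pullbackD[OF 2] by simp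
  note D [simp] = pullbackD(1-8)[OF 1] pullbackD(1-8)[OF 2] k t(1-3)
  fix a b
  assume ab [simp]: "a \<in> Arr C" "b \<in> Arr C" "Dom C b = Dom C a" "Cod C a = Dom C q"
    "Cod C b = Dom C k" and eq: "q \<cdot> a = k \<cdot> b"
  have e: "f \<cdot> (p \<cdot> a) = h \<cdot> (q \<cdot> a)"
    by (rule Comp_left_cong) (use pullbackD(9)[OF 2] in simp_all)
  obtain s where s [simp]: "s \<in> Arr C" "Dom C s = Dom C a" "Cod C s = Dom C r"
    and s': "r \<cdot> s = p \<cdot> a" "q' \<cdot> s = b"
    by (rule pullbackE[OF 1, of "p \<cdot> a" b]) (use e eq in simp_all)
  have "p \<cdot> (t \<cdot> s) = r \<cdot> s" "q \<cdot> (t \<cdot> s) = (k \<cdot> q') \<cdot> s"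
    using t(4,5) by (simp_all add: Comp_left_eq[OF t(4)] Comp_left_eq[OF t(5)])
  then have "t \<cdot> s = a"
    by - (rule pullback_eqI[OF 2], use s' eq in simp_all)
  then show "\<exists>s. s \<in> Arr C \<and> Dom C s = Dom C a \<and> Cod C s = Dom C t \<and> t \<cdot> s = a \<and> q' \<cdot> s = b"
    using s' by (intro exI[of _ s]) simp_all
next
  have [simp]: "Dom C (h \<cdot> k) = Dom C k" using k pullbackD[OF 2] by simp
  note D [simp] = pullbackD(1-8)[OF 1] pullbackD(1-8)[OF 2] k t(1-3)
  fix s s'
  assume st [simp]: "s \<in> Arr C" "s' \<in> Arr C" "Dom C s = Dom C s'" "Cod C s = Dom C t"
    "Cod C s' = Dom C t" and eq: "t \<cdot> s = t \<cdot> s'" "q' \<cdot> s = q' \<cdot> s'"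
  have "r \<cdot> x = p \<cdot> (t \<cdot> x)" if "x \<in> Arr C" "Cod C x = Dom C t" for x
    using that by (simp add: Comp_left_eq[OF t(4)])
  then show "s = s'"
    by - (rule pullback_eqI[OF 1], use eq in simp_all)
qed (use pullbackD[OF 1] pullbackD[OF 2] k t in simp_all)

lemma pullback_paste_left:
  assumes "is_pullback C g h k g'" "is_pullback C f k p f'"
  shows "is_pullback C (g \<cdot> f) h p (g' \<cdot> f')"
  using pullback_paste[OF assms[THEN pullback_sym]] by (rule pullback_sym)

lemma pullback_unpaste_left:
  assumes "is_pullback C (g \<cdot> f) h p r" "is_pullback C g h k g'" "f \<in> Arr C" "Cod C f = Dom C g"
    and t: "t \<in> Arr C" "Dom C t = Dom C p" "Cod C t = Dom C k" "k \<cdot> t = f \<cdot> p" "g' \<cdot> t = r"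
  shows "is_pullback C f k p t"
  by (rule pullback_sym, rule pullback_unpaste[OF assms(1,2)[THEN pullback_sym]])
     (use assms pullbackD[OF assms(1)] pullbackD[OF assms(2)] in simp_all)

lemma diagonal_exists:
  assumes "is_pullback C f f p q"
  obtains d where "is_diagonal C f p q d"
proof -
  note [simp] = pullbackD(1-8)[OF assms]
  obtain d where "d \<in> Arr C" "Dom C d = Dom C f" "Cod C d = Dom C p"
    "p \<cdot> d = Id C (Dom C f)" "q \<cdot> d = Id C (Dom C f)"
    by (rule pullbackE[OF assms, of "Id C (Dom C f)" "Id C (Dom C f)"]) simp_all
  then show ?thesis using that assms by (auto simp: is_diagonal_def Hom_def)
qed

lemma diagonalD:
  assumes "is_diagonal C f p q d"
  shows "is_pullback C f f p q" "d \<in> Arr C" "Dom C d = Dom C f" "Cod C d = Dom C p"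
    "p \<cdot> d = Id C (Dom C f)" "q \<cdot> d = Id C (Dom C f)"
  using assms by (auto simp: is_diagonal_def Hom_def)

lemma diagonal_Comp:
  assumes "is_diagonal C f p q d" "x \<in> Arr C" "Cod C x = Dom C f"
  shows "p \<cdot> (d \<cdot> x) = x" "q \<cdot> (d \<cdot> x) = x"
  using assms diagonalD[OF assms(1)] pullbackD[OF diagonalD(1)[OF assms(1)]]
  by (simp_all add: Comp_retract)

section \<open>Stability under pullback\<close>

lemma pullback_stableD:
  assumes "pullback_stable C K f"
  shows "f \<in> Arr C" "pullbacks_exist C f" "is_pullback C f h p q \<Longrightarrow> q \<in> K"
  using assms by (auto simp: pullback_stable_def)

lemma pullbacks_existE:
  assumes "pullbacks_exist C f" "h \<in> Arr C" "Cod C h = Cod C f"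
  obtains p q where "is_pullback C f h p q"
  using assms unfolding pullbacks_exist_def by blast

text \<open>
  To pull back \<open>q\<close> along \<open>k\<close>, pull back \<open>f\<close> along \<open>h \<cdot> k\<close> and split off the given square.
\<close>

lemma pullbacks_exist_pullback:
  assumes f: "pullbacks_exist C f" and 1: "is_pullback C f h p q"
  shows "pullbacks_exist C q"
  unfolding pullbacks_exist_def
proof (intro ballI impI)
  note D [simp] = pullbackD(1-8)[OF 1]
  fix k assume k: "k \<in> Arr C" "Cod C k = Cod C q"
  obtain r q' where 2: "is_pullback C f (h \<cdot> k) r q'"
    by (rule pullbacks_existE[OF f, of "h \<cdot> k"]) (use k in simp_all)
  note D2 = pullbackD[OF 2]
  have "q' \<in> Arr C" "Cod C q' = Dom C k" "f \<cdot> r = h \<cdot> (k \<cdot> q')"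
    using D2 k by simp_all
  then obtain t where "t \<in> Arr C" "Dom C t = Dom C r" "Cod C t = Dom C p" "p \<cdot> t = r"
    "q \<cdot> t = k \<cdot> q'"
    by - (rule pullbackE[OF 1, of r "k \<cdot> q'"], use D2 k in simp_all)
  then have "is_pullback C q k t q'"
    by - (rule pullback_unpaste[OF 2 1], use k in simp_all)
  then show "\<exists>p' q'. is_pullback C q k p' q'" by blast
qed

lemma pullback_stable_pullback:
  assumes f: "pullback_stable C K f" and 1: "is_pullback C f h p q"
  shows "pullback_stable C K q"
  using f pullbacks_exist_pullback[OF _ 1] pullback_paste[OF 1] pullbackD[OF 1]
  unfolding pullback_stable_def by blast

lemma pullbacks_exist_Comp:
  assumes f: "pullbacks_exist C f" and g: "pullbacks_exist C g"
    and [simp]: "f \<in> Arr C" "g \<in> Arr C" "Cod C f = Dom C g"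
  shows "pullbacks_exist C (g \<cdot> f)"
  unfolding pullbacks_exist_def
proof (intro ballI impI)
  fix h assume h: "h \<in> Arr C" "Cod C h = Cod C (g \<cdot> f)"
  obtain k g' where 1: "is_pullback C g h k g'"
    by (rule pullbacks_existE[OF g, of h]) (use h in simp_all)
  obtain p f' where "is_pullback C f k p f'"
    by (rule pullbacks_existE[OF f, of k]) (use pullbackD[OF 1] in simp_all)
  from pullback_paste_left[OF 1 this] show "\<exists>p q. is_pullback C (g \<cdot> f) h p q" by blast
qed

text \<open>
  An arbitrary pullback of \<open>g \<cdot> f\<close> has to be considered, not one built from pullbacks of \<open>g\<close> and
  \<open>f\<close>.  Comparing it with a pullback of \<open>g\<close> exhibits it as a composite of the desired form.
\<close>

lemma pullback_stable_Comp:
  assumes K: "comp_closed C K"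
    and f: "pullback_stable C K f" and g: "pullback_stable C K g" and fg: "Cod C f = Dom C g"
  shows "pullback_stable C K (g \<cdot> f)"
proof -
  note F [simp] = pullback_stableD(1)[OF f] pullback_stableD(1)[OF g] fg
  have "q \<in> K" if 1: "is_pullback C (g \<cdot> f) h p q" for h p q
  proof -
    note D = pullbackD[OF 1]
    obtain k g' where 2: "is_pullback C g h k g'"
      by (rule pullbacks_existE[OF pullback_stableD(2)[OF g], of h]) (use D in simp_all)
    note D2 = pullbackD[OF 2]
    have "g \<cdot> (f \<cdot> p) = h \<cdot> q" using D by simp
    then obtain t where t: "t \<in> Arr C" "Dom C t = Dom C p" "Cod C t = Dom C k" "k \<cdot> t = f \<cdot> p"
      "g' \<cdot> t = q"
      by - (rule pullbackE[OF 2, of "f \<cdot> p" q], use D in simp_all)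
    then have "is_pullback C f k p t"
      by (intro pullback_unpaste_left[OF 1 2]) simp_all
    then have "t \<in> K" using pullback_stableD(3)[OF f] by blast
    moreover have "g' \<in> K" using pullback_stableD(3)[OF g 2] .
    ultimately have "g' \<cdot> t \<in> K" using K t(3) D2(6) by (simp add: comp_closed_def)
    then show ?thesis using t by simp
  qed
  moreover have "pullbacks_exist C (g \<cdot> f)"
    using f g by (intro pullbacks_exist_Comp) (simp_all add: pullback_stable_def)
  ultimately show ?thesis by (auto simp: pullback_stable_def)
qed

text \<open>
  A pullback \<open>g'\<close> of \<open>g\<close>, preceded by a suitable pullback \<open>f'\<close> of \<open>f\<close>, is a pullback of
  \<open>g \<cdot> f\<close>, and \<open>f'\<close> cancels.
\<close>

lemma pullback_stable_cancel_right:
  assumes gf: "pullback_stable C K (g \<cdot> f)" and f: "pullback_stable C (right_cancelling C K) f"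
    and g: "pullbacks_exist C g" "g \<in> Arr C" and fg: "Cod C f = Dom C g"
  shows "pullback_stable C K g"
proof -
  note F [simp] = pullback_stableD(1)[OF f] g(2) fg
  have "g' \<in> K" if 1: "is_pullback C g h k g'" for h k g'
  proof -
    note D = pullbackD[OF 1]
    obtain p f' where 2: "is_pullback C f k p f'"
      by (rule pullbacks_existE[OF pullback_stableD(2)[OF f], of k]) (use D in simp_all)
    have "g' \<cdot> f' \<in> K"
      using pullback_stableD(3)[OF gf pullback_paste_left[OF 1 2]] .
    moreover have "f' \<in> right_cancelling C K" using pullback_stableD(3)[OF f 2] .
    ultimately show ?thesis
      using D pullbackD[OF 2] by (auto simp: right_cancelling_def)
  qed
  then show ?thesis using g by (auto simp: pullback_stable_def)
qed


section \<open>Diagonals\<close>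

lemma diagonal_stableD:
  assumes "diagonal_stable C K f"
  shows "f \<in> Arr C" "is_diagonal C f p q d \<Longrightarrow> pullback_stable C K d"
  using assms by (auto simp: diagonal_stable_def)

lemma diagonal_stableE:
  assumes "diagonal_stable C K f"
  obtains p q d where "is_diagonal C f p q d" "pullback_stable C K d"
proof -
  obtain p q where "is_pullback C f f p q" using assms by (auto simp: diagonal_stable_def)
  then obtain d where "is_diagonal C f p q d" by (rule diagonal_exists)
  then show ?thesis using that diagonal_stableD(2)[OF assms] by blast
qed

text \<open>
  If \<open>q : P \<rightarrow> W\<close> is the pullback of \<open>f : X \<rightarrow> Y\<close> along \<open>h\<close>, then the diagonal \<open>P \<rightarrow> P \<times>\<^sub>W P\<close> is
  the pullback of the diagonal \<open>X \<rightarrow> X \<times>\<^sub>Y X\<close> along the map \<open>s\<close> induced by \<open>P \<rightarrow> X\<close>: two points of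
  \<open>P\<close> over the same point of \<open>W\<close> agree as soon as their images in \<open>X\<close> do.
\<close>

lemma diagonal_stable_pullback:
  assumes f: "diagonal_stable C K f" and ex: "pullbacks_exist C f"
    and 1: "is_pullback C f h p q"
  shows "diagonal_stable C K q"
proof -
  note D [simp] = pullbackD(1-8)[OF 1]
  obtain p0 q0 d0 where d0: "is_diagonal C f p0 q0 d0" "pullback_stable C K d0"
    using diagonal_stableE[OF f] .
  note E0 [simp] = diagonalD(2-4)[OF d0(1)] and K0 = diagonalD(1)[OF d0(1)]
  note L0 [simp] = pullbackD(3,4,6-8)[OF K0]
  have "pullback_stable C K d" if d: "is_diagonal C q a b d" for a b d
  proof -
    note E [simp] = diagonalD(2-4)[OF d] and Kq = diagonalD(1)[OF d]
    note L [simp] = pullbackD(3,4,6-8)[OF Kq]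
    have "f \<cdot> (p \<cdot> a) = h \<cdot> (q \<cdot> a)" "f \<cdot> (p \<cdot> b) = h \<cdot> (q \<cdot> b)"
      by (rule Comp_left_cong; use pullbackD(9)[OF 1] in simp)+
    then have "f \<cdot> (p \<cdot> a) = f \<cdot> (p \<cdot> b)" using pullbackD(9)[OF Kq] by simp
    then obtain s where s [simp]: "s \<in> Arr C" "Dom C s = Dom C a" "Cod C s = Dom C p0"
      and s': "p0 \<cdot> s = p \<cdot> a" "q0 \<cdot> s = p \<cdot> b"
      by - (rule pullbackE[OF K0, of "p \<cdot> a" "p \<cdot> b"], simp_all)
    have s'': "p0 \<cdot> (s \<cdot> x) = p \<cdot> (a \<cdot> x)" "q0 \<cdot> (s \<cdot> x) = p \<cdot> (b \<cdot> x)"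
      if "x \<in> Arr C" "Cod C x = Dom C a" for x
      using that by (simp_all add: Comp_left_cong[OF s'(1)] Comp_left_cong[OF s'(2)])
    have "is_pullback C d0 s p d"
    proof (rule pullbackI)
      show "d0 \<cdot> p = s \<cdot> d"
        by (rule pullback_eqI[OF K0])
          (simp_all add: s'' diagonal_Comp[OF d0(1)] diagonalD(5,6)[OF d])
    next
      fix x r
      assume xr [simp]: "x \<in> Arr C" "r \<in> Arr C" "Dom C r = Dom C x" "Cod C x = Dom C d0"
        "Cod C r = Dom C s" and eq: "d0 \<cdot> x = s \<cdot> r"
      have x: "p \<cdot> (a \<cdot> r) = x" "p \<cdot> (b \<cdot> r) = x"
        using arg_cong[OF eq, of "\<lambda>y. p0 \<cdot> y"] arg_cong[OF eq, of "\<lambda>y. q0 \<cdot> y"]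
        by (simp_all add: s'' diagonal_Comp[OF d0(1)])
      moreover have "q \<cdot> (a \<cdot> r) = q \<cdot> (b \<cdot> r)"
        by (rule Comp_left_cong) (use pullbackD(9)[OF Kq] in simp_all)
      ultimately have ab: "b \<cdot> r = a \<cdot> r"
        by - (rule pullback_eqI[OF 1], simp_all)
      have dr: "d \<cdot> (a \<cdot> r) = r"
        by (rule pullback_eqI[OF Kq]) (simp_all add: diagonal_Comp[OF d] ab)
      show "\<exists>t. t \<in> Arr C \<and> Dom C t = Dom C x \<and> Cod C t = Dom C p \<and> p \<cdot> t = x \<and> d \<cdot> t = r"
        by (rule exI[of _ "a \<cdot> r"]) (simp add: x dr)
    next
      fix t t'
      assume t: "t \<in> Arr C" "t' \<in> Arr C" "Cod C t = Dom C p" "Cod C t' = Dom C p" "d \<cdot> t = d \<cdot> t'"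
      have "t = a \<cdot> (d \<cdot> t)" "t' = a \<cdot> (d \<cdot> t')"
        by (rule diagonal_Comp(1)[OF d, symmetric]; use t in simp)+
      then show "t = t'" using t(5) by metis
    qed simp_all
    with d0(2) show ?thesis by (rule pullback_stable_pullback)
  qed
  moreover have "\<exists>a b. is_pullback C q q a b"
    using pullbacks_exist_pullback[OF ex 1] by (simp add: pullbacks_exist_def)
  ultimately show ?thesis by (auto simp: diagonal_stable_def)
qed

text \<open>
  The inclusion \<open>j : X \<times>\<^sub>Y X \<rightarrow> X \<times>\<^sub>Z X\<close> is the pullback of the diagonal of \<open>g : Y \<rightarrow> Z\<close> along
  the map \<open>s : X \<times>\<^sub>Z X \<rightarrow> Y \<times>\<^sub>Z Y\<close> induced by \<open>f\<close>, and the diagonal of \<open>g \<cdot> f\<close> is \<open>j\<close> after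
  the diagonal of \<open>f\<close>.
\<close>

lemma diagonal_stable_Comp:
  assumes K: "comp_closed C K"
    and f: "diagonal_stable C K f" and g: "diagonal_stable C K g" and fg: "Cod C f = Dom C g"
    and ex: "\<exists>p q. is_pullback C (g \<cdot> f) (g \<cdot> f) p q"
  shows "diagonal_stable C K (g \<cdot> f)"
proof -
  note F [simp] = diagonal_stableD(1)[OF f] diagonal_stableD(1)[OF g] fg
  obtain p0 q0 d0 where d0: "is_diagonal C f p0 q0 d0" "pullback_stable C K d0"
    using diagonal_stableE[OF f] .
  note E0 [simp] = diagonalD(2-4)[OF d0(1)] and K0 = diagonalD(1)[OF d0(1)]
  note L0 [simp] = pullbackD(3,4,6-8)[OF K0]
  obtain p1 q1 d1 where d1: "is_diagonal C g p1 q1 d1" "pullback_stable C K d1"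
    using diagonal_stableE[OF g] .
  note E1 [simp] = diagonalD(2-4)[OF d1(1)] and K1 = diagonalD(1)[OF d1(1)]
  note L1 [simp] = pullbackD(3,4,6-8)[OF K1]
  have "pullback_stable C K d" if d: "is_diagonal C (g \<cdot> f) a b d" for a b d
  proof -
    have E [simp]: "d \<in> Arr C" "Dom C d = Dom C f" "Cod C d = Dom C a"
      using diagonalD(2-4)[OF d] by simp_all
    note Kd = diagonalD(1)[OF d]
    have L [simp]: "a \<in> Arr C" "b \<in> Arr C" "Dom C b = Dom C a" "Cod C a = Dom C f" "Cod C b = Dom C f"
      and ab: "g \<cdot> (f \<cdot> a) = g \<cdot> (f \<cdot> b)"
      using pullbackD[OF Kd] by simp_all
    obtain s where s [simp]: "s \<in> Arr C" "Dom C s = Dom C a" "Cod C s = Dom C p1"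
      and s': "p1 \<cdot> s = f \<cdot> a" "q1 \<cdot> s = f \<cdot> b"
      by (rule pullbackE[OF K1, of "f \<cdot> a" "f \<cdot> b"]) (use ab in simp_all)
    have s'': "p1 \<cdot> (s \<cdot> x) = f \<cdot> (a \<cdot> x)" "q1 \<cdot> (s \<cdot> x) = f \<cdot> (b \<cdot> x)"
      if "x \<in> Arr C" "Cod C x = Dom C a" for x
      using that by (simp_all add: Comp_left_cong[OF s'(1)] Comp_left_cong[OF s'(2)])
    have fpq: "f \<cdot> p0 = f \<cdot> q0" using pullbackD(9)[OF K0] .
    obtain j where j [simp]: "j \<in> Arr C" "Dom C j = Dom C p0" "Cod C j = Dom C a"
      and j': "a \<cdot> j = p0" "b \<cdot> j = q0"
      by (rule pullbackE[OF Kd, of p0 q0]) (use fpq in simp_all)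
    have j'': "a \<cdot> (j \<cdot> x) = p0 \<cdot> x" "b \<cdot> (j \<cdot> x) = q0 \<cdot> x"
      if "x \<in> Arr C" "Cod C x = Dom C p0" for x
      using that by (simp_all add: Comp_left_eq[OF j'(1)] Comp_left_eq[OF j'(2)])
    have "is_pullback C d1 s (f \<cdot> p0) j"
    proof (rule pullbackI)
      show "d1 \<cdot> (f \<cdot> p0) = s \<cdot> j"
        by (rule pullback_eqI[OF K1]) (simp_all add: s'' j' diagonal_Comp[OF d1(1)] fpq)
    next
      fix y r
      assume yr [simp]: "y \<in> Arr C" "r \<in> Arr C" "Dom C r = Dom C y" "Cod C y = Dom C d1"
        "Cod C r = Dom C s" and eq: "d1 \<cdot> y = s \<cdot> r"
      have y: "f \<cdot> (a \<cdot> r) = y" "f \<cdot> (b \<cdot> r) = y"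
        using arg_cong[OF eq, of "\<lambda>y. p1 \<cdot> y"] arg_cong[OF eq, of "\<lambda>y. q1 \<cdot> y"]
        by (simp_all add: s'' diagonal_Comp[OF d1(1)])
      then obtain t where t [simp]: "t \<in> Arr C" "Dom C t = Dom C r" "Cod C t = Dom C p0"
        and t': "p0 \<cdot> t = a \<cdot> r" "q0 \<cdot> t = b \<cdot> r"
        by - (rule pullbackE[OF K0, of "a \<cdot> r" "b \<cdot> r"], simp_all)
      have "j \<cdot> t = r"
        by (rule pullback_eqI[OF Kd]) (simp_all add: j'' t')
      then show "\<exists>t. t \<in> Arr C \<and> Dom C t = Dom C y \<and> Cod C t = Dom C (f \<cdot> p0) \<and>
          (f \<cdot> p0) \<cdot> t = y \<and> j \<cdot> t = r"
        using t' y by (intro exI[of _ t]) simp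
    next
      fix t t'
      assume t [simp]: "t \<in> Arr C" "t' \<in> Arr C" "Dom C t = Dom C t'" "Cod C t = Dom C (f \<cdot> p0)"
        "Cod C t' = Dom C (f \<cdot> p0)" and eq: "j \<cdot> t = j \<cdot> t'"
      have [simp]: "Cod C t = Dom C p0" "Cod C t' = Dom C p0" using t(4,5) by simp_all
      have "a \<cdot> (j \<cdot> t) = a \<cdot> (j \<cdot> t')" "b \<cdot> (j \<cdot> t) = b \<cdot> (j \<cdot> t')" using eq by simp_all
      then show "t = t'"
        by - (rule pullback_eqI[OF K0], simp_all add: j'')
    qed simp_all
    with d1(2) have "pullback_stable C K j" by (rule pullback_stable_pullback)
    with d0(2) have "pullback_stable C K (j \<cdot> d0)"
      by - (rule pullback_stable_Comp[OF K], simp_all)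
    moreover have "j \<cdot> d0 = d"
      by (rule pullback_eqI[OF Kd])
        (use diagonalD(5,6)[OF d0(1)] diagonalD(5,6)[OF d] in \<open>simp_all add: j''\<close>)
    ultimately show ?thesis by simp
  qed
  then show ?thesis using ex by (auto simp: diagonal_stable_def)
qed

text \<open>
  Factor \<open>f = q \<cdot> c\<close> through its graph \<open>c : X \<rightarrow> X \<times>\<^sub>Z Y\<close>.  The projection \<open>q\<close> is a pullback of
  \<open>g \<cdot> f\<close>, and \<open>c\<close> is the pullback of the diagonal of \<open>g\<close> along
  \<open>s : X \<times>\<^sub>Z Y \<rightarrow> Y \<times>\<^sub>Z Y\<close>, since the graph consists of the pairs \<open>(x, y)\<close> with \<open>f x = y\<close>.
\<close>

lemma pullback_stable_cancel_left:
  assumes K: "comp_closed C K"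
    and gf: "pullback_stable C K (g \<cdot> f)" and g: "diagonal_stable C K g"
    and f: "f \<in> Arr C" and fg: "Cod C f = Dom C g"
  shows "pullback_stable C K f"
proof -
  note F [simp] = f diagonal_stableD(1)[OF g] fg
  obtain p1 q1 d1 where d1: "is_diagonal C g p1 q1 d1" "pullback_stable C K d1"
    using diagonal_stableE[OF g] .
  note E1 [simp] = diagonalD(2-4)[OF d1(1)] and K1 = diagonalD(1)[OF d1(1)]
  note L1 [simp] = pullbackD(3,4,6-8)[OF K1]
  obtain p q where P: "is_pullback C (g \<cdot> f) g p q"
    by (rule pullbacks_existE[OF pullback_stableD(2)[OF gf], of g]) simp_all
  have L [simp]: "p \<in> Arr C" "q \<in> Arr C" "Dom C q = Dom C p" "Cod C p = Dom C f" "Cod C q = Dom C g"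
    and pq: "g \<cdot> (f \<cdot> p) = g \<cdot> q"
    using pullbackD[OF P] by simp_all
  obtain c where c [simp]: "c \<in> Arr C" "Dom C c = Dom C f" "Cod C c = Dom C p"
    and c': "p \<cdot> c = Id C (Dom C f)" "q \<cdot> c = f"
    by (rule pullbackE[OF P, of "Id C (Dom C f)" f]) simp_all
  have c'': "p \<cdot> (c \<cdot> x) = x" "q \<cdot> (c \<cdot> x) = f \<cdot> x" if "x \<in> Arr C" "Cod C x = Dom C f" for x
    using that by (simp_all add: Comp_left_eq[OF c'(1)] Comp_left_eq[OF c'(2)])
  obtain s where s [simp]: "s \<in> Arr C" "Dom C s = Dom C p" "Cod C s = Dom C p1"
    and s': "p1 \<cdot> s = f \<cdot> p" "q1 \<cdot> s = q"
    by (rule pullbackE[OF K1, of "f \<cdot> p" q]) (use pq in simp_all)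
  have s'': "p1 \<cdot> (s \<cdot> x) = f \<cdot> (p \<cdot> x)" "q1 \<cdot> (s \<cdot> x) = q \<cdot> x"
    if "x \<in> Arr C" "Cod C x = Dom C p" for x
    using that by (simp_all add: Comp_left_cong[OF s'(1)] Comp_left_eq[OF s'(2)])
  have "is_pullback C d1 s f c"
  proof (rule pullbackI)
    show "d1 \<cdot> f = s \<cdot> c"
      by (rule pullback_eqI[OF K1]) (simp_all add: s'' c' diagonal_Comp[OF d1(1)])
  next
    fix y r
    assume yr [simp]: "y \<in> Arr C" "r \<in> Arr C" "Dom C r = Dom C y" "Cod C y = Dom C d1"
      "Cod C r = Dom C s" and eq: "d1 \<cdot> y = s \<cdot> r"
    have y: "f \<cdot> (p \<cdot> r) = y" "q \<cdot> r = y"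
      using arg_cong[OF eq, of "\<lambda>y. p1 \<cdot> y"] arg_cong[OF eq, of "\<lambda>y. q1 \<cdot> y"]
      by (simp_all add: s'' diagonal_Comp[OF d1(1)])
    have cr: "c \<cdot> (p \<cdot> r) = r"
      by (rule pullback_eqI[OF P]) (simp_all add: c'' y)
    show "\<exists>t. t \<in> Arr C \<and> Dom C t = Dom C y \<and> Cod C t = Dom C f \<and> f \<cdot> t = y \<and> c \<cdot> t = r"
      by (rule exI[of _ "p \<cdot> r"]) (simp add: y cr)
  next
    fix t t'
    assume t: "t \<in> Arr C" "t' \<in> Arr C" "Cod C t = Dom C f" "Cod C t' = Dom C f" "c \<cdot> t = c \<cdot> t'"
    have "t = p \<cdot> (c \<cdot> t)" "t' = p \<cdot> (c \<cdot> t')"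
      by (rule c''(1)[symmetric]; use t in simp)+
    then show "t = t'" using t(5) by metis
  qed simp_all
  with d1(2) have "pullback_stable C K c" by (rule pullback_stable_pullback)
  moreover have "pullback_stable C K q" using gf P by (rule pullback_stable_pullback)
  ultimately have "pullback_stable C K (q \<cdot> c)"
    by - (rule pullback_stable_Comp[OF K], simp_all)
  then show ?thesis by (simp add: c')
qed

text \<open>
  With \<open>j : X \<times>\<^sub>Y X \<rightarrow> X \<times>\<^sub>Z X\<close> the inclusion, the diagonal of \<open>g \<cdot> f\<close> is \<open>j \<cdot> d0\<close> for the
  diagonal \<open>d0\<close> of \<open>f\<close>.  As \<open>j\<close> is monic, pulling back along \<open>j\<close> recovers \<open>d0\<close>.
\<close>

lemma diagonal_stable_cancel_left:
  assumes gf: "diagonal_stable C K (g \<cdot> f)" and ex: "\<exists>p q. is_pullback C f f p q"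
    and g: "g \<in> Arr C" and f: "f \<in> Arr C" and fg: "Cod C f = Dom C g"
  shows "diagonal_stable C K f"
proof -
  note F [simp] = f g fg
  obtain a b d where d: "is_diagonal C (g \<cdot> f) a b d" "pullback_stable C K d"
    using diagonal_stableE[OF gf] .
  have E [simp]: "d \<in> Arr C" "Dom C d = Dom C f" "Cod C d = Dom C a"
    using diagonalD(2-4)[OF d(1)] by simp_all
  note Kd = diagonalD(1)[OF d(1)]
  have L [simp]: "a \<in> Arr C" "b \<in> Arr C" "Dom C b = Dom C a" "Cod C a = Dom C f" "Cod C b = Dom C f"
    using pullbackD[OF Kd] by simp_all
  have "pullback_stable C K d0" if d0: "is_diagonal C f p0 q0 d0" for p0 q0 d0
  proof -
    note E0 [simp] = diagonalD(2-4)[OF d0(1)] and K0 = diagonalD(1)[OF d0(1)]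
    note L0 [simp] = pullbackD(3,4,6-8)[OF K0]
    have fpq: "f \<cdot> p0 = f \<cdot> q0" using pullbackD(9)[OF K0] .
    obtain j where j [simp]: "j \<in> Arr C" "Dom C j = Dom C p0" "Cod C j = Dom C a"
      and j': "a \<cdot> j = p0" "b \<cdot> j = q0"
      by (rule pullbackE[OF Kd, of p0 q0]) (use fpq in simp_all)
    have j'': "a \<cdot> (j \<cdot> x) = p0 \<cdot> x" "b \<cdot> (j \<cdot> x) = q0 \<cdot> x"
      if "x \<in> Arr C" "Cod C x = Dom C p0" for x
      using that by (simp_all add: Comp_left_eq[OF j'(1)] Comp_left_eq[OF j'(2)])
    have dd: "a \<cdot> (d \<cdot> x) = x" "b \<cdot> (d \<cdot> x) = x" if "x \<in> Arr C" "Cod C x = Dom C f" for x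
      using that by (auto intro!: diagonal_Comp[OF d(1)])
    have "is_pullback C d j (Id C (Dom C f)) d0"
    proof (rule pullbackI)
      show "d \<cdot> Id C (Dom C f) = j \<cdot> d0"
        by (rule pullback_eqI[OF Kd])
          (use diagonalD(5,6)[OF d0(1)] diagonalD(5,6)[OF d(1)] in \<open>simp_all add: j''\<close>)
    next
      fix x r
      assume xr [simp]: "x \<in> Arr C" "r \<in> Arr C" "Dom C r = Dom C x" "Cod C x = Dom C d"
        "Cod C r = Dom C j" and eq: "d \<cdot> x = j \<cdot> r"
      have x: "p0 \<cdot> r = x" "q0 \<cdot> r = x"
        using arg_cong[OF eq, of "\<lambda>y. a \<cdot> y"] arg_cong[OF eq, of "\<lambda>y. b \<cdot> y"]
        by (simp_all add: j'' dd)
      have "d0 \<cdot> x = r"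
        by (rule pullback_eqI[OF K0]) (simp_all add: diagonal_Comp[OF d0] x)
      then show "\<exists>t. t \<in> Arr C \<and> Dom C t = Dom C x \<and> Cod C t = Dom C (Id C (Dom C f)) \<and>
          Id C (Dom C f) \<cdot> t = x \<and> d0 \<cdot> t = r"
        by (intro exI[of _ x]) simp
    next
      fix t t'
      assume "t \<in> Arr C" "t' \<in> Arr C" "Cod C t = Dom C (Id C (Dom C f))"
        "Cod C t' = Dom C (Id C (Dom C f))" "Id C (Dom C f) \<cdot> t = Id C (Dom C f) \<cdot> t'"
      then show "t = t'" by simp
    qed simp_all
    with d(2) show ?thesis by (rule pullback_stable_pullback)
  qed
  then show ?thesis using ex by (auto simp: diagonal_stable_def)
qed

text \<open>
  The map \<open>f \<times> f : X \<times>\<^sub>Z X \<rightarrow> Y \<times>\<^sub>Z Y\<close> is \<open>y1 \<cdot> y2\<close>, where \<open>y1 : X \<times>\<^sub>Z Y \<rightarrow> Y \<times>\<^sub>Z Y\<close> and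
  \<open>y2 : X \<times>\<^sub>Z X \<rightarrow> X \<times>\<^sub>Z Y\<close> are pullbacks of \<open>f\<close>.  It takes the diagonal \<open>e\<close> of \<open>g \<cdot> f\<close> to
  the diagonal \<open>d1\<close> of \<open>g\<close> preceded by \<open>f\<close>, so \<open>d1 \<cdot> f\<close> is stably in \<open>K\<close> and \<open>f\<close> can be
  cancelled.
\<close>

lemma diagonal_stable_cancel_right:
  assumes K: "comp_closed C K"
    and gf: "diagonal_stable C K (g \<cdot> f)" and f: "pullback_stable C K f"
    and f': "pullback_stable C (right_cancelling C K) f"
    and g: "g \<in> Arr C" "pullbacks_exist C g" and fg: "Cod C f = Dom C g"
    and diag: "\<And>p q d. is_diagonal C g p q d \<Longrightarrow> pullbacks_exist C d"
  shows "diagonal_stable C K g"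
proof -
  note F [simp] = pullback_stableD(1)[OF f] g(1) fg
  note fex = pullback_stableD(2)[OF f]
  have "pullback_stable C K d1" if d1: "is_diagonal C g a1 a2 d1" for a1 a2 d1
  proof -
    note E1 [simp] = diagonalD(2-4)[OF d1(1)] and K1 = diagonalD(1)[OF d1(1)]
    note L1 [simp] = pullbackD(3,4,6-8)[OF K1]
    obtain x1 y1 where P1: "is_pullback C f a1 x1 y1"
      by (rule pullbacks_existE[OF fex, of a1]) simp_all
    note M1 [simp] = pullbackD(3,4,6-8)[OF P1]
    obtain x2 y2 where P2: "is_pullback C f (a2 \<cdot> y1) x2 y2"
      by (rule pullbacks_existE[OF fex, of "a2 \<cdot> y1"]) simp_all
    have M2 [simp]: "x2 \<in> Arr C" "y2 \<in> Arr C" "Dom C y2 = Dom C x2" "Cod C x2 = Dom C f"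
      "Cod C y2 = Dom C x1"
      using pullbackD[OF P2] by simp_all
    \<comment> \<open>The domain of \<open>y2\<close> is a kernel pair of \<open>g \<cdot> f\<close>, so the diagonal into it is available.\<close>
    have P: "is_pullback C (g \<cdot> f) (g \<cdot> f) (x1 \<cdot> y2) x2"
      using pullback_paste_left[OF pullback_sym[OF pullback_paste_left[OF K1 P1]] P2]
      by (rule pullback_sym)
    obtain e where e: "is_diagonal C (g \<cdot> f) (x1 \<cdot> y2) x2 e"
      using diagonal_exists[OF P] .
    have [simp]: "e \<in> Arr C" "Dom C e = Dom C f" "Cod C e = Dom C x2"
      using diagonalD(2-4)[OF e] by simp_all
    have e': "x1 \<cdot> (y2 \<cdot> e) = Id C (Dom C f)" "x2 \<cdot> e = Id C (Dom C f)"
      using diagonalD(5,6)[OF e] by simp_all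
    have "pullback_stable C K e" using diagonal_stableD(2)[OF gf e] .
    moreover have "pullback_stable C K y2" "pullback_stable C K y1"
      using pullback_stable_pullback[OF f P1] pullback_stable_pullback[OF f P2] by simp_all
    ultimately have "pullback_stable C K (y1 \<cdot> (y2 \<cdot> e))"
      by (simp add: pullback_stable_Comp[OF K])
    moreover have "y1 \<cdot> (y2 \<cdot> e) = d1 \<cdot> f"
    proof (rule pullback_eqI[OF K1])
      have "a1 \<cdot> (y1 \<cdot> (y2 \<cdot> e)) = f \<cdot> (x1 \<cdot> (y2 \<cdot> e))"
        by (rule Comp_left_cong) (use pullbackD(9)[OF P1] in simp_all)
      then show "a1 \<cdot> (y1 \<cdot> (y2 \<cdot> e)) = a1 \<cdot> (d1 \<cdot> f)"
        by (simp add: e' diagonal_Comp[OF d1])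
      have "(a2 \<cdot> y1) \<cdot> (y2 \<cdot> e) = f \<cdot> (x2 \<cdot> e)"
        by (rule Comp_left_cong) (use pullbackD(9)[OF P2] in simp_all)
      then show "a2 \<cdot> (y1 \<cdot> (y2 \<cdot> e)) = a2 \<cdot> (d1 \<cdot> f)"
        by (simp add: e' diagonal_Comp[OF d1])
    qed simp_all
    ultimately have "pullback_stable C K (d1 \<cdot> f)" by simp
    then show ?thesis
      using f' diag[OF d1] by (rule pullback_stable_cancel_right) simp_all
  qed
  then show ?thesis using g by (auto simp: diagonal_stable_def pullbacks_exist_def)
qed

end

section \<open>The subobject calculus\<close>

text \<open>
  A subobject is determined by the arrows that factor through it.  In terms of these arrows, inverse
  images become composition (\<open>below_inverse_image\<close>) and meets become conjunction (\<open>Sub_meet\<close>), so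
  that most identities between subobjects reduce to propositional reasoning.
\<close>

definition below :: "('o, 'a) fact_category \<Rightarrow> 'a \<Rightarrow> 'a set \<Rightarrow> bool" where
  "below C f p \<longleftrightarrow> (\<exists>n \<in> p. factors_through C f n)"

context proper_factorization
begin

lemma MM_Arr [simp]: "m \<in> MM C \<Longrightarrow> m \<in> Arr C"
  using MM_mono by (auto simp: is_mono_def)

lemma EE_Arr [simp]: "e \<in> EE C \<Longrightarrow> e \<in> Arr C"
  using EE_epi by (auto simp: is_epi_def)

lemma is_isoI:
  assumes "e \<in> Arr C" "t \<in> Arr C" "Dom C t = Cod C e" "Cod C t = Dom C e"
    "t \<cdot> e = Id C (Dom C e)" "e \<cdot> t = Id C (Cod C e)"
  shows "is_iso C e"
  using assms unfolding is_iso_def Hom_def by blast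

lemma Id_iso: "X \<in> Obj C \<Longrightarrow> is_iso C (Id C X)"
  by (rule is_isoI[of _ "Id C X"]) simp_all

lemma mono_cancel:
  assumes "is_mono C m" "m \<cdot> g = m \<cdot> h" "g \<in> Arr C" "h \<in> Arr C" "Cod C g = Dom C m"
    "Cod C h = Dom C m" "Dom C g = Dom C h"
  shows "g = h"
proof -
  have "g \<in> Hom C (Dom C h) (Dom C m)" "h \<in> Hom C (Dom C h) (Dom C m)"
    using assms by (auto simp: Hom_def)
  then show ?thesis using assms(1,2) by (auto simp: is_mono_def)
qed

lemma epi_cancel:
  assumes "is_epi C e" "g \<cdot> e = h \<cdot> e" "g \<in> Arr C" "h \<in> Arr C" "Dom C g = Cod C e"
    "Dom C h = Cod C e" "Cod C g = Cod C h"
  shows "g = h"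
proof -
  have "g \<in> Hom C (Cod C e) (Cod C h)" "h \<in> Hom C (Cod C e) (Cod C h)"
    using assms by (auto simp: Hom_def)
  then show ?thesis using assms(1,2) by (auto simp: is_epi_def)
qed

lemma MM_cancel:
  assumes "m \<in> MM C" "m \<cdot> g = m \<cdot> h" "g \<in> Arr C" "h \<in> Arr C" "Cod C g = Dom C m"
    "Cod C h = Dom C m" "Dom C g = Dom C h"
  shows "g = h"
  using mono_cancel[OF MM_mono[OF assms(1)] assms(2-7)] .

lemma Id_EE: "X \<in> Obj C \<Longrightarrow> Id C X \<in> EE C"
  by (simp add: iso_EE Id_iso)

lemma factors_throughE:
  assumes "factors_through C a n"
  obtains k where "k \<in> Arr C" "Dom C k = Dom C a" "Cod C k = Dom C n" "n \<cdot> k = a"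
    "Cod C a = Cod C n"
  using assms by (auto simp: factors_through_def Hom_def)

lemma factors_through_Cod: "factors_through C a n \<Longrightarrow> Cod C a = Cod C n"
  by (simp add: factors_through_def)

lemma factors_throughI:
  assumes "k \<in> Arr C" "n \<in> Arr C" "Cod C k = Dom C n"
  shows "factors_through C (n \<cdot> k) n"
  using assms by (auto simp: factors_through_def Hom_def)

lemma factors_through_refl: "n \<in> Arr C \<Longrightarrow> factors_through C n n"
  using factors_throughI[of "Id C (Dom C n)" n] by simp

lemma factors_through_trans:
  assumes "factors_through C a m" "factors_through C m n" "m \<in> Arr C" "n \<in> Arr C"
  shows "factors_through C a n"
proof -
  obtain k where k: "k \<in> Arr C" "Cod C k = Dom C m" "m \<cdot> k = a"
    using assms(1) by (rule factors_throughE)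
  obtain l where l: "l \<in> Arr C" "Dom C l = Dom C m" "Cod C l = Dom C n" "n \<cdot> l = m"
    using assms(2) by (rule factors_throughE)
  have "n \<cdot> (l \<cdot> k) = a" using Comp_left_eq[OF l(4)] k l assms(4) by simp
  moreover have "factors_through C (n \<cdot> (l \<cdot> k)) n"
    by (rule factors_throughI) (use k l assms(4) in simp_all)
  ultimately show ?thesis by simp
qed

lemma factors_through_Comp:
  assumes "factors_through C m n" "m \<in> Arr C" "n \<in> Arr C" "a \<in> Arr C" "Cod C a = Dom C m"
  shows "factors_through C (m \<cdot> a) n"
  using factors_through_trans[OF factors_throughI[of a m] assms(1)] assms by simp

lemma factors_through_Comp_left:
  assumes "factors_through C m n" "m \<in> Arr C" "n \<in> Arr C" "f \<in> Arr C" "Cod C n = Dom C f"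
  shows "factors_through C (f \<cdot> m) (f \<cdot> n)"
proof -
  obtain k where "k \<in> Arr C" "Cod C k = Dom C n" "n \<cdot> k = m"
    using assms(1) by (rule factors_throughE)
  then show ?thesis using factors_throughI[of k "f \<cdot> n"] assms by simp
qed

lemma mem_subobj:
  "n \<in> subobj C m \<longleftrightarrow> n \<in> MM C \<and> factors_through C m n \<and> factors_through C n m"
  by (simp add: subobj_def)

lemma subobjD:
  assumes "n \<in> subobj C m"
  shows "n \<in> MM C" "Cod C n = Cod C m" "factors_through C m n" "factors_through C n m"
  using assms factors_through_Cod[of n m] by (simp_all add: mem_subobj)

lemma subobj_self: "m \<in> MM C \<Longrightarrow> m \<in> subobj C m"
  by (simp add: subobj_def factors_through_refl)

lemma subobj_eq:
  assumes "m \<in> MM C" "n \<in> MM C" "factors_through C m n" "factors_through C n m"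
  shows "subobj C m = subobj C n"
  using assms by (auto simp: subobj_def intro: factors_through_trans MM_Arr)

lemma subobj_closed: "m \<in> MM C \<Longrightarrow> subobj C m \<in> carrier (Sub C (Cod C m))"
  by (auto simp: Sub_def)

lemma SubE:
  assumes "p \<in> carrier (Sub C X)"
  obtains m where "m \<in> MM C" "Cod C m = X" "p = subobj C m"
  using assms by (auto simp: Sub_def)

lemma Sub_memD:
  assumes "p \<in> carrier (Sub C X)" "n \<in> p"
  shows "n \<in> MM C" "Cod C n = X" "p = subobj C n"
proof -
  obtain m where m: "m \<in> MM C" "Cod C m = X" "p = subobj C m" using assms(1) by (rule SubE)
  then have n: "n \<in> MM C" "factors_through C m n" "factors_through C n m"
    using assms(2) by (simp_all add: subobj_def)
  show "n \<in> MM C" by (rule n(1))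
  show "Cod C n = X" using factors_through_Cod[OF n(3)] m(2) by simp
  show "p = subobj C n" using m(3) subobj_eq[OF m(1) n] by simp
qed

lemma below_subobj:
  assumes "n \<in> MM C"
  shows "below C a (subobj C n) \<longleftrightarrow> factors_through C a n"
proof
  assume "below C a (subobj C n)"
  then obtain n' where "n' \<in> MM C" "factors_through C n' n" "factors_through C a n'"
    unfolding below_def subobj_def by blast
  then show "factors_through C a n" using assms factors_through_trans[of a n' n] by simp
qed (use subobj_self[OF assms] in \<open>auto simp: below_def\<close>)

lemma below_Comp:
  assumes "below C a p" "p \<in> carrier (Sub C X)" "a \<in> Arr C" "b \<in> Arr C" "Cod C b = Dom C a"
  shows "below C (a \<cdot> b) p"
proof -
  obtain n where "n \<in> MM C" "p = subobj C n" using assms(2) by (rule SubE)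
  then show ?thesis using assms factors_through_Comp[of a n b] by (simp add: below_subobj)
qed

lemma Sub_le_iff_subobj:
  assumes "m \<in> MM C" "q \<in> carrier (Sub C X)"
  shows "subobj C m \<sqsubseteq>\<^bsub>Sub C X\<^esub> q \<longleftrightarrow> below C m q"
proof -
  obtain n where n: "n \<in> MM C" "q = subobj C n" using assms(2) by (rule SubE)
  have "subobj C m \<sqsubseteq>\<^bsub>Sub C X\<^esub> q \<longleftrightarrow> (\<exists>m' \<in> subobj C m. below C m' q)"
    by (simp add: Sub_def below_def)
  also have "\<dots> \<longleftrightarrow> below C m q"
  proof
    assume "\<exists>m' \<in> subobj C m. below C m' q"
    then obtain m' where "m' \<in> MM C" "factors_through C m m'" "factors_through C m' n"
      using n by (auto simp: below_subobj mem_subobj)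
    then show "below C m q" using n factors_through_trans[of m m' n] by (simp add: below_subobj)
  qed (use subobj_self[OF assms(1)] in blast)
  finally show ?thesis .
qed

lemma Sub_le_iff:
  assumes "p \<in> carrier (Sub C X)" "q \<in> carrier (Sub C X)"
  shows "p \<sqsubseteq>\<^bsub>Sub C X\<^esub> q \<longleftrightarrow> (\<forall>a \<in> Arr C. Cod C a = X \<longrightarrow> below C a p \<longrightarrow> below C a q)"
proof -
  obtain m where m: "m \<in> MM C" "Cod C m = X" "p = subobj C m" using assms(1) by (rule SubE)
  obtain n where n: "n \<in> MM C" "q = subobj C n" using assms(2) by (rule SubE)
  show ?thesis
    using m n assms(2) factors_through_refl[of m]
    by (auto simp: Sub_le_iff_subobj below_subobj intro: factors_through_trans)
qed

lemma Sub_eqI: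
  assumes p: "p \<in> carrier (Sub C X)" and q: "q \<in> carrier (Sub C X)"
    and eq: "\<And>a. \<lbrakk>a \<in> Arr C; Cod C a = X\<rbrakk> \<Longrightarrow> below C a p \<longleftrightarrow> below C a q"
  shows "p = q"
proof -
  obtain m where m: "m \<in> MM C" "Cod C m = X" "p = subobj C m" using p by (rule SubE)
  obtain n where n: "n \<in> MM C" "Cod C n = X" "q = subobj C n" using q by (rule SubE)
  have "factors_through C m n" "factors_through C n m"
    using eq[of m] eq[of n] m n by (simp_all add: below_subobj factors_through_refl)
  then show ?thesis using subobj_eq[OF m(1) n(1)] m(3) n(3) by simp
qed

text \<open>
  The diagonal property says that an arrow factors through an \<open>\<M>\<close>-subobject as soon as it does so
  after precomposition with an \<open>\<E>\<close>-morphism.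
\<close>

lemma below_Comp_EE:
  assumes e: "e \<in> EE C" and m: "m \<in> Arr C" "Cod C e = Dom C m"
    and p: "p \<in> carrier (Sub C (Cod C m))"
  shows "below C (m \<cdot> e) p \<longleftrightarrow> below C m p"
proof
  obtain n where n: "n \<in> MM C" "Cod C n = Cod C m" "p = subobj C n" using p by (rule SubE)
  assume "below C (m \<cdot> e) p"
  then obtain k where k: "k \<in> Arr C" "Dom C k = Dom C e" "Cod C k = Dom C n" "n \<cdot> k = m \<cdot> e"
    by - (rule factors_throughE[of "m \<cdot> e" n], use n e m in \<open>simp_all add: below_subobj\<close>)
  then have "\<exists>!d. d \<in> Hom C (Cod C e) (Dom C n) \<and> d \<cdot> e = k \<and> n \<cdot> d = m"
    using e n m by (intro diagonal) (simp_all add: Hom_def)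
  then obtain d where d: "d \<in> Hom C (Cod C e) (Dom C n)" "n \<cdot> d = m" by blast
  then have "factors_through C m n" using factors_throughI[of d n] n by (auto simp: Hom_def)
  then show "below C m p" using n by (simp add: below_subobj)
qed (use assms below_Comp in auto)

lemma factorizationE:
  assumes "f \<in> Arr C"
  obtains e m where "e \<in> EE C" "m \<in> MM C" "Cod C e = Dom C m" "m \<cdot> e = f"
    "Dom C e = Dom C f" "Cod C m = Cod C f"
proof -
  obtain e m where em: "e \<in> EE C" "m \<in> MM C" "Cod C e = Dom C m" "f = m \<cdot> e"
    using factorization[OF assms] by blast
  show ?thesis by (rule that[of e m]) (use em(1-3) in \<open>simp_all add: em(4)\<close>)
qed

subsection \<open>Inverse images\<close>

text \<open>
  Factor \<open>m = m' \<cdot> e\<close>.  The diagonal filler \<open>d\<close> and the pullback property give \<open>t\<close> with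
  \<open>t \<cdot> e = id\<close>; an epimorphism that is a section is invertible.
\<close>

lemma pullback_MM:
  assumes P: "is_pullback C f n m k" and n: "n \<in> MM C"
  shows "m \<in> MM C"
proof -
  note D [simp] = pullbackD(1-8)[OF P]
  obtain e m' where em [simp]: "e \<in> EE C" "m' \<in> MM C" "Cod C e = Dom C m'" "Dom C e = Dom C m"
    "Cod C m' = Cod C m" and m: "m' \<cdot> e = m"
    using factorizationE[OF D(3)] by metis
  have eq: "n \<cdot> k = (f \<cdot> m') \<cdot> e" using pullbackD(9)[OF P] by (simp add: m)
  then have "\<exists>!d. d \<in> Hom C (Cod C e) (Dom C n) \<and> d \<cdot> e = k \<and> n \<cdot> d = f \<cdot> m'"
    using n by (intro diagonal) (simp_all add: Hom_def)
  then obtain d where d [simp]: "d \<in> Arr C" "Dom C d = Dom C m'" "Cod C d = Dom C n"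
    and d': "d \<cdot> e = k" "n \<cdot> d = f \<cdot> m'"
    by (auto simp: Hom_def)
  obtain t where t [simp]: "t \<in> Arr C" "Dom C t = Dom C m'" "Cod C t = Dom C m"
    and t': "m \<cdot> t = m'" "k \<cdot> t = d"
    by (rule pullbackE[OF P, of m' d]) (use d' in simp_all)
  have te: "t \<cdot> e = Id C (Dom C m)"
    by (rule pullback_eqI[OF P])
      (use d' m in \<open>simp_all add: Comp_left_eq[OF t'(1)] Comp_left_eq[OF t'(2)]\<close>)
  have "e \<cdot> t = Id C (Dom C m')"
    by (rule epi_cancel[OF EE_epi[OF em(1)]]) (simp_all add: te)
  then have "is_iso C e"
    using te by (intro is_isoI[of e t]) simp_all
  then have "m' \<cdot> e \<in> MM C" by (simp add: MM_Comp iso_MM)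
  then show ?thesis by (simp add: m)
qed

lemma pullback_factors_through:
  assumes P: "is_pullback C f n m k" and a: "a \<in> Arr C" "Cod C a = Dom C f"
  shows "factors_through C a m \<longleftrightarrow> factors_through C (f \<cdot> a) n"
proof
  note D [simp] = pullbackD(1-8)[OF P]
  assume "factors_through C a m"
  then obtain x where x: "x \<in> Arr C" "Dom C x = Dom C a" "Cod C x = Dom C m" "m \<cdot> x = a"
    by (rule factors_throughE)
  then have "n \<cdot> (k \<cdot> x) = f \<cdot> a"
    using Comp_left_cong[OF pullbackD(9)[OF P], of x] by simp
  then show "factors_through C (f \<cdot> a) n"
    using factors_throughI[of "k \<cdot> x" n] x by simp
next
  note D [simp] = pullbackD(1-8)[OF P]
  assume "factors_through C (f \<cdot> a) n"
  then obtain x where "x \<in> Arr C" "Dom C x = Dom C a" "Cod C x = Dom C n" "n \<cdot> x = f \<cdot> a"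
    by (rule factors_throughE) (use a in simp)
  then obtain t where "t \<in> Arr C" "Cod C t = Dom C m" "m \<cdot> t = a"
    by - (rule pullbackE[OF P, of a x], use a in simp_all)
  then show "factors_through C a m" using factors_throughI[of t m] by simp
qed

lemma pullback_of_factors_through:
  assumes n: "n \<in> MM C" "Cod C n = Cod C f" and f: "f \<in> Arr C"
    and m: "m \<in> MM C" "Cod C m = Dom C f"
    and eq: "\<And>a. \<lbrakk>a \<in> Arr C; Cod C a = Dom C f\<rbrakk>
      \<Longrightarrow> factors_through C a m \<longleftrightarrow> factors_through C (f \<cdot> a) n"
  obtains k where "is_pullback C f n m k"
proof -
  have "factors_through C (f \<cdot> m) n" using eq[of m] m factors_through_refl by simp
  then obtain k where k [simp]: "k \<in> Arr C" "Dom C k = Dom C m" "Cod C k = Dom C n"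
    and fm: "n \<cdot> k = f \<cdot> m"
    by (rule factors_throughE) (use m f in simp)
  note [simp] = n f m
  have "is_pullback C f n m k"
  proof (rule pullbackI)
    fix a b
    assume ab [simp]: "a \<in> Arr C" "b \<in> Arr C" "Dom C b = Dom C a" "Cod C a = Dom C f"
      "Cod C b = Dom C n" and ab': "f \<cdot> a = n \<cdot> b"
    have "factors_through C a m" using eq[of a] factors_throughI[of b n] ab' by simp
    then obtain t where t [simp]: "t \<in> Arr C" "Dom C t = Dom C a" "Cod C t = Dom C m"
      and t': "m \<cdot> t = a"
      by (rule factors_throughE)
    have "f \<cdot> (m \<cdot> t) = n \<cdot> (k \<cdot> t)" by (rule Comp_left_cong) (simp_all add: fm)
    then have "n \<cdot> (k \<cdot> t) = n \<cdot> b" using ab' t' by simp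
    then have "k \<cdot> t = b" by (rule MM_cancel[OF n(1)]) simp_all
    then show "\<exists>t. t \<in> Arr C \<and> Dom C t = Dom C a \<and> Cod C t = Dom C m \<and> m \<cdot> t = a \<and> k \<cdot> t = b"
      by (intro exI[of _ t]) (simp add: t')
  next
    fix t t'
    assume "t \<in> Arr C" "t' \<in> Arr C" "Dom C t = Dom C t'" "Cod C t = Dom C m"
      "Cod C t' = Dom C m" "m \<cdot> t = m \<cdot> t'"
    then show "t = t'" using MM_cancel[OF m(1)] by blast
  qed (simp_all add: fm)
  then show ?thesis using that by blast
qed

text \<open>
  Every pullback of every representative has the same arrows below it, and conversely any
  \<open>\<M>\<close>-morphism with these arrows below it is a pullback.  So the union in the definition of the
  inverse image is a single class.
\<close>

lemma inverse_image_subobj: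
  assumes P: "is_pullback C f n m k" and n: "n \<in> MM C"
  shows "inverse_image C f (subobj C n) = subobj C m"
proof -
  note D = pullbackD[OF P]
  have m: "m \<in> MM C" using P n by (rule pullback_MM)
  have eq: "factors_through C (f \<cdot> a) n' \<longleftrightarrow> factors_through C (f \<cdot> a) n"
    if "n' \<in> subobj C n" for a n'
    using that n by (auto simp: mem_subobj intro: factors_through_trans)
  have "m' \<in> subobj C m" if mi: "m' \<in> inverse_image C f (subobj C n)" for m'
  proof -
    obtain n' k' where n': "n' \<in> subobj C n" and P': "is_pullback C f n' m' k'"
      using mi unfolding inverse_image_def by blast
    have m': "m' \<in> MM C" using P' n' by (auto simp: mem_subobj intro: pullback_MM)
    have iff: "factors_through C a m' \<longleftrightarrow> factors_through C a m"
      if "a \<in> Arr C" "Cod C a = Dom C f" for a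
      using pullback_factors_through[OF P'] pullback_factors_through[OF P] that eq[OF n'] by simp
    have "factors_through C m' m" "factors_through C m m'"
      using iff[of m'] iff[of m] m m' D(7) pullbackD(7)[OF P'] factors_through_refl by simp_all
    then show ?thesis using m' by (simp add: subobj_def)
  qed
  moreover have "m' \<in> inverse_image C f (subobj C n)" if m': "m' \<in> subobj C m" for m'
  proof -
    have mm: "m' \<in> MM C" "Cod C m' = Dom C f"
      using subobjD[OF m'] D(7) by simp_all
    moreover have "factors_through C a m' \<longleftrightarrow> factors_through C (f \<cdot> a) n"
      if "a \<in> Arr C" "Cod C a = Dom C f" for a
      using m' mm(1) m pullback_factors_through[OF P that] factors_through_trans[of a m m']
        factors_through_trans[of a m' m]
      by (auto simp: mem_subobj)
    ultimately obtain k' where "is_pullback C f n m' k'"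
      using pullback_of_factors_through[of n f m'] n D(1,5) by blast
    then show ?thesis
      using subobj_self[OF n] by (auto simp: inverse_image_def)
  qed
  ultimately show ?thesis by blast
qed

subsection \<open>Direct images\<close>

text \<open>
  Any two \<open>\<M>\<close>-parts of an arrow factor through each other by \<open>below_Comp_EE\<close>; conversely, an
  isomorphism between representatives is absorbed into the \<open>\<E>\<close>-part.
\<close>

lemma M_part_Comp:
  assumes "e \<in> EE C" "m \<in> MM C" "Cod C e = Dom C m"
  shows "M_part C (m \<cdot> e) = subobj C m"
proof (rule equalityI; rule subsetI)
  fix m'
  assume "m' \<in> M_part C (m \<cdot> e)"
  then obtain e' where e': "m' \<in> MM C" "e' \<in> EE C" "Cod C e' = Dom C m'" "m' \<cdot> e' = m \<cdot> e"
    by (auto simp: M_part_def)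
  have cod: "Cod C m' = Cod C m"
    using e' assms by (metis Cod_Comp EE_Arr MM_Arr)
  have "below C m (subobj C m')" "below C m' (subobj C m)"
    using below_Comp_EE[OF assms(1) _ assms(3), of "subobj C m'"]
      below_Comp_EE[OF e'(2) _ e'(3), of "subobj C m"]
      e' assms cod subobj_closed[of m] subobj_closed[of m']
      factors_throughI[of e m] factors_throughI[of e' m']
    by (auto simp: below_subobj)
  then show "m' \<in> subobj C m" using e' assms by (simp add: below_subobj mem_subobj)
next
  fix m'
  assume m': "m' \<in> subobj C m"
  then have mm: "m' \<in> MM C" "Cod C m' = Cod C m" using subobjD[OF m'] by simp_all
  obtain i where i: "i \<in> Arr C" "Dom C i = Dom C m" "Cod C i = Dom C m'" "m' \<cdot> i = m"
    by (rule factors_throughE[of m m']) (use m' in \<open>simp_all add: mem_subobj\<close>)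
  obtain j where j: "j \<in> Arr C" "Dom C j = Dom C m'" "Cod C j = Dom C m" "m \<cdot> j = m'"
    by (rule factors_throughE[of m' m]) (use m' in \<open>simp_all add: mem_subobj\<close>)
  have "m \<cdot> (j \<cdot> i) = m \<cdot> Id C (Dom C m)"
    using Comp_left_eq[OF j(4), of i] i j assms by simp
  then have ji: "j \<cdot> i = Id C (Dom C m)"
    using MM_cancel[OF assms(2)] i j assms by simp
  have "m' \<cdot> (i \<cdot> j) = m' \<cdot> Id C (Dom C m')"
    using Comp_left_eq[OF i(4), of j] i j mm by simp
  then have ij: "i \<cdot> j = Id C (Dom C m')"
    using MM_cancel[OF mm(1)] i j mm by simp
  have "is_iso C i" using i j ij ji mm assms by (intro is_isoI[of i j]) simp_all
  then have "i \<cdot> e \<in> EE C" using assms i EE_Comp iso_EE by simp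
  moreover have "m' \<cdot> (i \<cdot> e) = m \<cdot> e"
    using Comp_left_eq[OF i(4), of e] i assms mm by simp
  moreover have "Cod C (i \<cdot> e) = Dom C m'" using assms i by simp
  ultimately show "m' \<in> M_part C (m \<cdot> e)"
    using mm(1) unfolding M_part_def by (intro CollectI conjI bexI[of _ "i \<cdot> e"]) simp_all
qed

lemma direct_image_subobj:
  assumes n: "n \<in> MM C" "Cod C n = Dom C f" and f: "f \<in> Arr C"
    and em: "e \<in> EE C" "m \<in> MM C" "Cod C e = Dom C m" "m \<cdot> e = f \<cdot> n"
  shows "direct_image C f (subobj C n) = subobj C m"
proof -
  have cod: "Cod C m = Cod C f" using em n f by (metis Cod_Comp EE_Arr MM_Arr)
  have "M_part C (f \<cdot> n') = subobj C m" if "n' \<in> subobj C n" for n'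
  proof -
    have n': "n' \<in> MM C" "Cod C n' = Dom C f" "factors_through C n n'" "factors_through C n' n"
      using subobjD[OF that] n by simp_all
    obtain e' m' where em': "e' \<in> EE C" "m' \<in> MM C" "Cod C e' = Dom C m'" "m' \<cdot> e' = f \<cdot> n'"
      "Cod C m' = Cod C f"
      using factorizationE[of "f \<cdot> n'"] n' f by (metis Comp_Arr Cod_Comp MM_Arr)
    have fn: "factors_through C (f \<cdot> n) (f \<cdot> n')" "factors_through C (f \<cdot> n') (f \<cdot> n)"
      using n n' f by (auto intro!: factors_through_Comp_left)
    have "factors_through C (m \<cdot> e) m'" "factors_through C (m' \<cdot> e') m"
      using factors_through_trans[OF fn(1), of m'] factors_through_trans[OF fn(2), of m]
        factors_throughI[of e m] factors_throughI[of e' m'] em em' n n' f by simp_all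
    then have "factors_through C m m'" "factors_through C m' m"
      using below_Comp_EE[OF em(1), of m "subobj C m'"] below_Comp_EE[OF em'(1), of m' "subobj C m"]
        em em' cod subobj_closed[of m] subobj_closed[of m']
      by (simp_all add: below_subobj)
    then have "subobj C m' = subobj C m" using em em' by (intro subobj_eq) simp_all
    then show ?thesis using M_part_Comp[of e' m'] em' by simp
  qed
  then show ?thesis using subobj_self[OF n(1)] by (auto simp: direct_image_def)
qed

lemma direct_image_closed:
  assumes f: "f \<in> Arr C" and p: "p \<in> carrier (Sub C (Dom C f))"
  shows "direct_image C f p \<in> carrier (Sub C (Cod C f))"
proof -
  obtain n where n: "n \<in> MM C" "Cod C n = Dom C f" "p = subobj C n" using p by (rule SubE)
  obtain e m where em: "e \<in> EE C" "m \<in> MM C" "Cod C e = Dom C m" "m \<cdot> e = f \<cdot> n"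
    "Cod C m = Cod C (f \<cdot> n)"
    using factorizationE[of "f \<cdot> n"] n f by (metis Comp_Arr MM_Arr)
  then show ?thesis using direct_image_subobj[OF n(1,2) f em(1-4)] subobj_closed[of m] n f by simp
qed

lemma direct_image_le:
  assumes f: "f \<in> Arr C" and n: "n \<in> MM C" "Cod C n = Dom C f"
    and q: "q \<in> carrier (Sub C (Cod C f))"
  shows "direct_image C f (subobj C n) \<sqsubseteq>\<^bsub>Sub C (Cod C f)\<^esub> q \<longleftrightarrow> below C (f \<cdot> n) q"
proof -
  obtain e m where em: "e \<in> EE C" "m \<in> MM C" "Cod C e = Dom C m" "m \<cdot> e = f \<cdot> n"
    "Cod C m = Cod C (f \<cdot> n)"
    using factorizationE[of "f \<cdot> n"] n f by (metis Comp_Arr MM_Arr)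
  then show ?thesis
    using direct_image_subobj[OF n f em(1-4)] Sub_le_iff_subobj[OF em(2) q]
      below_Comp_EE[OF em(1) _ em(3), of q] q n f by simp
qed

lemma below_direct_image:
  assumes f: "f \<in> Arr C" and p: "p \<in> carrier (Sub C (Dom C f))"
    and a: "a \<in> Arr C" "Cod C a = Dom C f" "below C a p"
  shows "below C (f \<cdot> a) (direct_image C f p)"
proof -
  obtain n where n: "n \<in> MM C" "Cod C n = Dom C f" "p = subobj C n" using p by (rule SubE)
  obtain e m where em: "e \<in> EE C" "m \<in> MM C" "Cod C e = Dom C m" "m \<cdot> e = f \<cdot> n"
    using factorizationE[of "f \<cdot> n"] n f by (metis Comp_Arr MM_Arr)
  have "factors_through C (f \<cdot> a) (f \<cdot> n)" "factors_through C (f \<cdot> n) m"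
    using a n f factors_throughI[of e m] em by (auto simp: below_subobj intro!: factors_through_Comp_left)
  then show ?thesis
    using direct_image_subobj[OF n(1,2) f em] em n f
    by (auto simp: below_subobj intro: factors_through_trans[of _ "f \<cdot> n"])
qed

lemma direct_image_MM:
  assumes m: "m \<in> MM C" and n: "n \<in> MM C" "Cod C n = Dom C m"
  shows "direct_image C m (subobj C n) = subobj C (m \<cdot> n)"
  using direct_image_subobj[of n m "Id C (Dom C n)" "m \<cdot> n"] assms
  by (simp add: MM_Comp Id_EE)

lemma comp_sub_eq_direct_image:
  assumes m: "m \<in> MM C" and p: "p \<in> carrier (Sub C (Dom C m))"
  shows "comp_sub C m p = direct_image C m p"
proof -
  have "M_part C (m \<cdot> n) = subobj C (m \<cdot> n)" if "n \<in> p" for n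
    using M_part_Comp[of "Id C (Dom C n)" "m \<cdot> n"] Sub_memD(1,2)[OF p that] m
    by (simp add: MM_Comp Id_EE)
  then show ?thesis by (simp add: comp_sub_def direct_image_def)
qed

end

context nbd_context
begin

lemma pullback_exists:
  assumes "f \<in> Arr C" "h \<in> Arr C" "Cod C f = Cod C h"
  obtains p q where "is_pullback C f h p q"
  using assms finitely_complete unfolding finitely_complete_def by blast

lemma inverse_image_closed [simp]:
  assumes f: "f \<in> Arr C" and p: "p \<in> carrier (Sub C (Cod C f))"
  shows "inverse_image C f p \<in> carrier (Sub C (Dom C f))"
proof -
  obtain n where n: "n \<in> MM C" "Cod C n = Cod C f" "p = subobj C n" using p by (rule SubE)
  obtain m k where P: "is_pullback C f n m k"
    by (rule pullback_exists[of f n]) (use n f in simp_all)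
  show ?thesis
    using inverse_image_subobj[OF P n(1)] subobj_closed[OF pullback_MM[OF P n(1)]]
      pullbackD(7)[OF P] n(3) by simp
qed

lemma below_inverse_image:
  assumes f: "f \<in> Arr C" and p: "p \<in> carrier (Sub C (Cod C f))"
    and a: "a \<in> Arr C" "Cod C a = Dom C f"
  shows "below C a (inverse_image C f p) \<longleftrightarrow> below C (f \<cdot> a) p"
proof -
  obtain n where n: "n \<in> MM C" "Cod C n = Cod C f" "p = subobj C n" using p by (rule SubE)
  obtain m k where P: "is_pullback C f n m k"
    by (rule pullback_exists[of f n]) (use n f in simp_all)
  show ?thesis
    using inverse_image_subobj[OF P n(1)] pullback_MM[OF P n(1)] n(1,3)
      pullback_factors_through[OF P a] by (simp add: below_subobj)
qed

lemma inverse_image_mono: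
  assumes f: "f \<in> Arr C" and p: "p \<in> carrier (Sub C (Cod C f))"
    and q: "q \<in> carrier (Sub C (Cod C f))" and le: "p \<sqsubseteq>\<^bsub>Sub C (Cod C f)\<^esub> q"
  shows "inverse_image C f p \<sqsubseteq>\<^bsub>Sub C (Dom C f)\<^esub> inverse_image C f q"
  using le f p q by (simp add: Sub_le_iff below_inverse_image)

lemma inverse_image_Comp:
  assumes f: "f \<in> Arr C" and g: "g \<in> Arr C" and fg: "Cod C f = Dom C g"
    and p: "p \<in> carrier (Sub C (Cod C g))"
  shows "inverse_image C (g \<cdot> f) p = inverse_image C f (inverse_image C g p)"
proof (rule Sub_eqI[of _ "Dom C f"])
  show "inverse_image C (g \<cdot> f) p \<in> carrier (Sub C (Dom C f))"
    using inverse_image_closed[of "g \<cdot> f" p] f g fg p by simp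
  have g': "inverse_image C g p \<in> carrier (Sub C (Cod C f))" using g fg p by simp
  then show "inverse_image C f (inverse_image C g p) \<in> carrier (Sub C (Dom C f))"
    using f by simp
  fix a assume a: "a \<in> Arr C" "Cod C a = Dom C f"
  show "below C a (inverse_image C (g \<cdot> f) p) \<longleftrightarrow>
      below C a (inverse_image C f (inverse_image C g p))"
    using below_inverse_image[of "g \<cdot> f" p a] below_inverse_image[OF f g' a]
      below_inverse_image[of g p "f \<cdot> a"] f g fg p a by simp
qed

lemma inverse_image_Id:
  assumes X: "X \<in> Obj C" and p: "p \<in> carrier (Sub C X)"
  shows "inverse_image C (Id C X) p = p"
  using inverse_image_closed[of "Id C X" p] below_inverse_image[of "Id C X" p] X p
  by (intro Sub_eqI[of _ X]) simp_all

lemma direct_image_adjoint: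
  assumes f: "f \<in> Arr C" and p: "p \<in> carrier (Sub C (Dom C f))"
    and q: "q \<in> carrier (Sub C (Cod C f))"
  shows "direct_image C f p \<sqsubseteq>\<^bsub>Sub C (Cod C f)\<^esub> q \<longleftrightarrow>
    p \<sqsubseteq>\<^bsub>Sub C (Dom C f)\<^esub> inverse_image C f q"
proof -
  obtain n where n: "n \<in> MM C" "Cod C n = Dom C f" "p = subobj C n" using p by (rule SubE)
  show ?thesis
    using direct_image_le[OF f n(1,2) q] Sub_le_iff_subobj[OF n(1) inverse_image_closed[OF f q]]
      below_inverse_image[OF f q _ n(2)] n by simp
qed

subsection \<open>The lattices of subobjects\<close>

lemma Sub_refl: "p \<in> carrier (Sub C X) \<Longrightarrow> p \<sqsubseteq>\<^bsub>Sub C X\<^esub> p"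
  by (simp add: Sub_le_iff)

lemma Sub_trans:
  "\<lbrakk>p \<sqsubseteq>\<^bsub>Sub C X\<^esub> q; q \<sqsubseteq>\<^bsub>Sub C X\<^esub> r; p \<in> carrier (Sub C X); q \<in> carrier (Sub C X);
    r \<in> carrier (Sub C X)\<rbrakk> \<Longrightarrow> p \<sqsubseteq>\<^bsub>Sub C X\<^esub> r"
  by (simp add: Sub_le_iff)

lemma Sub_antisym:
  "\<lbrakk>p \<sqsubseteq>\<^bsub>Sub C X\<^esub> q; q \<sqsubseteq>\<^bsub>Sub C X\<^esub> p; p \<in> carrier (Sub C X); q \<in> carrier (Sub C X)\<rbrakk>
    \<Longrightarrow> p = q"
  by (rule Sub_eqI) (auto simp: Sub_le_iff)

lemma Sub_meet:
  assumes X: "X \<in> Obj C" and p: "p \<in> carrier (Sub C X)" and q: "q \<in> carrier (Sub C X)"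
  shows "p \<sqinter>\<^bsub>Sub C X\<^esub> q \<in> carrier (Sub C X)"
    and "\<lbrakk>a \<in> Arr C; Cod C a = X\<rbrakk> \<Longrightarrow>
      below C a (p \<sqinter>\<^bsub>Sub C X\<^esub> q) \<longleftrightarrow> below C a p \<and> below C a q"
proof -
  interpret complete_lattice "Sub C X" using X by (rule Sub_complete)
  show cl: "p \<sqinter>\<^bsub>Sub C X\<^esub> q \<in> carrier (Sub C X)" using p q by simp
  assume a: "a \<in> Arr C" "Cod C a = X"
  obtain e m where em: "e \<in> EE C" "m \<in> MM C" "Cod C e = Dom C m" "m \<cdot> e = a" "Cod C m = Cod C a"
    using a(1) by (rule factorizationE)
  have *: "below C a r \<longleftrightarrow> subobj C m \<sqsubseteq>\<^bsub>Sub C X\<^esub> r" if "r \<in> carrier (Sub C X)" for r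
    using below_Comp_EE[OF em(1) _ em(3), of r] Sub_le_iff_subobj[OF em(2) that] em a that by simp
  have m: "subobj C m \<in> carrier (Sub C X)" using subobj_closed[OF em(2)] em a by simp
  show "below C a (p \<sqinter>\<^bsub>Sub C X\<^esub> q) \<longleftrightarrow> below C a p \<and> below C a q"
    unfolding *[OF p] *[OF q] *[OF cl]
  proof
    assume le: "subobj C m \<sqsubseteq>\<^bsub>Sub C X\<^esub> p \<sqinter>\<^bsub>Sub C X\<^esub> q"
    show "subobj C m \<sqsubseteq>\<^bsub>Sub C X\<^esub> p \<and> subobj C m \<sqsubseteq>\<^bsub>Sub C X\<^esub> q"
      using Sub_trans[OF le meet_left[OF p q] m cl p] Sub_trans[OF le meet_right[OF p q] m cl q]
      by simp
  next
    assume "subobj C m \<sqsubseteq>\<^bsub>Sub C X\<^esub> p \<and> subobj C m \<sqsubseteq>\<^bsub>Sub C X\<^esub> q"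
    then show "subobj C m \<sqsubseteq>\<^bsub>Sub C X\<^esub> p \<sqinter>\<^bsub>Sub C X\<^esub> q"
      using m p q by (intro meet_le) simp_all
  qed
qed

lemma inverse_image_meet:
  assumes f: "f \<in> Arr C" and p: "p \<in> carrier (Sub C (Cod C f))"
    and q: "q \<in> carrier (Sub C (Cod C f))"
  shows "inverse_image C f (p \<sqinter>\<^bsub>Sub C (Cod C f)\<^esub> q) =
    inverse_image C f p \<sqinter>\<^bsub>Sub C (Dom C f)\<^esub> inverse_image C f q"
proof (rule Sub_eqI[of _ "Dom C f"])
  note pq = Sub_meet(1)[OF Cod_Obj[OF f] p q]
  note fpq = inverse_image_closed[OF f p] inverse_image_closed[OF f q]
  show "inverse_image C f (p \<sqinter>\<^bsub>Sub C (Cod C f)\<^esub> q) \<in> carrier (Sub C (Dom C f))"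
    using f pq by (rule inverse_image_closed)
  show "inverse_image C f p \<sqinter>\<^bsub>Sub C (Dom C f)\<^esub> inverse_image C f q \<in> carrier (Sub C (Dom C f))"
    by (rule Sub_meet(1)[OF Dom_Obj[OF f] fpq])
  fix a assume a: "a \<in> Arr C" "Cod C a = Dom C f"
  show "below C a (inverse_image C f (p \<sqinter>\<^bsub>Sub C (Cod C f)\<^esub> q)) \<longleftrightarrow>
      below C a (inverse_image C f p \<sqinter>\<^bsub>Sub C (Dom C f)\<^esub> inverse_image C f q)"
    using Sub_meet(2)[OF Dom_Obj[OF f] fpq a] Sub_meet(2)[OF Cod_Obj[OF f] p q, of "f \<cdot> a"]
      below_inverse_image[OF f pq a] below_inverse_image[OF f p a] below_inverse_image[OF f q a]
      a f by simp
qed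

lemma Sub_top:
  assumes X: "X \<in> Obj C"
  shows "\<top>\<^bsub>Sub C X\<^esub> \<in> carrier (Sub C X)"
    and "p \<in> carrier (Sub C X) \<Longrightarrow> p \<sqsubseteq>\<^bsub>Sub C X\<^esub> \<top>\<^bsub>Sub C X\<^esub>"
proof -
  interpret complete_lattice "Sub C X" using X by (rule Sub_complete)
  show "\<top>\<^bsub>Sub C X\<^esub> \<in> carrier (Sub C X)"
    "p \<in> carrier (Sub C X) \<Longrightarrow> p \<sqsubseteq>\<^bsub>Sub C X\<^esub> \<top>\<^bsub>Sub C X\<^esub>"
    by (simp_all add: top_higher)
qed

lemma inverse_image_top:
  assumes f: "f \<in> Arr C"
  shows "inverse_image C f \<top>\<^bsub>Sub C (Cod C f)\<^esub> = \<top>\<^bsub>Sub C (Dom C f)\<^esub>"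
proof (rule Sub_antisym[where X = "Dom C f"])
  note t = Sub_top[OF Dom_Obj[OF f]] Sub_top[OF Cod_Obj[OF f]]
  show "inverse_image C f \<top>\<^bsub>Sub C (Cod C f)\<^esub> \<sqsubseteq>\<^bsub>Sub C (Dom C f)\<^esub> \<top>\<^bsub>Sub C (Dom C f)\<^esub>"
    using t f by simp
  show "\<top>\<^bsub>Sub C (Dom C f)\<^esub> \<sqsubseteq>\<^bsub>Sub C (Dom C f)\<^esub> inverse_image C f \<top>\<^bsub>Sub C (Cod C f)\<^esub>"
    using direct_image_adjoint[OF f t(1) t(3)] t(4)[OF direct_image_closed[OF f t(1)]] by simp
qed (use f Sub_top Dom_Obj Cod_Obj inverse_image_closed in blast)+

text \<open>
  The union defining \<open>sigma\<close> ranges over all initial objects; these are isomorphic over \<open>X\<close>, so each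
  of them contributes the same class.
\<close>

lemma sigma_subobj:
  assumes I: "is_initial C I" and i: "i \<in> Hom C I X"
    and em: "e \<in> EE C" "m \<in> MM C" "Cod C e = Dom C m" "m \<cdot> e = i"
  shows "sigma C X = subobj C m"
proof -
  have iA: "i \<in> Arr C" "Dom C i = I" "Cod C i = X" using i by (simp_all add: Hom_def)
  have m: "Cod C m = X" "Dom C e = I"
    using em iA by (metis Cod_Comp EE_Arr MM_Arr, metis Dom_Comp EE_Arr MM_Arr)
  have "M_part C i' = subobj C m" if I': "is_initial C I'" and i': "i' \<in> Hom C I' X" for I' i'
  proof -
    have "I' \<in> Obj C" "I \<in> Obj C" using I I' by (simp_all add: is_initial_def)
    then obtain u where u: "u \<in> Hom C I I'" using I unfolding is_initial_def by blast
    obtain v where v: "v \<in> Hom C I' I" using I' \<open>I \<in> Obj C\<close> unfolding is_initial_def by blast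
    have uv: "u \<cdot> v \<in> Hom C I' I'" "v \<cdot> u \<in> Hom C I I" "Id C I' \<in> Hom C I' I'" "Id C I \<in> Hom C I I"
      "i \<cdot> v \<in> Hom C I' X"
      using u v i Comp_Hom Id_Hom \<open>I' \<in> Obj C\<close> \<open>I \<in> Obj C\<close> by blast+
    have eqs: "u \<cdot> v = Id C I'" "v \<cdot> u = Id C I"
      using I I' uv \<open>I' \<in> Obj C\<close> \<open>I \<in> Obj C\<close> unfolding is_initial_def by blast+
    have "X \<in> Obj C" using iA Cod_Obj by metis
    then have "i' = i \<cdot> v" using I' i' uv unfolding is_initial_def by blast
    have uvA: "u \<in> Arr C" "v \<in> Arr C" "Dom C u = I" "Cod C u = I'" "Dom C v = I'" "Cod C v = I"
      using u v by (simp_all add: Hom_def)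
    then have "v \<in> EE C" using eqs by (intro iso_EE is_isoI[of v u]) simp_all
    then have "e \<cdot> v \<in> EE C" using em m uvA by (intro EE_Comp) simp_all
    moreover have "m \<cdot> (e \<cdot> v) = i'"
      using Comp_left_eq[OF em(4), of v] em m uvA \<open>i' = i \<cdot> v\<close> by simp
    ultimately show ?thesis using M_part_Comp[of "e \<cdot> v" m] em m uvA by simp
  qed
  then show ?thesis using I i unfolding sigma_def by blast
qed

lemma sigma_bottom:
  assumes X: "X \<in> Obj C"
  shows "sigma C X \<in> carrier (Sub C X)"
    and "p \<in> carrier (Sub C X) \<Longrightarrow> sigma C X \<sqsubseteq>\<^bsub>Sub C X\<^esub> p"
proof -
  obtain I where I: "is_initial C I" "I \<in> Obj C"
    using finite_coproducts by (auto simp: has_finite_coproducts_def is_initial_def)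
  then obtain i where i: "i \<in> Hom C I X" using X unfolding is_initial_def by blast
  then have iA: "i \<in> Arr C" "Dom C i = I" "Cod C i = X" by (simp_all add: Hom_def)
  obtain e m where em: "e \<in> EE C" "m \<in> MM C" "Cod C e = Dom C m" "m \<cdot> e = i" "Cod C m = Cod C i"
    using iA(1) by (rule factorizationE)
  note eq = sigma_subobj[OF I(1) i em(1-4)]
  show "sigma C X \<in> carrier (Sub C X)" using eq subobj_closed[OF em(2)] em(5) iA by simp
  show "sigma C X \<sqsubseteq>\<^bsub>Sub C X\<^esub> p" if p: "p \<in> carrier (Sub C X)"
  proof -
    obtain n where n: "n \<in> MM C" "Cod C n = X" "p = subobj C n" using p by (rule SubE)
    have "Dom C n \<in> Obj C" using n by simp
    then obtain j where j: "j \<in> Hom C I (Dom C n)" using I unfolding is_initial_def by blast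
    then have "n \<cdot> j \<in> Hom C I X" using n Comp_Hom[of j I "Dom C n" n X] by (simp add: Hom_def)
    then have "n \<cdot> j = i" using i I X unfolding is_initial_def by blast
    then have "below C i p" using factors_throughI[of j n] j n by (simp add: below_subobj Hom_def)
    then show ?thesis
      using below_Comp_EE[OF em(1) _ em(3), of p] em iA p eq by (simp add: Sub_le_iff_subobj)
  qed
qed

lemma below_sigma_Comp:
  assumes f: "f \<in> Arr C" and a: "a \<in> Arr C" "Cod C a = Dom C f" "below C a (sigma C (Dom C f))"
  shows "below C (f \<cdot> a) (sigma C (Cod C f))"
proof -
  note s = sigma_bottom[OF Dom_Obj[OF f]] sigma_bottom(1)[OF Cod_Obj[OF f]]
  note fs = inverse_image_closed[OF f s(3)]
  have "below C a (inverse_image C f (sigma C (Cod C f)))"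
    using s(2)[OF fs] a unfolding Sub_le_iff[OF s(1) fs] by blast
  then show ?thesis using below_inverse_image[OF f s(3) a(1,2)] by simp
qed

subsection \<open>Direct images along composites and along morphisms in E\<close>

text \<open>
  Both sides are left adjoint to the same map of inverse images.
\<close>

lemma direct_image_Comp:
  assumes f: "f \<in> Arr C" and g: "g \<in> Arr C" and fg: "Cod C f = Dom C g"
    and p: "p \<in> carrier (Sub C (Dom C f))"
  shows "direct_image C (g \<cdot> f) p = direct_image C g (direct_image C f p)"
proof -
  have fp: "direct_image C f p \<in> carrier (Sub C (Dom C g))"
    using direct_image_closed[OF f p] fg by simp
  have gf: "g \<cdot> f \<in> Arr C" "Dom C (g \<cdot> f) = Dom C f" "Cod C (g \<cdot> f) = Cod C g"
    using f g fg by simp_all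
  have c: "direct_image C (g \<cdot> f) p \<in> carrier (Sub C (Cod C g))"
    "direct_image C g (direct_image C f p) \<in> carrier (Sub C (Cod C g))"
    using direct_image_closed[OF gf(1)] p gf direct_image_closed[OF g fp] by simp_all
  have iff: "direct_image C (g \<cdot> f) p \<sqsubseteq>\<^bsub>Sub C (Cod C g)\<^esub> q \<longleftrightarrow>
      direct_image C g (direct_image C f p) \<sqsubseteq>\<^bsub>Sub C (Cod C g)\<^esub> q"
    if q: "q \<in> carrier (Sub C (Cod C g))" for q
  proof -
    have gq: "inverse_image C g q \<in> carrier (Sub C (Cod C f))"
      using inverse_image_closed[OF g q] fg by simp
    show ?thesis
      using direct_image_adjoint[OF gf(1), of p q] direct_image_adjoint[OF g fp q]
        direct_image_adjoint[OF f p gq] inverse_image_Comp[OF f g fg q] p q gf fg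
      by simp
  qed
  show ?thesis
    using iff[OF c(1)] iff[OF c(2)] c Sub_refl by (intro Sub_antisym[where X = "Cod C g"]) simp_all
qed

lemma direct_inverse_image:
  assumes P: "is_pullback C f n m k" and n: "n \<in> MM C" and k: "k \<in> EE C"
  shows "direct_image C f (inverse_image C f (subobj C n)) = subobj C n"
  using direct_image_subobj[of m f k n] pullbackD[OF P] pullback_MM[OF P n] n k
    inverse_image_subobj[OF P n] by simp

section \<open>Preneighbourhood systems\<close>

lemma is_pnsD:
  assumes "is_pns C X \<mu>"
  shows "X \<in> Obj C"
    and "\<lbrakk>m \<in> carrier (Sub C X); p \<in> \<mu> m\<rbrakk> \<Longrightarrow> p \<in> carrier (Sub C X)"
    and "\<lbrakk>m \<in> carrier (Sub C X); p \<in> \<mu> m; q \<in> carrier (Sub C X); p \<sqsubseteq>\<^bsub>Sub C X\<^esub> q\<rbrakk> \<Longrightarrow> q \<in> \<mu> m"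
    and "m \<in> carrier (Sub C X) \<Longrightarrow> \<top>\<^bsub>Sub C X\<^esub> \<in> \<mu> m"
    and "\<lbrakk>m \<in> carrier (Sub C X); p \<in> \<mu> m; q \<in> \<mu> m\<rbrakk> \<Longrightarrow> p \<sqinter>\<^bsub>Sub C X\<^esub> q \<in> \<mu> m"
    and "\<lbrakk>m \<in> carrier (Sub C X); n \<in> carrier (Sub C X); m \<sqsubseteq>\<^bsub>Sub C X\<^esub> n; p \<in> \<mu> n\<rbrakk> \<Longrightarrow> p \<in> \<mu> m"
    and "\<mu> (sigma C X) = carrier (Sub C X)"
    and "\<lbrakk>m \<in> carrier (Sub C X); p \<in> \<mu> m\<rbrakk> \<Longrightarrow> m \<sqsubseteq>\<^bsub>Sub C X\<^esub> p"
proof -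
  have filter: "is_filter C X (\<mu> m)" if "m \<in> carrier (Sub C X)" for m
    using assms that by (simp add: is_pns_def)
  show "X \<in> Obj C" "\<mu> (sigma C X) = carrier (Sub C X)"
    using assms by (simp_all add: is_pns_def)
  show "\<lbrakk>m \<in> carrier (Sub C X); p \<in> \<mu> m\<rbrakk> \<Longrightarrow> p \<in> carrier (Sub C X)"
    using filter[of m] unfolding is_filter_def by blast
  show "\<lbrakk>m \<in> carrier (Sub C X); p \<in> \<mu> m; q \<in> carrier (Sub C X); p \<sqsubseteq>\<^bsub>Sub C X\<^esub> q\<rbrakk> \<Longrightarrow> q \<in> \<mu> m"
    using filter[of m] unfolding is_filter_def by blast
  show "m \<in> carrier (Sub C X) \<Longrightarrow> \<top>\<^bsub>Sub C X\<^esub> \<in> \<mu> m"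
    using filter[of m] by (simp add: is_filter_def)
  show "\<lbrakk>m \<in> carrier (Sub C X); p \<in> \<mu> m; q \<in> \<mu> m\<rbrakk> \<Longrightarrow> p \<sqinter>\<^bsub>Sub C X\<^esub> q \<in> \<mu> m"
    using filter[of m] by (simp add: is_filter_def)
  show "\<lbrakk>m \<in> carrier (Sub C X); n \<in> carrier (Sub C X); m \<sqsubseteq>\<^bsub>Sub C X\<^esub> n; p \<in> \<mu> n\<rbrakk> \<Longrightarrow> p \<in> \<mu> m"
    using assms by (auto simp: is_pns_def)
  show "\<lbrakk>m \<in> carrier (Sub C X); p \<in> \<mu> m\<rbrakk> \<Longrightarrow> m \<sqsubseteq>\<^bsub>Sub C X\<^esub> p"
    using assms by (simp add: is_pns_def)
qed

text \<open>
  The supremum in the closure is at least \<open>p\<close>, because \<open>p\<close> is one of its members unless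
  \<open>p\<close> is the least subobject.  So \<open>p\<close> is closed iff each subobject is comparable with \<open>p\<close> or far
  from it: a strictly larger subobject is no obstacle.
\<close>

lemma closed_subs_iff:
  assumes \<mu>: "is_pns C X \<mu>"
  shows "p \<in> closed_subs C X \<mu> \<longleftrightarrow> p \<in> carrier (Sub C X) \<and>
    (\<forall>x \<in> carrier (Sub C X). x \<sqsubseteq>\<^bsub>Sub C X\<^esub> p \<or> p \<sqsubseteq>\<^bsub>Sub C X\<^esub> x \<or>
      (\<exists>u \<in> \<mu> x. u \<sqinter>\<^bsub>Sub C X\<^esub> p = sigma C X))"
proof (cases "p \<in> carrier (Sub C X)")
  case p: True
  note X = is_pnsD(1)[OF \<mu>]
  interpret complete_lattice "Sub C X" using X by (rule Sub_complete)
  let ?L = "Sub C X"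
  let ?A = "{x \<in> carrier ?L. \<not> p \<sqsubset>\<^bsub>?L\<^esub> x \<and> x \<notin> Far C X \<mu> p}"
  have A: "?A \<subseteq> carrier ?L" by auto
  have eqv: "x .=\<^bsub>?L\<^esub> y \<longleftrightarrow> x = y" for x y by (simp add: Sub_def)
  have far: "x \<in> Far C X \<mu> p \<longleftrightarrow> (\<exists>u \<in> \<mu> x. u \<sqinter>\<^bsub>?L\<^esub> p = sigma C X)" if "x \<in> carrier ?L" for x
    using that by (simp add: Far_def)
  have le_iff: "\<Squnion>\<^bsub>?L\<^esub> ?A \<sqsubseteq>\<^bsub>?L\<^esub> p \<longleftrightarrow> (\<forall>x \<in> ?A. x \<sqsubseteq>\<^bsub>?L\<^esub> p)"
    using sup_upper[OF A] sup_least[OF A p] sup_closed[OF A] p Sub_trans A by blast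
  have ge: "p \<sqsubseteq>\<^bsub>?L\<^esub> \<Squnion>\<^bsub>?L\<^esub> ?A"
  proof (cases "p = sigma C X")
    case True
    then show ?thesis using sigma_bottom(2)[OF X sup_closed[OF A]] by simp
  next
    case False
    have "p \<notin> Far C X \<mu> p"
    proof
      assume "p \<in> Far C X \<mu> p"
      then obtain u where u: "u \<in> \<mu> p" "u \<sqinter>\<^bsub>?L\<^esub> p = sigma C X" using far[OF p] by blast
      note uc = is_pnsD(2,8)[OF \<mu> p u(1)]
      have "p \<sqsubseteq>\<^bsub>?L\<^esub> u \<sqinter>\<^bsub>?L\<^esub> p" using meet_le[OF uc(2) Sub_refl[OF p]] uc p by simp
      then show False
        using False u(2) Sub_antisym[of X p "sigma C X"] sigma_bottom[OF X] p by simp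
    qed
    then have "p \<in> ?A" using p by (simp add: lless_def eqv)
    then show ?thesis by (rule sup_upper[OF A])
  qed
  have "p \<in> closed_subs C X \<mu> \<longleftrightarrow> \<Squnion>\<^bsub>?L\<^esub> ?A \<sqsubseteq>\<^bsub>?L\<^esub> p"
    using ge Sub_antisym[OF _ ge sup_closed[OF A] p] Sub_refl[OF p] p
    by (auto simp: closed_subs_def cl_def)
  also have "\<dots> \<longleftrightarrow> (\<forall>x \<in> carrier ?L. x \<sqsubseteq>\<^bsub>?L\<^esub> p \<or> p \<sqsubseteq>\<^bsub>?L\<^esub> x \<or>
      (\<exists>u \<in> \<mu> x. u \<sqinter>\<^bsub>?L\<^esub> p = sigma C X))"
    unfolding le_iff using far p Sub_refl by (auto simp: lless_def eqv)
  finally show ?thesis using p by simp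
qed (simp add: closed_subs_def)

lemma top_closed:
  assumes \<mu>: "is_pns C X \<mu>"
  shows "\<top>\<^bsub>Sub C X\<^esub> \<in> closed_subs C X \<mu>"
  using Sub_top[OF is_pnsD(1)[OF \<mu>]] by (simp add: closed_subs_iff[OF \<mu>])

end

section \<open>The category of preneighbourhood spaces\<close>

text \<open>
  An arrow carries its source and target systems, since one underlying morphism can be a
  preneighbourhood morphism for many pairs of systems.
\<close>

definition PNS :: "('o, 'a) fact_category \<Rightarrow>
    ('o \<times> ('a set \<Rightarrow> 'a set set), ('a set \<Rightarrow> 'a set set) \<times> 'a \<times> ('a set \<Rightarrow> 'a set set)) category" where
  "PNS C = \<lparr>Obj = {(X, \<mu>). is_pns C X \<mu>}, Arr = {(\<mu>, f, \<phi>). pn_morphism C \<mu> \<phi> f},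
     Dom = (\<lambda>(\<mu>, f, \<phi>). (Dom C f, \<mu>)), Cod = (\<lambda>(\<mu>, f, \<phi>). (Cod C f, \<phi>)),
     Id = (\<lambda>(X, \<mu>). (\<mu>, Id C X, \<mu>)),
     Comp = (\<lambda>(_, g, \<psi>) (\<mu>, f, _). (\<mu>, g \<cdot>\<^bsub>C\<^esub> f, \<psi>))\<rparr>"

lemma PNS_simps [simp]:
  "(X, \<mu>) \<in> Obj (PNS C) \<longleftrightarrow> is_pns C X \<mu>"
  "(\<mu>, f, \<phi>) \<in> Arr (PNS C) \<longleftrightarrow> pn_morphism C \<mu> \<phi> f"
  "Dom (PNS C) (\<mu>, f, \<phi>) = (Dom C f, \<mu>)"
  "Cod (PNS C) (\<mu>, f, \<phi>) = (Cod C f, \<phi>)"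
  "category.Id (PNS C) (X, \<mu>) = (\<mu>, category.Id C X, \<mu>)"
  "(\<phi>', g, \<psi>) \<cdot>\<^bsub>PNS C\<^esub> (\<mu>, f, \<phi>) = (\<mu>, g \<cdot>\<^bsub>C\<^esub> f, \<psi>)"
  by (simp_all add: PNS_def)

abbreviation closed_arrows :: "('o, 'a) fact_category \<Rightarrow>
    (('a set \<Rightarrow> 'a set set) \<times> 'a \<times> ('a set \<Rightarrow> 'a set set)) set" where
  "closed_arrows C \<equiv> {(\<rho>, q, \<omega>). closed_morphism C \<rho> \<omega> q}"

text \<open>
  The finest preneighbourhood system on \<open>X\<close>.  Every morphism out of a discrete space is a
  preneighbourhood morphism; for this reason pullbacks of spaces are pullbacks of the underlying objects.
\<close>

definition discrete :: "('o, 'a) fact_category \<Rightarrow> 'o \<Rightarrow> 'a set \<Rightarrow> 'a set set" where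
  "discrete C X m = {p \<in> carrier (Sub C X). m \<sqsubseteq>\<^bsub>Sub C X\<^esub> p}"

context nbd_context
begin

lemma pn_morphismD:
  assumes "pn_morphism C \<mu> \<phi> f"
  shows "f \<in> Arr C" "is_pns C (Dom C f) \<mu>" "is_pns C (Cod C f) \<phi>"
    "\<lbrakk>u \<in> carrier (Sub C (Cod C f)); p \<in> \<phi> u\<rbrakk> \<Longrightarrow> inverse_image C f p \<in> \<mu> (inverse_image C f u)"
  using assms by (simp_all add: pn_morphism_def)

lemma pn_morphism_Comp:
  assumes f: "pn_morphism C \<mu> \<phi> f" and g: "pn_morphism C \<phi> \<psi> g" and fg: "Cod C f = Dom C g"
  shows "pn_morphism C \<mu> \<psi> (g \<cdot> f)"
  unfolding pn_morphism_def
proof (intro conjI ballI)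
  note F = pn_morphismD[OF f] and G = pn_morphismD[OF g]
  show gf: "g \<cdot> f \<in> Arr C" using F(1) G(1) fg by simp
  show "is_pns C (Dom C (g \<cdot> f)) \<mu>" "is_pns C (Cod C (g \<cdot> f)) \<psi>"
    using F(1,2) G(1,3) fg by simp_all
  fix u p assume u: "u \<in> carrier (Sub C (Cod C (g \<cdot> f)))" and p: "p \<in> \<psi> u"
  have u': "u \<in> carrier (Sub C (Cod C g))" using u F(1) G(1) fg by simp
  have p': "p \<in> carrier (Sub C (Cod C g))" using is_pnsD(2)[OF G(3) u' p] .
  have "inverse_image C f (inverse_image C g p) \<in> \<mu> (inverse_image C f (inverse_image C g u))"
    using F(4)[OF _ G(4)[OF u' p]] inverse_image_closed[OF G(1) u'] fg by simp
  then show "inverse_image C (g \<cdot> f) p \<in> \<mu> (inverse_image C (g \<cdot> f) u)"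
    using inverse_image_Comp[OF F(1) G(1) fg] u' p' by simp
qed

lemma pn_morphism_Id:
  assumes \<mu>: "is_pns C X \<mu>"
  shows "pn_morphism C \<mu> \<mu> (Id C X)"
  using is_pnsD(1)[OF \<mu>] is_pnsD(2)[OF \<mu>] \<mu>
  by (simp add: pn_morphism_def inverse_image_Id)

lemma PNS_category: "category (PNS C)"
proof
  fix F assume F: "F \<in> Arr (PNS C)"
  then obtain \<mu> f \<phi> where F': "F = (\<mu>, f, \<phi>)" "pn_morphism C \<mu> \<phi> f" by (cases F) simp
  note fD = pn_morphismD[OF F'(2)]
  show "Dom (PNS C) F \<in> Obj (PNS C)" "Cod (PNS C) F \<in> Obj (PNS C)"
    "F \<cdot>\<^bsub>PNS C\<^esub> category.Id (PNS C) (Dom (PNS C) F) = F"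
    "category.Id (PNS C) (Cod (PNS C) F) \<cdot>\<^bsub>PNS C\<^esub> F = F"
    using fD by (simp_all add: F'(1))
next
  fix X assume X: "X \<in> Obj (PNS C)"
  then obtain Y \<mu> where "X = (Y, \<mu>)" "is_pns C Y \<mu>" by (cases X) simp
  then show "category.Id (PNS C) X \<in> Hom (PNS C) X X"
    using pn_morphism_Id[of Y \<mu>] is_pnsD(1)[of Y \<mu>] by (simp add: Hom_def)
next
  fix X Y Z F G assume FG: "F \<in> Hom (PNS C) X Y" "G \<in> Hom (PNS C) Y Z"
  obtain \<mu> f \<phi> where F: "F = (\<mu>, f, \<phi>)" by (cases F)
  obtain \<phi>' g \<psi> where G: "G = (\<phi>', g, \<psi>)" by (cases G)
  have "pn_morphism C \<mu> \<phi> f" "pn_morphism C \<phi> \<psi> g" "Cod C f = Dom C g"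
    "X = (Dom C f, \<mu>)" "Z = (Cod C g, \<psi>)"
    using FG by (auto simp: Hom_def F G)
  then show "G \<cdot>\<^bsub>PNS C\<^esub> F \<in> Hom (PNS C) X Z"
    using pn_morphism_Comp pn_morphismD(1) by (simp add: Hom_def F G)
next
  fix W X Y Z F G H
  assume FGH: "F \<in> Hom (PNS C) W X" "G \<in> Hom (PNS C) X Y" "H \<in> Hom (PNS C) Y Z"
  obtain \<mu> f \<phi> where F: "F = (\<mu>, f, \<phi>)" by (cases F)
  obtain \<phi>' g \<psi> where G: "G = (\<phi>', g, \<psi>)" by (cases G)
  obtain \<psi>' h \<chi> where H: "H = (\<psi>', h, \<chi>)" by (cases H)
  have "f \<in> Arr C" "g \<in> Arr C" "h \<in> Arr C" "Cod C f = Dom C g" "Cod C g = Dom C h"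
    using FGH pn_morphismD(1) by (auto simp: Hom_def F G H)
  then show "H \<cdot>\<^bsub>PNS C\<^esub> (G \<cdot>\<^bsub>PNS C\<^esub> F) = (H \<cdot>\<^bsub>PNS C\<^esub> G) \<cdot>\<^bsub>PNS C\<^esub> F"
    by (simp add: F G H)
qed

lemma discrete_pns:
  assumes X: "X \<in> Obj C"
  shows "is_pns C X (discrete C X)"
  unfolding is_pns_def is_filter_def
proof (intro conjI ballI impI subsetI)
  note t = Sub_top[OF X] and s = sigma_bottom[OF X]
  show "discrete C X (sigma C X) = carrier (Sub C X)" using s by (auto simp: discrete_def)
  show "\<top>\<^bsub>Sub C X\<^esub> \<in> discrete C X m" if "m \<in> carrier (Sub C X)" for m
    using that t by (simp add: discrete_def)
  show "p \<sqinter>\<^bsub>Sub C X\<^esub> q \<in> discrete C X m"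
    if m: "m \<in> carrier (Sub C X)" "p \<in> discrete C X m" "q \<in> discrete C X m" for m p q
  proof -
    have pq: "p \<in> carrier (Sub C X)" "q \<in> carrier (Sub C X)" "m \<sqsubseteq>\<^bsub>Sub C X\<^esub> p" "m \<sqsubseteq>\<^bsub>Sub C X\<^esub> q"
      using m by (simp_all add: discrete_def)
    interpret complete_lattice "Sub C X" using X by (rule Sub_complete)
    show ?thesis using pq m meet_le[OF pq(3,4)] by (simp add: discrete_def)
  qed
  show "p \<in> discrete C X m"
    if "m \<in> carrier (Sub C X)" "n \<in> carrier (Sub C X)" "m \<sqsubseteq>\<^bsub>Sub C X\<^esub> n" "p \<in> discrete C X n" for m n p
    using that Sub_trans[OF that(3)] by (auto simp: discrete_def)
  show "q \<in> discrete C X m"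
    if "m \<in> carrier (Sub C X)" "p \<in> discrete C X m" "q \<in> carrier (Sub C X)" "p \<sqsubseteq>\<^bsub>Sub C X\<^esub> q" for m p q
    using that Sub_trans[OF _ that(4)] by (auto simp: discrete_def)
qed (use X in \<open>auto simp: discrete_def\<close>)

lemma discrete_pn_morphism:
  assumes f: "f \<in> Arr C" and \<phi>: "is_pns C (Cod C f) \<phi>"
  shows "pn_morphism C (discrete C (Dom C f)) \<phi> f"
  unfolding pn_morphism_def
proof (intro conjI ballI)
  fix u p assume u: "u \<in> carrier (Sub C (Cod C f))" and p: "p \<in> \<phi> u"
  note p' = is_pnsD(2,8)[OF \<phi> u p]
  show "inverse_image C f p \<in> discrete C (Dom C f) (inverse_image C f u)"
    using inverse_image_mono[OF f u p'] inverse_image_closed[OF f p'(1)] by (simp add: discrete_def)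
qed (use f \<phi> discrete_pns in simp_all)

lemma pn_pullback_imp_PNS:
  assumes P: "pn_pullback C \<mu> \<phi> \<omega> f h \<rho> p q"
  shows "is_pullback (PNS C) (\<mu>, f, \<phi>) (\<omega>, h, \<phi>) (\<rho>, p, \<mu>) (\<rho>, q, \<omega>)"
proof -
  interpret PNS: category "PNS C" by (rule PNS_category)
  have pn: "pn_morphism C \<mu> \<phi> f" "pn_morphism C \<omega> \<phi> h" "pn_morphism C \<rho> \<mu> p" "pn_morphism C \<rho> \<omega> q"
    and U: "is_pullback C f h p q"
    and univ: "\<And>\<theta> t. \<lbrakk>t \<in> Hom C (Dom C t) (Dom C p); pn_morphism C \<theta> \<mu> (p \<cdot> t);
      pn_morphism C \<theta> \<omega> (q \<cdot> t)\<rbrakk> \<Longrightarrow> pn_morphism C \<theta> \<rho> t"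
    using P unfolding pn_pullback_def by blast+
  note D = pullbackD[OF U]
  show ?thesis
  proof (rule PNS.pullbackI)
    fix A B
    assume AB: "A \<in> Arr (PNS C)" "B \<in> Arr (PNS C)" "Dom (PNS C) B = Dom (PNS C) A"
      "Cod (PNS C) A = Dom (PNS C) (\<mu>, f, \<phi>)" "Cod (PNS C) B = Dom (PNS C) (\<omega>, h, \<phi>)"
      "(\<mu>, f, \<phi>) \<cdot>\<^bsub>PNS C\<^esub> A = (\<omega>, h, \<phi>) \<cdot>\<^bsub>PNS C\<^esub> B"
    obtain \<theta> a \<mu>' where A: "A = (\<theta>, a, \<mu>')" by (cases A)
    obtain \<theta>' b \<omega>' where B: "B = (\<theta>', b, \<omega>')" by (cases B)
    have ab: "pn_morphism C \<theta> \<mu> a" "pn_morphism C \<theta> \<omega> b" "Dom C b = Dom C a"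
      "Cod C a = Dom C f" "Cod C b = Dom C h" "f \<cdot> a = h \<cdot> b" "\<theta>' = \<theta>" "\<mu>' = \<mu>" "\<omega>' = \<omega>"
      using AB by (simp_all add: A B)
    obtain t where t: "t \<in> Arr C" "Dom C t = Dom C a" "Cod C t = Dom C p" "p \<cdot> t = a" "q \<cdot> t = b"
      by (rule pullbackE[OF U, of a b]) (use ab pn_morphismD(1) in simp_all)
    have "pn_morphism C \<theta> \<rho> t"
      by (rule univ) (use t ab in \<open>simp_all add: Hom_def\<close>)
    then show "\<exists>T. T \<in> Arr (PNS C) \<and> Dom (PNS C) T = Dom (PNS C) A \<and>
        Cod (PNS C) T = Dom (PNS C) (\<rho>, p, \<mu>) \<and> (\<rho>, p, \<mu>) \<cdot>\<^bsub>PNS C\<^esub> T = A \<and> (\<rho>, q, \<omega>) \<cdot>\<^bsub>PNS C\<^esub> T = B"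
      using t ab by (intro exI[of _ "(\<theta>, t, \<rho>)"]) (simp add: A B)
  next
    fix T T'
    assume T: "T \<in> Arr (PNS C)" "T' \<in> Arr (PNS C)" "Dom (PNS C) T = Dom (PNS C) T'"
      "Cod (PNS C) T = Dom (PNS C) (\<rho>, p, \<mu>)" "Cod (PNS C) T' = Dom (PNS C) (\<rho>, p, \<mu>)"
      "(\<rho>, p, \<mu>) \<cdot>\<^bsub>PNS C\<^esub> T = (\<rho>, p, \<mu>) \<cdot>\<^bsub>PNS C\<^esub> T'" "(\<rho>, q, \<omega>) \<cdot>\<^bsub>PNS C\<^esub> T = (\<rho>, q, \<omega>) \<cdot>\<^bsub>PNS C\<^esub> T'"
    obtain \<theta> t \<rho>1 where t: "T = (\<theta>, t, \<rho>1)" by (cases T)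
    obtain \<theta>' t' \<rho>2 where t': "T' = (\<theta>', t', \<rho>2)" by (cases T')
    have "t = t'"
      by (rule pullback_eqI[OF U]) (use T pn_morphismD(1) in \<open>simp_all add: t t'\<close>)
    then show "T = T'" using T by (simp add: t t')
  qed (use pn D in simp_all)
qed

text \<open>
  Maps from discrete test spaces show that the underlying square is a pullback.  Minimality of the
  system \<open>\<rho>\<close> is the universal property applied to the identity, from a competing system to \<open>\<rho>\<close>.
\<close>

lemma PNS_pullback_imp_pn:
  assumes P: "is_pullback (PNS C) (\<mu>, f, \<phi>) (\<omega>, h, \<phi>) (\<rho>, p, \<mu>) (\<rho>, q, \<omega>)"
  shows "pn_pullback C \<mu> \<phi> \<omega> f h \<rho> p q"
proof -
  interpret PNS: category "PNS C" by (rule PNS_category)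
  have pn: "pn_morphism C \<mu> \<phi> f" "pn_morphism C \<omega> \<phi> h" "pn_morphism C \<rho> \<mu> p" "pn_morphism C \<rho> \<omega> q"
    and D: "Cod C h = Cod C f" "Dom C q = Dom C p" "Cod C p = Dom C f" "Cod C q = Dom C h"
      "f \<cdot> p = h \<cdot> q"
    using PNS.pullbackD[OF P] by simp_all
  note arr = pn[THEN pn_morphismD(1)]
  have ex: "\<exists>t. pn_morphism C \<theta> \<rho> t \<and> Dom C t = Dom C a \<and> Cod C t = Dom C p \<and> p \<cdot> t = a \<and> q \<cdot> t = b"
    if ab: "pn_morphism C \<theta> \<mu> a" "pn_morphism C \<theta> \<omega> b" "Dom C b = Dom C a" "Cod C a = Dom C f"
      "Cod C b = Dom C h" "f \<cdot> a = h \<cdot> b" for \<theta> a b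
  proof -
    obtain T where T: "T \<in> Arr (PNS C)" "Dom (PNS C) T = Dom (PNS C) (\<theta>, a, \<mu>)"
      "Cod (PNS C) T = Dom (PNS C) (\<rho>, p, \<mu>)" "(\<rho>, p, \<mu>) \<cdot>\<^bsub>PNS C\<^esub> T = (\<theta>, a, \<mu>)"
      "(\<rho>, q, \<omega>) \<cdot>\<^bsub>PNS C\<^esub> T = (\<theta>, b, \<omega>)"
      by (rule PNS.pullbackE[OF P, of "(\<theta>, a, \<mu>)" "(\<theta>, b, \<omega>)"]) (use ab in simp_all)
    obtain \<theta>' t \<rho>' where t: "T = (\<theta>', t, \<rho>')" by (cases T)
    show ?thesis using T by (intro exI[of _ t]) (simp add: t)
  qed
  have un: "t = t'"
    if t: "t \<in> Arr C" "t' \<in> Arr C" "Dom C t = Dom C t'" "Cod C t = Dom C p" "Cod C t' = Dom C p"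
      "p \<cdot> t = p \<cdot> t'" "q \<cdot> t = q \<cdot> t'" for t t'
  proof -
    \<comment> \<open>Uniqueness of mediating arrows is inherited from maps out of the discrete space on their domain.\<close>
    let ?\<theta> = "discrete C (Dom C t')"
    have "pn_morphism C ?\<theta> \<rho> t" "pn_morphism C ?\<theta> \<rho> t'"
      using discrete_pn_morphism[OF t(1), of \<rho>] discrete_pn_morphism[OF t(2), of \<rho>]
        pn_morphismD(2)[OF pn(3)] t(3-5) by simp_all
    then have "(?\<theta>, t, \<rho>) = (?\<theta>, t', \<rho>)"
      by - (rule PNS.pullback_eqI[OF P], use t in simp_all)
    then show ?thesis by simp
  qed
  have U: "is_pullback C f h p q"
  proof (rule pullbackI)
    fix a b
    assume ab: "a \<in> Arr C" "b \<in> Arr C" "Dom C b = Dom C a" "Cod C a = Dom C f"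
      "Cod C b = Dom C h" "f \<cdot> a = h \<cdot> b"
    have "pn_morphism C (discrete C (Dom C a)) \<mu> a" "pn_morphism C (discrete C (Dom C a)) \<omega> b"
      using discrete_pn_morphism[OF ab(1), of \<mu>] discrete_pn_morphism[OF ab(2), of \<omega>]
        pn_morphismD(2)[OF pn(1)] pn_morphismD(2)[OF pn(2)] ab(3-5) by simp_all
    from ex[OF this ab(3-6)] show "\<exists>t. t \<in> Arr C \<and> Dom C t = Dom C a \<and> Cod C t = Dom C p \<and> p \<cdot> t = a \<and> q \<cdot> t = b"
      using pn_morphismD(1) by blast
  qed (use arr D un in simp_all)
  have univ: "pn_morphism C \<theta> \<rho> t"
    if t: "t \<in> Hom C (Dom C t) (Dom C p)" "pn_morphism C \<theta> \<mu> (p \<cdot> t)" "pn_morphism C \<theta> \<omega> (q \<cdot> t)" for \<theta> t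
  proof -
    have tA: "t \<in> Arr C" "Cod C t = Dom C p" using t(1) by (simp_all add: Hom_def)
    have "f \<cdot> (p \<cdot> t) = h \<cdot> (q \<cdot> t)" by (rule Comp_left_cong) (use D tA arr in simp_all)
    then obtain t' where t': "pn_morphism C \<theta> \<rho> t'" "Dom C t' = Dom C (p \<cdot> t)" "Cod C t' = Dom C p"
      "p \<cdot> t' = p \<cdot> t" "q \<cdot> t' = q \<cdot> t"
      using ex[OF t(2,3)] D tA arr by auto
    have "t' = t" by (rule un) (use t' tA D arr pn_morphismD(1)[OF t'(1)] in simp_all)
    then show ?thesis using t'(1) by simp
  qed
  have least: "\<rho> m \<subseteq> \<rho>' m"
    if \<rho>': "pn_morphism C \<rho>' \<mu> p" "pn_morphism C \<rho>' \<omega> q" and m: "m \<in> carrier (Sub C (Dom C p))" for \<rho>' m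
  proof
    fix u assume u: "u \<in> \<rho> m"
    let ?i = "Id C (Dom C p)"
    have "Dom C p \<in> Obj C" using arr by simp
    moreover have "pn_morphism C \<rho>' \<rho> ?i"
      by (rule univ) (use \<rho>' arr D \<open>Dom C p \<in> Obj C\<close> in \<open>simp_all add: Hom_def\<close>)
    moreover have "u \<in> carrier (Sub C (Dom C p))"
      using is_pnsD(2)[OF pn_morphismD(2)[OF pn(3)] m u] .
    ultimately show "u \<in> \<rho>' m"
      using pn_morphismD(4)[of \<rho>' \<rho> ?i m u] u m by (simp add: inverse_image_Id)
  qed
  show ?thesis
    unfolding pn_pullback_def using pn U univ least by blast
qed

lemma pn_pullback_iff:
  "pn_pullback C \<mu> \<phi> \<omega> f h \<rho> p q \<longleftrightarrow>
    is_pullback (PNS C) (\<mu>, f, \<phi>) (\<omega>, h, \<phi>) (\<rho>, p, \<mu>) (\<rho>, q, \<omega>)"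
  using pn_pullback_imp_PNS PNS_pullback_imp_pn by blast

lemma PNS_pullbackE:
  assumes "is_pullback (PNS C) (\<mu>, f, \<phi>) H P Q"
  obtains \<omega> h \<rho> p q where "H = (\<omega>, h, \<phi>)" "P = (\<rho>, p, \<mu>)" "Q = (\<rho>, q, \<omega>)"
    "pn_pullback C \<mu> \<phi> \<omega> f h \<rho> p q"
proof -
  interpret PNS: category "PNS C" by (rule PNS_category)
  obtain \<omega> h \<phi>' where H: "H = (\<omega>, h, \<phi>')" by (cases H)
  obtain \<rho> p \<mu>' where P: "P = (\<rho>, p, \<mu>')" by (cases P)
  obtain \<rho>' q \<omega>' where Q: "Q = (\<rho>', q, \<omega>')" by (cases Q)
  have "\<phi>' = \<phi>" "\<mu>' = \<mu>" "\<rho>' = \<rho>" "\<omega>' = \<omega>"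
    using PNS.pullbackD(5-8)[OF assms] by (simp_all add: H P Q)
  then show ?thesis using that[of \<omega> h \<rho> p q] assms H P Q by (simp add: pn_pullback_iff)
qed

lemma has_pn_pullbacks_iff:
  assumes f: "pn_morphism C \<mu> \<phi> f"
  shows "has_pn_pullbacks C \<mu> \<phi> f \<longleftrightarrow> pullbacks_exist (PNS C) (\<mu>, f, \<phi>)"
proof
  assume ex: "has_pn_pullbacks C \<mu> \<phi> f"
  show "pullbacks_exist (PNS C) (\<mu>, f, \<phi>)"
    unfolding pullbacks_exist_def
  proof (intro ballI impI)
    fix H assume H: "H \<in> Arr (PNS C)" "Cod (PNS C) H = Cod (PNS C) (\<mu>, f, \<phi>)"
    obtain \<omega> h \<phi>' where h: "H = (\<omega>, h, \<phi>')" by (cases H)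
    then have "pn_morphism C \<omega> \<phi> h" "Cod C h = Cod C f" "\<phi>' = \<phi>" using H by simp_all
    then obtain \<rho> p q where "pn_pullback C \<mu> \<phi> \<omega> f h \<rho> p q"
      using ex unfolding has_pn_pullbacks_def by blast
    then show "\<exists>P Q. is_pullback (PNS C) (\<mu>, f, \<phi>) H P Q"
      using h \<open>\<phi>' = \<phi>\<close> pn_pullback_iff by blast
  qed
next
  assume ex: "pullbacks_exist (PNS C) (\<mu>, f, \<phi>)"
  show "has_pn_pullbacks C \<mu> \<phi> f"
    unfolding has_pn_pullbacks_def
  proof (intro allI impI)
    fix \<omega> h assume "pn_morphism C \<omega> \<phi> h \<and> Cod C h = Cod C f"
    then have "(\<omega>, h, \<phi>) \<in> Arr (PNS C)" "Cod (PNS C) (\<omega>, h, \<phi>) = Cod (PNS C) (\<mu>, f, \<phi>)"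
      by simp_all
    then obtain P Q where "is_pullback (PNS C) (\<mu>, f, \<phi>) (\<omega>, h, \<phi>) P Q"
      using ex unfolding pullbacks_exist_def by blast
    then show "\<exists>\<rho> p q. pn_pullback C \<mu> \<phi> \<omega> f h \<rho> p q"
      by (rule PNS_pullbackE) auto
  qed
qed

lemma stably_iff:
  "stably C \<Phi> \<mu> \<phi> f \<longleftrightarrow> pullback_stable (PNS C) {(\<rho>, q, \<omega>). \<Phi> \<rho> \<omega> q} (\<mu>, f, \<phi>)"
proof -
  have "(\<forall>\<omega> h \<rho> p q. pn_pullback C \<mu> \<phi> \<omega> f h \<rho> p q \<longrightarrow> \<Phi> \<rho> \<omega> q) \<longleftrightarrow>
      (\<forall>H P Q. is_pullback (PNS C) (\<mu>, f, \<phi>) H P Q \<longrightarrow> Q \<in> {(\<rho>, q, \<omega>). \<Phi> \<rho> \<omega> q})"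
  proof (intro iffI allI impI)
    fix H P Q
    assume "\<forall>\<omega> h \<rho> p q. pn_pullback C \<mu> \<phi> \<omega> f h \<rho> p q \<longrightarrow> \<Phi> \<rho> \<omega> q"
      "is_pullback (PNS C) (\<mu>, f, \<phi>) H P Q"
    then show "Q \<in> {(\<rho>, q, \<omega>). \<Phi> \<rho> \<omega> q}" by (elim PNS_pullbackE) blast
  next
    fix \<omega> h \<rho> p q
    assume all: "\<forall>H P Q. is_pullback (PNS C) (\<mu>, f, \<phi>) H P Q \<longrightarrow> Q \<in> {(\<rho>, q, \<omega>). \<Phi> \<rho> \<omega> q}"
      and P: "pn_pullback C \<mu> \<phi> \<omega> f h \<rho> p q"
    show "\<Phi> \<rho> \<omega> q" using all[rule_format, OF pn_pullback_imp_PNS[OF P]] by simp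
  qed
  then show ?thesis
    using has_pn_pullbacks_iff[of \<mu> \<phi> f] by (auto simp: stably_def pullback_stable_def)
qed

lemma is_diagonal_PNSE:
  assumes "is_diagonal (PNS C) (\<mu>, f, \<phi>) P Q D"
  obtains \<kappa> p q d where "P = (\<kappa>, p, \<mu>)" "Q = (\<kappa>, q, \<mu>)" "D = (\<mu>, d, \<kappa>)"
    "pn_pullback C \<mu> \<phi> \<mu> f f \<kappa> p q" "pn_morphism C \<mu> \<kappa> d" "d \<in> Hom C (Dom C f) (Dom C p)"
    "p \<cdot> d = Id C (Dom C f)" "q \<cdot> d = Id C (Dom C f)"
proof -
  interpret PNS: category "PNS C" by (rule PNS_category)
  obtain \<omega> h \<kappa> p q where pq: "(\<mu>, f, \<phi>) = (\<omega>, h, \<phi>)" "P = (\<kappa>, p, \<mu>)" "Q = (\<kappa>, q, \<omega>)"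
    "pn_pullback C \<mu> \<phi> \<omega> f h \<kappa> p q"
    using PNS_pullbackE[OF PNS.diagonalD(1)[OF assms]] .
  obtain \<mu>' d \<kappa>' where D: "D = (\<mu>', d, \<kappa>')" by (cases D)
  have d: "pn_morphism C \<mu> \<kappa> d" "\<mu>' = \<mu>" "\<kappa>' = \<kappa>" "Dom C d = Dom C f" "Cod C d = Dom C p"
    "p \<cdot> d = Id C (Dom C f)" "q \<cdot> d = Id C (Dom C f)"
    using PNS.diagonalD(2-6)[OF assms] pq by (auto simp: D)
  show ?thesis
    by (rule that[of \<kappa> p q d])
      (use pq D d pn_morphismD(1)[OF d(1)] in \<open>simp_all add: Hom_def\<close>)
qed

lemma is_diagonal_PNSI:
  assumes P: "pn_pullback C \<mu> \<phi> \<mu> f f \<kappa> p q" and d: "d \<in> Hom C (Dom C f) (Dom C p)"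
    and pd: "p \<cdot> d = Id C (Dom C f)" and qd: "q \<cdot> d = Id C (Dom C f)"
  shows "is_diagonal (PNS C) (\<mu>, f, \<phi>) (\<kappa>, p, \<mu>) (\<kappa>, q, \<mu>) (\<mu>, d, \<kappa>)"
proof -
  have f: "pn_morphism C \<mu> \<phi> f" using P by (simp add: pn_pullback_def)
  have Id: "pn_morphism C \<mu> \<mu> (Id C (Dom C f))"
    using pn_morphism_Id pn_morphismD(2)[OF f] .
  have dA: "d \<in> Arr C" "Dom C d = Dom C f" "Cod C d = Dom C p" using d by (simp_all add: Hom_def)
  have "pn_morphism C \<mu> \<kappa> d"
    using P d pd qd Id dA unfolding pn_pullback_def by metis
  then show ?thesis
    using pn_pullback_imp_PNS[OF P] dA pd qd by (simp add: is_diagonal_def Hom_def)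
qed

lemma separated_iff:
  "separated C \<mu> \<phi> f \<longleftrightarrow>
    diagonal_stable (PNS C) (closed_arrows C) (\<mu>, f, \<phi>)"
  (is "_ \<longleftrightarrow> diagonal_stable _ ?K _")
proof
  assume f: "separated C \<mu> \<phi> f"
  obtain \<kappa> p q where "pn_pullback C \<mu> \<phi> \<mu> f f \<kappa> p q" using f unfolding separated_def by blast
  then have "\<exists>P Q. is_pullback (PNS C) (\<mu>, f, \<phi>) (\<mu>, f, \<phi>) P Q"
    using pn_pullback_iff by blast
  moreover have "(\<mu>, f, \<phi>) \<in> Arr (PNS C)" using f by (simp add: separated_def)
  moreover have "pullback_stable (PNS C) ?K D" if "is_diagonal (PNS C) (\<mu>, f, \<phi>) P Q D" for P Q D
    using that
  proof (rule is_diagonal_PNSE)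
    fix \<kappa> p q d
    assume "D = (\<mu>, d, \<kappa>)" "pn_pullback C \<mu> \<phi> \<mu> f f \<kappa> p q" "d \<in> Hom C (Dom C f) (Dom C p)"
      "p \<cdot> d = Id C (Dom C f)" "q \<cdot> d = Id C (Dom C f)"
    then show ?thesis
      using f by (simp add: separated_def proper_def flip: stably_iff)
  qed
  ultimately show "diagonal_stable (PNS C) ?K (\<mu>, f, \<phi>)" by (simp add: diagonal_stable_def)
next
  interpret PNS: category "PNS C" by (rule PNS_category)
  assume f: "diagonal_stable (PNS C) ?K (\<mu>, f, \<phi>)"
  obtain P Q where "is_pullback (PNS C) (\<mu>, f, \<phi>) (\<mu>, f, \<phi>) P Q"
    using f unfolding diagonal_stable_def by blast
  then obtain \<kappa> p q where P: "pn_pullback C \<mu> \<phi> \<mu> f f \<kappa> p q"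
    by (rule PNS_pullbackE) auto
  then have "pn_morphism C \<mu> \<phi> f" by (simp add: pn_pullback_def)
  moreover have "proper C \<mu> \<kappa>' d"
    if "pn_pullback C \<mu> \<phi> \<mu> f f \<kappa>' p' q'" "d \<in> Hom C (Dom C f) (Dom C p')"
      "p' \<cdot> d = Id C (Dom C f)" "q' \<cdot> d = Id C (Dom C f)" for \<kappa>' p' q' d
    using PNS.diagonal_stableD(2)[OF f is_diagonal_PNSI[OF that]]
    by (simp add: proper_def stably_iff)
  ultimately show "separated C \<mu> \<phi> f"
    using P unfolding separated_def by blast
qed

lemma closed_morphism_Comp:
  assumes f: "closed_morphism C \<mu> \<phi> f" and g: "closed_morphism C \<phi> \<psi> g" and fg: "Cod C f = Dom C g"
  shows "closed_morphism C \<mu> \<psi> (g \<cdot> f)"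
proof -
  have A: "f \<in> Arr C" "g \<in> Arr C" using f g by (simp_all add: closed_morphism_def)
  have "direct_image C (g \<cdot> f) p \<in> closed_subs C (Cod C g) \<psi>" if p: "p \<in> closed_subs C (Dom C f) \<mu>" for p
  proof -
    have "p \<in> carrier (Sub C (Dom C f))" using p by (simp add: closed_subs_def)
    then show ?thesis
      using direct_image_Comp[OF A fg] p f g fg by (simp add: closed_morphism_def)
  qed
  then show ?thesis using A f g fg by (simp add: closed_morphism_def)
qed

end

section \<open>Embeddings\<close>

text \<open>
  An embedding is an \<open>\<M>\<close>-morphism whose domain carries the restricted system.  The
  converse inclusion holds for every preneighbourhood morphism in \<open>\<M>\<close>.
\<close>

definition pn_embedding :: "('o, 'a) fact_category \<Rightarrow>
    ('a set \<Rightarrow> 'a set set) \<Rightarrow> ('a set \<Rightarrow> 'a set set) \<Rightarrow> 'a \<Rightarrow> bool" where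
  "pn_embedding C \<mu> \<phi> m \<longleftrightarrow> m \<in> MM C \<and> pn_morphism C \<mu> \<phi> m \<and>
     (\<forall>a \<in> carrier (Sub C (Dom C m)). \<mu> a \<subseteq> restrict_pns C \<phi> m a)"

context nbd_context
begin

lemma below_direct_imageE:
  assumes m: "m \<in> MM C" and p: "p \<in> carrier (Sub C (Dom C m))"
    and a: "a \<in> Arr C" "below C a (direct_image C m p)"
  obtains c where "c \<in> Arr C" "Cod C c = Dom C m" "m \<cdot> c = a" "below C c p"
proof -
  obtain n where n: "n \<in> MM C" "Cod C n = Dom C m" "p = subobj C n" using p by (rule SubE)
  have mn: "m \<cdot> n \<in> MM C" using n m by (simp add: MM_Comp)
  have "factors_through C a (m \<cdot> n)"
    using a(2) direct_image_MM[OF m n(1,2)] n(3) below_subobj[OF mn] by simp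
  then obtain k where k: "k \<in> Arr C" "Dom C k = Dom C a" "Cod C k = Dom C (m \<cdot> n)" "(m \<cdot> n) \<cdot> k = a"
    by (rule factors_throughE)
  then have k': "Cod C k = Dom C n" using n m by simp
  show ?thesis
    by (rule that[of "n \<cdot> k"])
      (use k k' n m factors_throughI[of k n] in \<open>simp_all add: below_subobj\<close>)
qed

lemma inverse_direct_image:
  assumes m: "m \<in> MM C" and p: "p \<in> carrier (Sub C (Dom C m))"
  shows "inverse_image C m (direct_image C m p) = p"
proof (rule Sub_eqI[of _ "Dom C m"])
  note mp = direct_image_closed[OF MM_Arr[OF m] p]
  show "inverse_image C m (direct_image C m p) \<in> carrier (Sub C (Dom C m))"
    using m mp by simp
  fix a assume a: "a \<in> Arr C" "Cod C a = Dom C m"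
  note iff = below_inverse_image[OF MM_Arr[OF m] mp a]
  show "below C a (inverse_image C m (direct_image C m p)) \<longleftrightarrow> below C a p"
  proof
    assume "below C a (inverse_image C m (direct_image C m p))"
    then have ma: "below C (m \<cdot> a) (direct_image C m p)" using iff by simp
    have maA: "m \<cdot> a \<in> Arr C" using a m by simp
    obtain c where c: "c \<in> Arr C" "Cod C c = Dom C m" "m \<cdot> c = m \<cdot> a" "below C c p"
      using below_direct_imageE[OF m p maA ma] .
    have "Dom C c = Dom C a" using c a m by (metis Dom_Comp MM_Arr)
    then have "c = a" using MM_cancel[OF m c(3)] c a by simp
    then show "below C a p" using c by simp
  next
    assume "below C a p"
    then show "below C a (inverse_image C m (direct_image C m p))"
      using iff below_direct_image[OF MM_Arr[OF m] p a] by simp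
  qed
qed (rule p)

lemma direct_image_mono:
  assumes f: "f \<in> Arr C" and p: "p \<in> carrier (Sub C (Dom C f))" and q: "q \<in> carrier (Sub C (Dom C f))"
    and le: "p \<sqsubseteq>\<^bsub>Sub C (Dom C f)\<^esub> q"
  shows "direct_image C f p \<sqsubseteq>\<^bsub>Sub C (Cod C f)\<^esub> direct_image C f q"
proof -
  note fq = direct_image_closed[OF f q]
  have "q \<sqsubseteq>\<^bsub>Sub C (Dom C f)\<^esub> inverse_image C f (direct_image C f q)"
    using direct_image_adjoint[OF f q fq] Sub_refl[OF fq] by simp
  then show ?thesis
    using direct_image_adjoint[OF f p fq] Sub_trans[OF le _ p q inverse_image_closed[OF f fq]]
    by simp
qed

lemma direct_image_inverse_le:
  assumes f: "f \<in> Arr C" and q: "q \<in> carrier (Sub C (Cod C f))"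
  shows "direct_image C f (inverse_image C f q) \<sqsubseteq>\<^bsub>Sub C (Cod C f)\<^esub> q"
  using direct_image_adjoint[OF f inverse_image_closed[OF f q] q]
    Sub_refl[OF inverse_image_closed[OF f q]] by simp

lemma direct_image_sigma:
  assumes f: "f \<in> Arr C"
  shows "direct_image C f (sigma C (Dom C f)) = sigma C (Cod C f)"
proof (rule Sub_antisym[where X = "Cod C f"])
  note s = sigma_bottom[OF Dom_Obj[OF f]] and t = sigma_bottom[OF Cod_Obj[OF f]]
  show fs: "direct_image C f (sigma C (Dom C f)) \<in> carrier (Sub C (Cod C f))"
    by (rule direct_image_closed[OF f s(1)])
  show "direct_image C f (sigma C (Dom C f)) \<sqsubseteq>\<^bsub>Sub C (Cod C f)\<^esub> sigma C (Cod C f)"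
    using direct_image_adjoint[OF f s(1) t(1)] s(2)[OF inverse_image_closed[OF f t(1)]] by simp
  show "sigma C (Cod C f) \<sqsubseteq>\<^bsub>Sub C (Cod C f)\<^esub> direct_image C f (sigma C (Dom C f))"
    by (rule t(2)[OF fs])
  show "sigma C (Cod C f) \<in> carrier (Sub C (Cod C f))" by (rule t(1))
qed

lemma inverse_image_sigma:
  assumes m: "m \<in> MM C"
  shows "inverse_image C m (sigma C (Cod C m)) = sigma C (Dom C m)"
  using inverse_direct_image[OF m sigma_bottom(1)[OF Dom_Obj[OF MM_Arr[OF m]]]]
    direct_image_sigma[OF MM_Arr[OF m]] by simp

lemma restrict_pns_iff:
  assumes m: "m \<in> MM C" and a: "a \<in> carrier (Sub C (Dom C m))"
  shows "u \<in> restrict_pns C \<phi> m a \<longleftrightarrow> u \<in> carrier (Sub C (Dom C m)) \<and>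
    (\<exists>v \<in> \<phi> (direct_image C m a). inverse_image C m v \<sqsubseteq>\<^bsub>Sub C (Dom C m)\<^esub> u)"
  using comp_sub_eq_direct_image[OF m a] by (simp add: restrict_pns_def)

lemma restrict_pns_is_pns:
  assumes m: "m \<in> MM C" and \<phi>: "is_pns C (Cod C m) \<phi>"
  shows "is_pns C (Dom C m) (restrict_pns C \<phi> m)"
  unfolding is_pns_def is_filter_def
proof (intro conjI ballI impI subsetI)
  let ?M = "Sub C (Dom C m)" and ?X = "Sub C (Cod C m)" and ?\<mu> = "restrict_pns C \<phi> m"
  note mA = MM_Arr[OF m] and iff = restrict_pns_iff[OF m, of _ _ \<phi>]
  note dc = direct_image_closed[OF mA] and ic = inverse_image_closed[OF mA]
  show M: "Dom C m \<in> Obj C" using mA by simp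
  note \<phi>D = is_pnsD[OF \<phi>]
  fix a
  {
    assume a: "a \<in> carrier ?M"
    show "u \<in> carrier ?M" if "u \<in> ?\<mu> a" for u using that iff[OF a] by blast
    show "w \<in> ?\<mu> a" if u: "u \<in> ?\<mu> a" "w \<in> carrier ?M" "u \<sqsubseteq>\<^bsub>?M\<^esub> w" for u w
    proof -
      obtain v where v: "v \<in> \<phi> (direct_image C m a)" "inverse_image C m v \<sqsubseteq>\<^bsub>?M\<^esub> u" "u \<in> carrier ?M"
        using u(1) iff[OF a] by blast
      have "v \<in> carrier ?X" using \<phi>D(2)[OF dc[OF a] v(1)] .
      then have "inverse_image C m v \<sqsubseteq>\<^bsub>?M\<^esub> w"
        using Sub_trans[OF v(2) u(3) ic v(3) u(2)] by simp
      then show ?thesis using u(2) v(1) iff[OF a] by blast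
    qed
    show "\<top>\<^bsub>?M\<^esub> \<in> ?\<mu> a"
      using \<phi>D(4)[OF dc[OF a]] inverse_image_top[OF mA] Sub_top(1)[OF M] Sub_refl
        iff[OF a, of "\<top>\<^bsub>?M\<^esub>"] by (metis (no_types))
    show "u \<sqinter>\<^bsub>?M\<^esub> w \<in> ?\<mu> a" if uw: "u \<in> ?\<mu> a" "w \<in> ?\<mu> a" for u w
    proof -
      obtain v where v: "v \<in> \<phi> (direct_image C m a)" "inverse_image C m v \<sqsubseteq>\<^bsub>?M\<^esub> u" "u \<in> carrier ?M"
        using uw(1) iff[OF a] by blast
      obtain v' where v': "v' \<in> \<phi> (direct_image C m a)" "inverse_image C m v' \<sqsubseteq>\<^bsub>?M\<^esub> w" "w \<in> carrier ?M"
        using uw(2) iff[OF a] by blast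
      have vc: "v \<in> carrier ?X" "v' \<in> carrier ?X" using \<phi>D(2)[OF dc[OF a]] v(1) v'(1) by blast+
      note meets = Sub_meet[OF M ic[OF vc(1)] ic[OF vc(2)]] Sub_meet[OF M v(3) v'(3)]
      have "inverse_image C m v \<sqinter>\<^bsub>?M\<^esub> inverse_image C m v' \<sqsubseteq>\<^bsub>?M\<^esub> u \<sqinter>\<^bsub>?M\<^esub> w"
        unfolding Sub_le_iff[OF meets(1,3)]
        using meets(2,4) v(2) v'(2) unfolding Sub_le_iff[OF ic[OF vc(1)] v(3)] Sub_le_iff[OF ic[OF vc(2)] v'(3)]
        by blast
      then have "inverse_image C m (v \<sqinter>\<^bsub>?X\<^esub> v') \<sqsubseteq>\<^bsub>?M\<^esub> u \<sqinter>\<^bsub>?M\<^esub> w"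
        using inverse_image_meet[OF mA vc] by simp
      then show ?thesis using \<phi>D(5)[OF dc[OF a] v(1) v'(1)] meets(3) iff[OF a] by blast
    qed
    show "u \<in> ?\<mu> a" if b: "b \<in> carrier ?M" "a \<sqsubseteq>\<^bsub>?M\<^esub> b" "u \<in> ?\<mu> b" for b u
    proof -
      obtain v where v: "v \<in> \<phi> (direct_image C m b)" "inverse_image C m v \<sqsubseteq>\<^bsub>?M\<^esub> u" "u \<in> carrier ?M"
        using b(3) iff[OF b(1)] by blast
      have "v \<in> \<phi> (direct_image C m a)"
        using \<phi>D(6)[OF dc[OF a] dc[OF b(1)] direct_image_mono[OF mA a b(1,2)] v(1)] .
      then show ?thesis using v iff[OF a] by blast
    qed
    show "a \<sqsubseteq>\<^bsub>?M\<^esub> u" if u: "u \<in> ?\<mu> a" for u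
    proof -
      obtain v where v: "v \<in> \<phi> (direct_image C m a)" "inverse_image C m v \<sqsubseteq>\<^bsub>?M\<^esub> u" "u \<in> carrier ?M"
        using u iff[OF a] by blast
      have vc: "v \<in> carrier ?X" and le: "direct_image C m a \<sqsubseteq>\<^bsub>?X\<^esub> v"
        using \<phi>D(2,8)[OF dc[OF a] v(1)] .
      have "a \<sqsubseteq>\<^bsub>?M\<^esub> inverse_image C m v" using direct_image_adjoint[OF mA a vc] le by simp
      then show ?thesis using Sub_trans[OF _ v(2) a ic[OF vc] v(3)] by simp
    qed
  }
  show "?\<mu> (sigma C (Dom C m)) = carrier ?M"
  proof -
    note s = sigma_bottom[OF M] and t = sigma_bottom[OF Cod_Obj[OF mA]]
    have "u \<in> ?\<mu> (sigma C (Dom C m))" if u: "u \<in> carrier ?M" for u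
    proof -
      have "sigma C (Cod C m) \<in> \<phi> (direct_image C m (sigma C (Dom C m)))"
        using direct_image_sigma[OF mA] \<phi>D(7) t(1) by simp
      moreover have "inverse_image C m (sigma C (Cod C m)) \<sqsubseteq>\<^bsub>?M\<^esub> u"
        using inverse_image_sigma[OF m] s(2)[OF u] by simp
      ultimately show ?thesis using iff[OF s(1)] u by blast
    qed
    then show ?thesis using iff[OF s(1)] by blast
  qed
qed

lemma restrict_pns_embedding:
  assumes m: "m \<in> MM C" and \<phi>: "is_pns C (Cod C m) \<phi>"
  shows "pn_embedding C (restrict_pns C \<phi> m) \<phi> m"
proof -
  note mA = MM_Arr[OF m]
  have "inverse_image C m p \<in> restrict_pns C \<phi> m (inverse_image C m u)"
    if u: "u \<in> carrier (Sub C (Cod C m))" and p: "p \<in> \<phi> u" for u p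
  proof -
    note mu = inverse_image_closed[OF mA u]
    have pc: "p \<in> carrier (Sub C (Cod C m))" using is_pnsD(2)[OF \<phi> u p] .
    have "p \<in> \<phi> (direct_image C m (inverse_image C m u))"
      using is_pnsD(6)[OF \<phi> direct_image_closed[OF mA mu] u direct_image_inverse_le[OF mA u] p] .
    then show ?thesis
      using restrict_pns_iff[OF m mu] inverse_image_closed[OF mA pc] Sub_refl by blast
  qed
  then show ?thesis
    using m \<phi> restrict_pns_is_pns[OF m \<phi>] by (simp add: pn_embedding_def pn_morphism_def)
qed

text \<open>
  Restricted systems are initial: by \<open>inverse_direct_image\<close>, a neighbourhood of \<open>a\<close> contains the trace of
  a neighbourhood of its image \<open>m \<circ> a\<close>, and the trace is pulled back along \<open>t\<close> as the latter is along
  \<open>m \<cdot> t\<close>.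
\<close>

lemma embedding_lift:
  assumes m: "pn_embedding C \<mu> \<phi> m" and t: "t \<in> Arr C" "Cod C t = Dom C m"
    and mt: "pn_morphism C \<theta> \<phi> (m \<cdot> t)"
  shows "pn_morphism C \<theta> \<mu> t"
  unfolding pn_morphism_def
proof (intro conjI ballI)
  have mM: "m \<in> MM C" and mp: "pn_morphism C \<mu> \<phi> m"
    and res: "\<And>a. a \<in> carrier (Sub C (Dom C m)) \<Longrightarrow> \<mu> a \<subseteq> restrict_pns C \<phi> m a"
    using m by (simp_all add: pn_embedding_def)
  note mA = MM_Arr[OF mM] and D = pn_morphismD[OF mp] and T = pn_morphismD[OF mt]
  show "t \<in> Arr C" by (rule t(1))
  show \<theta>: "is_pns C (Dom C t) \<theta>" using T(2) t mA by simp
  show "is_pns C (Cod C t) \<mu>" using D(2) t by simp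
  fix a u assume "a \<in> carrier (Sub C (Cod C t))" and u: "u \<in> \<mu> a"
  then have a: "a \<in> carrier (Sub C (Dom C m))" using t by simp
  note da = direct_image_closed[OF mA a]
  obtain v where v: "v \<in> \<phi> (direct_image C m a)" "inverse_image C m v \<sqsubseteq>\<^bsub>Sub C (Dom C m)\<^esub> u"
    and uc: "u \<in> carrier (Sub C (Dom C m))"
    using u res[OF a] restrict_pns_iff[OF mM a] by blast
  have vc: "v \<in> carrier (Sub C (Cod C m))" using is_pnsD(2)[OF D(3) da v(1)] .
  have mt': "inverse_image C (m \<cdot> t) w = inverse_image C t (inverse_image C m w)"
    if "w \<in> carrier (Sub C (Cod C m))" for w
    using inverse_image_Comp[OF t(1) mA t(2) that] .
  have "inverse_image C (m \<cdot> t) v \<in> \<theta> (inverse_image C (m \<cdot> t) (direct_image C m a))"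
    using T(4)[OF _ v(1)] da t mA by simp
  then have *: "inverse_image C t (inverse_image C m v) \<in> \<theta> (inverse_image C t a)"
    using mt'[OF vc] mt'[OF da] inverse_direct_image[OF mM a] by simp
  have cs: "inverse_image C m v \<in> carrier (Sub C (Cod C t))" "u \<in> carrier (Sub C (Cod C t))"
    "a \<in> carrier (Sub C (Cod C t))"
    using inverse_image_closed[OF mA vc] uc a t by simp_all
  have "inverse_image C t (inverse_image C m v) \<sqsubseteq>\<^bsub>Sub C (Dom C t)\<^esub> inverse_image C t u"
    using inverse_image_mono[OF t(1) cs(1,2)] v(2) t by simp
  then show "inverse_image C t u \<in> \<theta> (inverse_image C t a)"
    using is_pnsD(3)[OF \<theta> inverse_image_closed[OF t(1) cs(3)] * inverse_image_closed[OF t(1) cs(2)]]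
    by simp
qed

lemma pn_morphism_Id_subset:
  assumes Id: "pn_morphism C \<rho>' \<rho> (Id C X)" and X: "X \<in> Obj C" and m: "m \<in> carrier (Sub C X)"
  shows "\<rho> m \<subseteq> \<rho>' m"
proof
  fix u assume u: "u \<in> \<rho> m"
  have "is_pns C X \<rho>" using pn_morphismD(3)[OF Id] X by simp
  then have "u \<in> carrier (Sub C X)" using m u by (rule is_pnsD(2))
  then show "u \<in> \<rho>' m"
    using pn_morphismD(4)[OF Id, of m u] X m u by (simp add: inverse_image_Id)
qed

lemma embedding_pullback:
  assumes m: "pn_embedding C \<mu> \<phi> m" and h: "pn_morphism C \<omega> \<phi> h" and P: "is_pullback C m h p q"
  shows "pn_pullback C \<mu> \<phi> \<omega> m h (restrict_pns C \<omega> q) p q"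
proof -
  let ?\<rho> = "restrict_pns C \<omega> q"
  note D = pullbackD[OF P]
  have mM: "m \<in> MM C" and mp: "pn_morphism C \<mu> \<phi> m" using m by (simp_all add: pn_embedding_def)
  have q: "q \<in> MM C" using pullback_MM[OF pullback_sym[OF P] mM] .
  have \<omega>: "is_pns C (Cod C q) \<omega>" using pn_morphismD(2)[OF h] D(8) by simp
  note qe = restrict_pns_embedding[OF q \<omega>]
  then have qp: "pn_morphism C ?\<rho> \<omega> q" by (simp add: pn_embedding_def)
  have "pn_morphism C ?\<rho> \<phi> (m \<cdot> p)" using pn_morphism_Comp[OF qp h D(8)] D(9) by simp
  then have pp: "pn_morphism C ?\<rho> \<mu> p" using embedding_lift[OF m D(3,7)] by simp
  have univ: "pn_morphism C \<theta> ?\<rho> t"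
    if "t \<in> Hom C (Dom C t) (Dom C p)" "pn_morphism C \<theta> \<omega> (q \<cdot> t)" for \<theta> t
    using embedding_lift[OF qe _ _ that(2)] that(1) D(6) by (simp add: Hom_def)
  have Y: "Dom C p \<in> Obj C" using D by simp
  have least: "?\<rho> a \<subseteq> \<rho>' a"
    if "pn_morphism C \<rho>' \<omega> q" "a \<in> carrier (Sub C (Dom C p))" for \<rho>' a
    by (rule pn_morphism_Id_subset[OF univ Y that(2)]) (use that D Y in \<open>simp_all add: Hom_def\<close>)
  show ?thesis
    unfolding pn_pullback_def using mp h P pp qp univ least by blast
qed

lemma embedding_has_pn_pullbacks:
  assumes m: "pn_embedding C \<mu> \<phi> m"
  shows "has_pn_pullbacks C \<mu> \<phi> m"
  unfolding has_pn_pullbacks_def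
proof (intro allI impI)
  fix \<omega> h assume h: "pn_morphism C \<omega> \<phi> h \<and> Cod C h = Cod C m"
  have "m \<in> Arr C" using m by (simp add: pn_embedding_def)
  then obtain p q where "is_pullback C m h p q"
    using pullback_exists[of m h] h pn_morphismD(1)[of \<omega> \<phi> h] by metis
  then show "\<exists>\<rho> p q. pn_pullback C \<mu> \<phi> \<omega> m h \<rho> p q"
    using embedding_pullback[OF m] h by blast
qed

lemma pullback_embedding:
  assumes m: "pn_embedding C \<mu> \<phi> m" and P: "pn_pullback C \<mu> \<phi> \<omega> m h \<rho> p q"
  shows "pn_embedding C \<rho> \<omega> q"
proof -
  have U: "is_pullback C m h p q" and h: "pn_morphism C \<omega> \<phi> h" and q: "pn_morphism C \<rho> \<omega> q"
    using P by (simp_all add: pn_pullback_def)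
  note D = pullbackD[OF U]
  have "m \<in> MM C" using m by (simp add: pn_embedding_def)
  then have qM: "q \<in> MM C" using pullback_MM[OF pullback_sym[OF U]] by simp
  have R: "pn_morphism C (restrict_pns C \<omega> q) \<mu> p" "pn_morphism C (restrict_pns C \<omega> q) \<omega> q"
    using embedding_pullback[OF m h U] by (simp_all add: pn_pullback_def)
  then have "\<rho> a \<subseteq> restrict_pns C \<omega> q a" if "a \<in> carrier (Sub C (Dom C p))" for a
    using P that unfolding pn_pullback_def by blast
  then show ?thesis using qM q D(6) by (simp add: pn_embedding_def)
qed

text \<open>
  For \<open>p\<close> closed in the domain and \<open>x\<close> a subobject of the codomain, compare \<open>x\<close> with \<open>m\<close>.  If \<open>x\<close>
  contains \<open>m\<close>, it contains \<open>m \<circ> p\<close>; if \<open>x\<close> is far from \<open>m\<close>, it is far from \<open>m \<circ> p\<close>.  If \<open>x\<close> is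
  contained in \<open>m\<close>, it is the image of \<open>m\<^sup>-\<^sup>1 x\<close>, and closedness of \<open>p\<close> in the restricted system
  transfers to the codomain.
\<close>

lemma closed_embedding_closed_morphism:
  assumes m: "pn_embedding C \<mu> \<phi> m" and cl: "subobj C m \<in> closed_subs C (Cod C m) \<phi>"
  shows "closed_morphism C \<mu> \<phi> m"
proof -
  have mM: "m \<in> MM C" and mp: "pn_morphism C \<mu> \<phi> m"
    and res: "\<And>a. a \<in> carrier (Sub C (Dom C m)) \<Longrightarrow> \<mu> a \<subseteq> restrict_pns C \<phi> m a"
    using m by (simp_all add: pn_embedding_def)
  note mA = MM_Arr[OF mM] and D = pn_morphismD[OF mp]
  let ?X = "Sub C (Cod C m)" and ?M = "Sub C (Dom C m)" and ?\<sigma> = "sigma C (Cod C m)"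
  note X = Cod_Obj[OF mA] and M = Dom_Obj[OF mA]
  note s = sigma_bottom[OF X]
  have eq\<sigma>: "w = ?\<sigma>"
    if "w \<in> carrier ?X" "\<And>a. \<lbrakk>a \<in> Arr C; Cod C a = Cod C m; below C a w\<rbrakk> \<Longrightarrow> below C a ?\<sigma>" for w
  proof -
    have "w \<sqsubseteq>\<^bsub>?X\<^esub> ?\<sigma>"
      unfolding Sub_le_iff[OF that(1) s(1)] using that(2) by blast
    then show ?thesis using s(2)[OF that(1)] that(1) s(1) by (rule Sub_antisym)
  qed
  have "direct_image C m p \<in> closed_subs C (Cod C m) \<phi>" if p: "p \<in> closed_subs C (Dom C m) \<mu>" for p
    unfolding closed_subs_iff[OF D(3)]
  proof (intro conjI ballI)
    have pc: "p \<in> carrier ?M" using p by (simp add: closed_subs_def)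
    show dp: "direct_image C m p \<in> carrier ?X" by (rule direct_image_closed[OF mA pc])
    have mc: "subobj C m \<in> carrier ?X" by (rule subobj_closed[OF mM])
    have below_m: "below C a (subobj C m)" if "a \<in> Arr C" "below C a (direct_image C m p)" for a
      using that below_direct_imageE[OF mM pc] factors_throughI[OF _ mA] below_subobj[OF mM] by metis
    fix x assume x: "x \<in> carrier ?X"
    let ?goal = "x \<sqsubseteq>\<^bsub>?X\<^esub> direct_image C m p \<or> direct_image C m p \<sqsubseteq>\<^bsub>?X\<^esub> x \<or>
      (\<exists>u \<in> \<phi> x. u \<sqinter>\<^bsub>?X\<^esub> direct_image C m p = ?\<sigma>)"
    consider "x \<sqsubseteq>\<^bsub>?X\<^esub> subobj C m" | "subobj C m \<sqsubseteq>\<^bsub>?X\<^esub> x" |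
      u where "u \<in> \<phi> x" "u \<sqinter>\<^bsub>?X\<^esub> subobj C m = ?\<sigma>"
      using cl x unfolding closed_subs_iff[OF D(3)] by blast
    then show ?goal
    proof cases
      case 2
      have "direct_image C m p \<sqsubseteq>\<^bsub>?X\<^esub> subobj C m"
        using below_m unfolding Sub_le_iff[OF dp mc] by blast
      then show ?thesis using Sub_trans[OF _ 2 dp mc x] by blast
    next
      case 3
      have uc: "u \<in> carrier ?X" using is_pnsD(2)[OF D(3) x 3(1)] .
      have "u \<sqinter>\<^bsub>?X\<^esub> direct_image C m p = ?\<sigma>"
      proof (rule eq\<sigma>)
        fix a assume a: "a \<in> Arr C" "Cod C a = Cod C m" "below C a (u \<sqinter>\<^bsub>?X\<^esub> direct_image C m p)"
        then have "below C a (u \<sqinter>\<^bsub>?X\<^esub> subobj C m)"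
          using Sub_meet(2)[OF X uc dp a(1,2)] Sub_meet(2)[OF X uc mc a(1,2)] below_m by blast
        then show "below C a ?\<sigma>" using 3(2) by simp
      qed (rule Sub_meet(1)[OF X uc dp])
      then show ?thesis using 3(1) by blast
    next
      case 1
      let ?x = "inverse_image C m x"
      have xc: "?x \<in> carrier ?M" by (rule inverse_image_closed[OF mA x])
      note dx = direct_image_closed[OF mA xc]
      have "x \<sqsubseteq>\<^bsub>?X\<^esub> direct_image C m ?x"
        unfolding Sub_le_iff[OF x dx]
      proof (intro ballI impI)
        fix a assume a: "a \<in> Arr C" "Cod C a = Cod C m" "below C a x"
        then have "factors_through C a m"
          using 1 unfolding Sub_le_iff[OF x mc] below_subobj[OF mM] by blast
        then obtain c where c: "c \<in> Arr C" "Cod C c = Dom C m" "m \<cdot> c = a" by (rule factors_throughE)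
        then have "below C c ?x" using below_inverse_image[OF mA x c(1,2)] a by simp
        then show "below C a (direct_image C m ?x)"
          using below_direct_image[OF mA xc c(1,2)] c(3) by simp
      qed
      then have x_eq: "direct_image C m ?x = x"
        using direct_image_inverse_le[OF mA x] Sub_antisym[OF _ _ dx x] by blast
      consider "?x \<sqsubseteq>\<^bsub>?M\<^esub> p" | "p \<sqsubseteq>\<^bsub>?M\<^esub> ?x" | u where "u \<in> \<mu> ?x" "u \<sqinter>\<^bsub>?M\<^esub> p = sigma C (Dom C m)"
        using p xc unfolding closed_subs_iff[OF D(2)] by blast
      then show ?thesis
      proof cases
        case 1
        then show ?thesis using direct_image_mono[OF mA xc pc] x_eq by simp
      next
        case 2
        then show ?thesis using direct_image_mono[OF mA pc xc] x_eq by simp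
      next
        case 3
        then have "u \<in> restrict_pns C \<phi> m ?x" using res[OF xc] by blast
        then obtain v where v: "v \<in> \<phi> x" "inverse_image C m v \<sqsubseteq>\<^bsub>?M\<^esub> u" and uc: "u \<in> carrier ?M"
          unfolding restrict_pns_iff[OF mM xc] x_eq by blast
        have vc: "v \<in> carrier ?X" using is_pnsD(2)[OF D(3) x v(1)] .
        note mv = inverse_image_closed[OF mA vc]
        have "v \<sqinter>\<^bsub>?X\<^esub> direct_image C m p = ?\<sigma>"
        proof (rule eq\<sigma>)
          fix a assume a: "a \<in> Arr C" "Cod C a = Cod C m" "below C a (v \<sqinter>\<^bsub>?X\<^esub> direct_image C m p)"
          then have av: "below C a v" "below C a (direct_image C m p)"
            using Sub_meet(2)[OF X vc dp a(1,2)] by simp_all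
          obtain c where c: "c \<in> Arr C" "Cod C c = Dom C m" "m \<cdot> c = a" "below C c p"
            using below_direct_imageE[OF mM pc a(1) av(2)] .
          have "below C c (inverse_image C m v)"
            using below_inverse_image[OF mA vc c(1,2)] av(1) c(3) by simp
          then have "below C c u" using v(2) c(1,2) unfolding Sub_le_iff[OF mv uc] by blast
          then have "below C c (sigma C (Dom C m))"
            using Sub_meet(2)[OF M uc pc c(1,2)] c(4) 3(2) by simp
          then show "below C a ?\<sigma>" using below_sigma_Comp[OF mA c(1,2)] c(3) by simp
        qed (rule Sub_meet(1)[OF X vc dp])
        then show ?thesis using v(1) by blast
      qed
    qed
  qed
  then show ?thesis using mA D by (simp add: closed_morphism_def)
qed

lemma section_MM:
  assumes d: "d \<in> Arr C" and p: "p \<in> Arr C" and dp: "Cod C d = Dom C p" and pd: "p \<cdot> d = Id C (Dom C d)"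
  shows "d \<in> MM C"
proof -
  obtain e m where em: "e \<in> EE C" "m \<in> MM C" "Cod C e = Dom C m" "m \<cdot> e = d"
    "Dom C e = Dom C d" "Cod C m = Cod C d"
    using d by (rule factorizationE)
  note emA = EE_Arr[OF em(1)] MM_Arr[OF em(2)]
  have "Cod C p = Dom C d"
    using pd d p dp by (metis Cod_Comp Cod_Id Dom_Obj)
  then have [simp]: "p \<cdot> m \<in> Arr C" "Dom C (p \<cdot> m) = Cod C e" "Cod C (p \<cdot> m) = Dom C e"
    using em p dp emA by simp_all
  have pme: "(p \<cdot> m) \<cdot> e = Id C (Dom C e)" using em p dp pd emA by simp
  have "e \<cdot> (p \<cdot> m) = Id C (Cod C e)"
  proof (rule epi_cancel[OF EE_epi[OF em(1)]])
    have "e \<cdot> ((p \<cdot> m) \<cdot> e) = e" using pme emA by simp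
    then show "(e \<cdot> (p \<cdot> m)) \<cdot> e = Id C (Cod C e) \<cdot> e" using emA em p dp by simp
  qed (use emA in simp_all)
  then have "is_iso C e" using pme emA by (intro is_isoI[of e "p \<cdot> m"]) simp_all
  then have "e \<in> MM C" by (rule iso_MM)
  then show ?thesis using MM_Comp[OF _ em(2,3)] em(4) by simp
qed

text \<open>
  A neighbourhood \<open>u\<close> of \<open>a\<close> is the trace of \<open>p\<^sup>-\<^sup>1 u\<close>, which is a neighbourhood of \<open>p\<^sup>-\<^sup>1 a\<close> and
  therefore of the smaller subobject \<open>d \<circ> a\<close>.
\<close>

lemma section_embedding:
  assumes d: "pn_morphism C \<mu> \<kappa> d" and p: "pn_morphism C \<kappa> \<mu> p" and dp: "Cod C d = Dom C p"
    and pd: "p \<cdot> d = Id C (Dom C d)"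
  shows "pn_embedding C \<mu> \<kappa> d"
proof -
  note D = pn_morphismD[OF d] and P = pn_morphismD[OF p]
  have dM: "d \<in> MM C" by (rule section_MM[OF D(1) P(1) dp pd])
  have cod: "Cod C p = Dom C d" using pd D(1) P(1) dp by (metis Cod_Comp Cod_Id Dom_Obj)
  have "u \<in> restrict_pns C \<kappa> d a" if a: "a \<in> carrier (Sub C (Dom C d))" and u: "u \<in> \<mu> a" for a u
  proof -
    have uc: "u \<in> carrier (Sub C (Dom C d))" using is_pnsD(2)[OF D(2) a u] .
    have dpi: "inverse_image C d (inverse_image C p w) = w" if "w \<in> carrier (Sub C (Dom C d))" for w
      using inverse_image_Comp[OF D(1) P(1) dp, of w] that cod pd D(1) by (simp add: inverse_image_Id)
    have ac: "a \<in> carrier (Sub C (Cod C p))" "u \<in> carrier (Sub C (Cod C p))" using a uc cod by simp_all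
    have pa: "inverse_image C p a \<in> carrier (Sub C (Cod C d))"
      using inverse_image_closed[OF P(1) ac(1)] dp by simp
    have "direct_image C d a \<sqsubseteq>\<^bsub>Sub C (Cod C d)\<^esub> inverse_image C p a"
      using direct_image_adjoint[OF D(1) a pa] dpi[OF a] Sub_refl[OF a] by simp
    then have "inverse_image C p u \<in> \<kappa> (direct_image C d a)"
      using is_pnsD(6)[OF D(3) direct_image_closed[OF D(1) a] pa] P(4)[OF ac(1) u] by blast
    then show ?thesis using restrict_pns_iff[OF dM a] uc dpi[OF uc] Sub_refl[OF uc] by metis
  qed
  then show ?thesis using d dM by (auto simp: pn_embedding_def)
qed

section \<open>Closed embeddings and perfect morphisms\<close>

text \<open>
  A split epimorphism in \<open>\<M>\<close> represents the largest subobject, which is closed.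
\<close>

lemma split_closed_embedding:
  assumes q: "pn_embedding C \<rho> \<omega> q" and t: "t \<in> Arr C" "Cod C t = Dom C q" "q \<cdot> t = Id C (Cod C q)"
  shows "closed_morphism C \<rho> \<omega> q"
proof (rule closed_embedding_closed_morphism[OF q])
  have qM: "q \<in> MM C" and \<omega>: "is_pns C (Cod C q) \<omega>"
    using q by (simp_all add: pn_embedding_def pn_morphism_def)
  note qA = MM_Arr[OF qM]
  note top = Sub_top[OF Cod_Obj[OF qA]] and qc = subobj_closed[OF qM]
  have dt: "Dom C t = Cod C q" using t qA by (metis Dom_Comp Dom_Id Cod_Obj)
  have "\<top>\<^bsub>Sub C (Cod C q)\<^esub> \<sqsubseteq>\<^bsub>Sub C (Cod C q)\<^esub> subobj C q"
    unfolding Sub_le_iff[OF top(1) qc]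
  proof (intro ballI impI)
    fix a assume a: "a \<in> Arr C" "Cod C a = Cod C q"
    have "q \<cdot> (t \<cdot> a) = a" using Comp_left_eq[OF t(3), of a] a t dt qA by simp
    then show "below C a (subobj C q)"
      using factors_throughI[of "t \<cdot> a" q] a t dt qA by (simp add: below_subobj[OF qM])
  qed
  then have "subobj C q = \<top>\<^bsub>Sub C (Cod C q)\<^esub>"
    using top(2)[OF qc] Sub_antisym[OF _ _ qc top(1)] by blast
  then show "subobj C q \<in> closed_subs C (Cod C q) \<omega>" using top_closed[OF \<omega>] by simp
qed

lemma closed_embedding_proper:
  assumes cont: "\<And>\<mu> \<phi> f. pn_morphism C \<mu> \<phi> f \<Longrightarrow> continuous_morphism C \<mu> \<phi> f"
    and m: "pn_embedding C \<mu> \<phi> m" and cl: "subobj C m \<in> closed_subs C (Cod C m) \<phi>"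
  shows "proper C \<mu> \<phi> m"
  unfolding proper_def stably_def
proof (intro conjI allI impI)
  show "pn_morphism C \<mu> \<phi> m" using m by (simp add: pn_embedding_def)
  show "has_pn_pullbacks C \<mu> \<phi> m" using m by (rule embedding_has_pn_pullbacks)
  fix \<omega> h \<rho> p q assume P: "pn_pullback C \<mu> \<phi> \<omega> m h \<rho> p q"
  then have U: "is_pullback C m h p q" and h: "continuous_morphism C \<omega> \<phi> h"
    using cont by (simp_all add: pn_pullback_def)
  note D = pullbackD[OF U]
  have "m \<in> MM C" using m by (simp add: pn_embedding_def)
  then have "inverse_image C h (subobj C m) = subobj C q"
    using inverse_image_subobj[OF pullback_sym[OF U]] by simp
  then have "subobj C q \<in> closed_subs C (Cod C q) \<omega>"
    using h cl D(5,8) by (auto simp: continuous_morphism_def)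
  then show "closed_morphism C \<rho> \<omega> q"
    by (rule closed_embedding_closed_morphism[OF pullback_embedding[OF m P]])
qed

text \<open>
  The underlying morphism is monic, so its diagonal is invertible with inverse either projection.
  Pullbacks of the diagonal are then split epimorphisms and embeddings, hence closed morphisms.
\<close>

lemma embedding_separated:
  assumes m: "pn_embedding C \<mu> \<phi> m"
  shows "separated C \<mu> \<phi> m"
  unfolding separated_def
proof (intro conjI allI impI)
  have mM: "m \<in> MM C" and mp: "pn_morphism C \<mu> \<phi> m" using m by (simp_all add: pn_embedding_def)
  show "pn_morphism C \<mu> \<phi> m" by (rule mp)
  show "\<exists>\<kappa> p q. pn_pullback C \<mu> \<phi> \<mu> m m \<kappa> p q"
    using embedding_has_pn_pullbacks[OF m] mp unfolding has_pn_pullbacks_def by blast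
  fix \<kappa> p q d
  assume *: "pn_pullback C \<mu> \<phi> \<mu> m m \<kappa> p q \<and> d \<in> Hom C (Dom C m) (Dom C p) \<and>
    p \<cdot> d = Id C (Dom C m) \<and> q \<cdot> d = Id C (Dom C m)"
  then have P: "pn_pullback C \<mu> \<phi> \<mu> m m \<kappa> p q" and d: "d \<in> Hom C (Dom C m) (Dom C p)"
    and pd: "p \<cdot> d = Id C (Dom C m)" and qd: "q \<cdot> d = Id C (Dom C m)"
    by blast+
  have U: "is_pullback C m m p q" and pp: "pn_morphism C \<kappa> \<mu> p"
    using P by (simp_all add: pn_pullback_def)
  note D = pullbackD[OF U]
  have dA: "d \<in> Arr C" "Dom C d = Dom C m" "Cod C d = Dom C p" using d by (simp_all add: Hom_def)
  have "is_diagonal (PNS C) (\<mu>, m, \<phi>) (\<kappa>, p, \<mu>) (\<kappa>, q, \<mu>) (\<mu>, d, \<kappa>)"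
    using is_diagonal_PNSI[OF P d pd qd] .
  then have dp: "pn_morphism C \<mu> \<kappa> d" by (simp add: is_diagonal_def Hom_def)
  have e: "pn_embedding C \<mu> \<kappa> d" by (rule section_embedding[OF dp pp]) (use dA pd in simp_all)
  have pq: "p = q" by (rule MM_cancel[OF mM D(9)]) (use D in simp_all)
  have dpi: "d \<cdot> p = Id C (Dom C p)"
  proof (rule pullback_eqI[OF U])
    have "p \<cdot> (d \<cdot> p) = p" using Comp_left_eq[OF pd, of p] D dA by simp
    then show "p \<cdot> (d \<cdot> p) = p \<cdot> Id C (Dom C p)" "q \<cdot> (d \<cdot> p) = q \<cdot> Id C (Dom C p)"
      using D by (simp_all flip: pq)
  qed (use D dA in simp_all)
  show "proper C \<mu> \<kappa> d"
    unfolding proper_def stably_def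
  proof (intro conjI allI impI)
    show "pn_morphism C \<mu> \<kappa> d" by (rule dp)
    show "has_pn_pullbacks C \<mu> \<kappa> d" using e by (rule embedding_has_pn_pullbacks)
    fix \<omega> h \<rho> p' q' assume P': "pn_pullback C \<mu> \<kappa> \<omega> d h \<rho> p' q'"
    then have U': "is_pullback C d h p' q'" by (simp add: pn_pullback_def)
    note D' = pullbackD[OF U']
    have "d \<cdot> (p \<cdot> h) = h" using Comp_left_eq[OF dpi, of h] D D' dA by simp
    then obtain t where "t \<in> Arr C" "Cod C t = Dom C p'" "q' \<cdot> t = Id C (Dom C h)"
      by - (rule pullbackE[OF U', of "p \<cdot> h" "Id C (Dom C h)"], use D D' dA in simp_all)
    then show "closed_morphism C \<rho> \<omega> q'"
      using D' by (intro split_closed_embedding[OF pullback_embedding[OF e P'], of t]) simp_all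
  qed
qed

text \<open>
  Pulling \<open>e\<close> back along a representative of \<open>c\<close>, with its restricted system, gives a morphism in
  \<open>\<E>\<close>, so that \<open>c\<close> is the image of \<open>e\<^sup>-\<^sup>1 c\<close>.  Therefore the image of \<open>c\<close> under \<open>g\<close> is the image
  of the closed subobject \<open>e\<^sup>-\<^sup>1 c\<close> under the closed morphism \<open>g \<cdot> e\<close>.
\<close>

lemma continuous_stably_E_cancel:
  assumes e: "continuous_morphism C \<rho> \<omega> e" and E: "stably_in_E C \<rho> \<omega> e"
  shows "(\<rho>, e, \<omega>) \<in> right_cancelling (PNS C) (closed_arrows C)"
  unfolding right_cancelling_def
proof (rule CollectI, intro ballI impI)
  fix G assume G: "G \<in> Arr (PNS C)" "Dom (PNS C) G = Cod (PNS C) (\<rho>, e, \<omega>)"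
    "G \<cdot>\<^bsub>PNS C\<^esub> (\<rho>, e, \<omega>) \<in> closed_arrows C"
  obtain \<omega>' g \<psi> where G': "G = (\<omega>', g, \<psi>)" by (cases G)
  have g: "pn_morphism C \<omega> \<psi> g" "Dom C g = Cod C e" "\<omega>' = \<omega>"
    and ge: "closed_morphism C \<rho> \<psi> (g \<cdot> e)"
    using G by (simp_all add: G')
  note gD = pn_morphismD[OF g(1)]
  have eA: "e \<in> Arr C" using e by (simp add: continuous_morphism_def)
  have eg: "Cod C e = Dom C g" using g(2) by simp
  have "direct_image C g c \<in> closed_subs C (Cod C g) \<psi>" if c: "c \<in> closed_subs C (Dom C g) \<omega>" for c
  proof -
    have cc: "c \<in> carrier (Sub C (Cod C e))" using c eg by (simp add: closed_subs_def)
    then obtain n where n: "n \<in> MM C" "Cod C n = Cod C e" "c = subobj C n" by (rule SubE)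
    have "is_pns C (Cod C n) \<omega>" using gD(2) n(2) eg by simp
    then have "pn_morphism C (restrict_pns C \<omega> n) \<omega> n"
      using restrict_pns_embedding[OF n(1)] by (simp add: pn_embedding_def)
    then obtain \<rho>' p q where P: "pn_pullback C \<rho> \<omega> (restrict_pns C \<omega> n) e n \<rho>' p q"
      using E n(2) unfolding stably_in_E_def stably_def has_pn_pullbacks_def by blast
    then have "q \<in> EE C" using E unfolding stably_in_E_def stably_def by blast
    moreover have "is_pullback C e n p q" using P by (simp add: pn_pullback_def)
    ultimately have ec: "direct_image C e (inverse_image C e c) = c"
      using direct_inverse_image n by simp
    have "inverse_image C e c \<in> closed_subs C (Dom C e) \<rho>"
      using e c eg by (simp add: continuous_morphism_def)
    then have "direct_image C (g \<cdot> e) (inverse_image C e c) \<in> closed_subs C (Cod C g) \<psi>"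
      using ge eA gD(1) eg by (simp add: closed_morphism_def)
    moreover have "direct_image C (g \<cdot> e) (inverse_image C e c) = direct_image C g c"
      using direct_image_Comp[OF eA gD(1) eg inverse_image_closed[OF eA cc]] ec by simp
    ultimately show ?thesis by simp
  qed
  then show "G \<in> closed_arrows C"
    using gD(1-3) g(3) by (simp add: G' closed_morphism_def)
qed

lemma stably_continuous_E_cancel:
  assumes c: "stably_continuous C \<mu> \<phi> f" and E: "stably_in_E C \<mu> \<phi> f"
  shows "pullback_stable (PNS C)
    (right_cancelling (PNS C) (closed_arrows C)) (\<mu>, f, \<phi>)"
proof -
  interpret PNS: category "PNS C" by (rule PNS_category)
  note c' = c[unfolded stably_continuous_def stably_iff]
    and E' = E[unfolded stably_in_E_def stably_iff]
  have "Q \<in> right_cancelling (PNS C) (closed_arrows C)"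
    if P: "is_pullback (PNS C) (\<mu>, f, \<phi>) H P Q" for H P Q
  proof -
    obtain \<omega> h \<rho> p q where Q: "Q = (\<rho>, q, \<omega>)" using PNS_pullbackE[OF P] by metis
    have "continuous_morphism C \<rho> \<omega> q" using PNS.pullback_stableD(3)[OF c' P] by (simp add: Q)
    moreover have "stably_in_E C \<rho> \<omega> q"
      using PNS.pullback_stable_pullback[OF E' P] by (simp add: Q stably_in_E_def stably_iff)
    ultimately show ?thesis unfolding Q by (rule continuous_stably_E_cancel)
  qed
  then show ?thesis using c' by (simp add: pullback_stable_def)
qed

lemma comp_closed_closed:
  "comp_closed (PNS C) (closed_arrows C)"
  unfolding comp_closed_def by (auto intro: closed_morphism_Comp)

lemma perfect_iff:
  "perfect C \<mu> \<phi> f \<longleftrightarrow>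
    pullback_stable (PNS C) (closed_arrows C) (\<mu>, f, \<phi>) \<and>
    diagonal_stable (PNS C) (closed_arrows C) (\<mu>, f, \<phi>)"
  by (simp add: perfect_def proper_def stably_iff separated_iff)

text \<open>
  A diagonal is a section of a projection of the kernel pair, hence an embedding.
\<close>

lemma diagonal_pullbacks_exist:
  assumes "is_diagonal (PNS C) (\<mu>, f, \<phi>) P Q D"
  shows "pullbacks_exist (PNS C) D"
  using assms
proof (rule is_diagonal_PNSE)
  fix \<kappa> p q d
  assume D: "D = (\<mu>, d, \<kappa>)" and P: "pn_pullback C \<mu> \<phi> \<mu> f f \<kappa> p q" and d: "pn_morphism C \<mu> \<kappa> d"
    "d \<in> Hom C (Dom C f) (Dom C p)" "p \<cdot> d = Id C (Dom C f)"
  have "pn_embedding C \<mu> \<kappa> d"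
    by (rule section_embedding[OF d(1), of p]) (use P d in \<open>simp_all add: pn_pullback_def Hom_def\<close>)
  then show ?thesis
    using embedding_has_pn_pullbacks has_pn_pullbacks_iff[OF d(1)] by (simp add: D)
qed

lemma perfect_pullback:
  assumes f: "perfect C \<mu> \<phi> f" and P: "pn_pullback C \<mu> \<phi> \<omega> f h \<rho> p q"
  shows "perfect C \<rho> \<omega> q"
proof -
  interpret PNS: category "PNS C" by (rule PNS_category)
  show ?thesis
    using f pn_pullback_imp_PNS[OF P] unfolding perfect_iff
    by (auto intro: PNS.pullback_stable_pullback PNS.diagonal_stable_pullback PNS.pullback_stableD(2))
qed

lemma perfect_Comp:
  assumes f: "perfect C \<mu> \<phi> f" and g: "perfect C \<phi> \<psi> g" and fg: "Cod C f = Dom C g"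
  shows "perfect C \<mu> \<psi> (g \<cdot> f)"
proof -
  interpret PNS: category "PNS C" by (rule PNS_category)
  let ?K = "closed_arrows C" and ?f = "(\<mu>, f, \<phi>)" and ?g = "(\<phi>, g, \<psi>)"
  have F: "pullback_stable (PNS C) ?K ?f" "diagonal_stable (PNS C) ?K ?f"
    and G: "pullback_stable (PNS C) ?K ?g" "diagonal_stable (PNS C) ?K ?g"
    using f g by (simp_all add: perfect_iff)
  have FG: "Cod (PNS C) ?f = Dom (PNS C) ?g" using fg by simp
  have 1: "pullback_stable (PNS C) ?K (?g \<cdot>\<^bsub>PNS C\<^esub> ?f)"
    by (rule PNS.pullback_stable_Comp[OF comp_closed_closed F(1) G(1) FG])
  then have "\<exists>p q. is_pullback (PNS C) (?g \<cdot>\<^bsub>PNS C\<^esub> ?f) (?g \<cdot>\<^bsub>PNS C\<^esub> ?f) p q"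
    unfolding pullback_stable_def pullbacks_exist_def by blast
  then have "diagonal_stable (PNS C) ?K (?g \<cdot>\<^bsub>PNS C\<^esub> ?f)"
    by (rule PNS.diagonal_stable_Comp[OF comp_closed_closed F(2) G(2) FG])
  with 1 show ?thesis by (simp add: perfect_iff)
qed

lemma proper_cancel_left:
  assumes gf: "proper C \<mu> \<psi> (g \<cdot> f)" and g: "separated C \<phi> \<psi> g"
    and f: "pn_morphism C \<mu> \<phi> f" and fg: "Cod C f = Dom C g"
  shows "proper C \<mu> \<phi> f"
proof -
  interpret PNS: category "PNS C" by (rule PNS_category)
  let ?K = "closed_arrows C" and ?f = "(\<mu>, f, \<phi>)" and ?g = "(\<phi>, g, \<psi>)"
  have "pullback_stable (PNS C) ?K (?g \<cdot>\<^bsub>PNS C\<^esub> ?f)" "diagonal_stable (PNS C) ?K ?g"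
    "?f \<in> Arr (PNS C)" "Cod (PNS C) ?f = Dom (PNS C) ?g"
    using gf g f fg by (simp_all add: proper_def stably_iff separated_iff)
  then have "pullback_stable (PNS C) ?K ?f"
    by (rule PNS.pullback_stable_cancel_left[OF comp_closed_closed])
  then show ?thesis by (simp add: proper_def stably_iff)
qed

lemma perfect_cancel_left:
  assumes gf: "perfect C \<mu> \<psi> (g \<cdot> f)" and g: "separated C \<phi> \<psi> g"
    and f: "pn_morphism C \<mu> \<phi> f" and fg: "Cod C f = Dom C g"
  shows "perfect C \<mu> \<phi> f"
proof -
  interpret PNS: category "PNS C" by (rule PNS_category)
  let ?K = "closed_arrows C" and ?f = "(\<mu>, f, \<phi>)" and ?g = "(\<phi>, g, \<psi>)"
  have p: "proper C \<mu> \<phi> f"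
    using gf proper_cancel_left[OF _ g f fg] by (simp add: perfect_def)
  then have "\<exists>P Q. is_pullback (PNS C) ?f ?f P Q"
    unfolding proper_def stably_iff pullback_stable_def pullbacks_exist_def by blast
  moreover have "diagonal_stable (PNS C) ?K (?g \<cdot>\<^bsub>PNS C\<^esub> ?f)"
    using gf by (simp add: perfect_iff)
  moreover have "?g \<in> Arr (PNS C)" "?f \<in> Arr (PNS C)" "Cod (PNS C) ?f = Dom (PNS C) ?g"
    using g f fg by (simp_all add: separated_def)
  ultimately have "diagonal_stable (PNS C) ?K ?f"
    by - (rule PNS.diagonal_stable_cancel_left)
  with p show ?thesis by (simp add: perfect_def separated_iff)
qed

lemma perfect_cancel_right:
  assumes gf: "perfect C \<mu> \<psi> (g \<cdot> f)" and f: "proper C \<mu> \<phi> f" "stably_continuous C \<mu> \<phi> f"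
    "stably_in_E C \<mu> \<phi> f" and g: "pn_morphism C \<phi> \<psi> g" "has_pn_pullbacks C \<phi> \<psi> g"
    and fg: "Cod C f = Dom C g"
  shows "perfect C \<phi> \<psi> g"
proof -
  interpret PNS: category "PNS C" by (rule PNS_category)
  let ?K = "closed_arrows C" and ?f = "(\<mu>, f, \<phi>)" and ?g = "(\<phi>, g, \<psi>)"
  have GF: "pullback_stable (PNS C) ?K (?g \<cdot>\<^bsub>PNS C\<^esub> ?f)" "diagonal_stable (PNS C) ?K (?g \<cdot>\<^bsub>PNS C\<^esub> ?f)"
    using gf by (simp_all add: perfect_iff)
  have F: "pullback_stable (PNS C) ?K ?f" using f(1) by (simp add: proper_def stably_iff)
  note F' = stably_continuous_E_cancel[OF f(2,3)]
  have G: "?g \<in> Arr (PNS C)" "pullbacks_exist (PNS C) ?g" and FG: "Cod (PNS C) ?f = Dom (PNS C) ?g"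
    using g has_pn_pullbacks_iff[OF g(1)] fg by simp_all
  have "pullback_stable (PNS C) ?K ?g"
    by (rule PNS.pullback_stable_cancel_right[OF GF(1) F' G(2,1) FG])
  moreover have "diagonal_stable (PNS C) ?K ?g"
    by (rule PNS.diagonal_stable_cancel_right[OF comp_closed_closed GF(2) F F' G FG
          diagonal_pullbacks_exist])
  ultimately show ?thesis by (simp add: perfect_iff)
qed

lemma closed_embedding_perfect:
  assumes cont: "\<And>\<mu> \<phi> f. pn_morphism C \<mu> \<phi> f \<Longrightarrow> continuous_morphism C \<mu> \<phi> f"
    and m: "closed_embedding C \<mu> m"
  shows "perfect C (restrict_pns C \<mu> m) \<mu> m"
proof -
  have "m \<in> MM C" "is_pns C (Cod C m) \<mu>" "subobj C m \<in> closed_subs C (Cod C m) \<mu>"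
    using m by (simp_all add: closed_embedding_def)
  then show ?thesis
    using closed_embedding_proper[OF cont] embedding_separated restrict_pns_embedding
    by (simp add: perfect_def)
qed

end

theorem mainTheorem19:
  fixes C :: "('o, 'a) fact_category" (structure)
  assumes "nbd_context C"
  shows
    "(\<forall>\<mu> \<phi> \<omega> f h \<rho> p q.
        perfect C \<mu> \<phi> f \<and> pn_pullback C \<mu> \<phi> \<omega> f h \<rho> p q \<longrightarrow> perfect C \<rho> \<omega> q) \<and>
     (\<forall>\<mu> \<phi> \<psi> f g.
        perfect C \<mu> \<phi> f \<and> perfect C \<phi> \<psi> g \<and> Cod C f = Dom C g \<longrightarrow>
        perfect C \<mu> \<psi> (g \<cdot> f)) \<and>
     ((\<forall>\<mu> \<phi> f. pn_morphism C \<mu> \<phi> f \<longrightarrow> continuous_morphism C \<mu> \<phi> f) \<longrightarrow>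
        (\<forall>\<mu> m. closed_embedding C \<mu> m \<longrightarrow> perfect C (restrict_pns C \<mu> m) \<mu> m)) \<and>
     (\<forall>\<mu> \<phi> \<psi> f g.
        pn_morphism C \<mu> \<phi> f \<and> pn_morphism C \<phi> \<psi> g \<and> Cod C f = Dom C g \<longrightarrow>
        (perfect C \<mu> \<psi> (g \<cdot> f) \<and> proper C \<mu> \<phi> f \<and> stably_continuous C \<mu> \<phi> f \<and>
           stably_in_E C \<mu> \<phi> f \<and> has_pn_pullbacks C \<phi> \<psi> g \<longrightarrow> perfect C \<phi> \<psi> g) \<and>
        (proper C \<mu> \<psi> (g \<cdot> f) \<and> separated C \<phi> \<psi> g \<longrightarrow> proper C \<mu> \<phi> f) \<and>
        (perfect C \<mu> \<psi> (g \<cdot> f) \<and> separated C \<phi> \<psi> g \<longrightarrow> perfect C \<mu> \<phi> f))"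
proof -
  interpret nbd_context C by (rule assms)
  show ?thesis
  proof (intro conjI allI impI)
    fix \<mu> \<phi> \<omega> f h \<rho> p q
    assume "perfect C \<mu> \<phi> f \<and> pn_pullback C \<mu> \<phi> \<omega> f h \<rho> p q"
    then show "perfect C \<rho> \<omega> q" using perfect_pullback by blast
  next
    fix \<mu> \<phi> \<psi> f g
    assume "perfect C \<mu> \<phi> f \<and> perfect C \<phi> \<psi> g \<and> Cod C f = Dom C g"
    then show "perfect C \<mu> \<psi> (g \<cdot> f)" using perfect_Comp by blast
  next
    fix \<mu> m
    assume "\<forall>\<mu> \<phi> f. pn_morphism C \<mu> \<phi> f \<longrightarrow> continuous_morphism C \<mu> \<phi> f"
      and "closed_embedding C \<mu> m"
    then show "perfect C (restrict_pns C \<mu> m) \<mu> m" using closed_embedding_perfect by blast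
  next
    fix \<mu> \<phi> \<psi> f g
    assume fg: "pn_morphism C \<mu> \<phi> f \<and> pn_morphism C \<phi> \<psi> g \<and> Cod C f = Dom C g"
    show "perfect C \<phi> \<psi> g"
      if "perfect C \<mu> \<psi> (g \<cdot> f) \<and> proper C \<mu> \<phi> f \<and> stably_continuous C \<mu> \<phi> f \<and>
        stably_in_E C \<mu> \<phi> f \<and> has_pn_pullbacks C \<phi> \<psi> g"
      using that fg perfect_cancel_right by blast
    show "proper C \<mu> \<phi> f" if "proper C \<mu> \<psi> (g \<cdot> f) \<and> separated C \<phi> \<psi> g"
      using that fg proper_cancel_left by blast
    show "perfect C \<mu> \<phi> f" if "perfect C \<mu> \<psi> (g \<cdot> f) \<and> separated C \<phi> \<psi> g"
      using that fg perfect_cancel_left by blast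
  qed
qed

end
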